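(* Let $\{\mathbb{K}_2(i/b,s_i)\}_{i\in(\mathbb{Z}/b\mathbb{Z})^\times}$ be a Galois family, $r=1/b$, $s=s_1$, and let $f_{r,s}=\sum_{i\in(\mathbb{Z}/b\mathbb{Z})^\times}\beta_i\,\mathbb{K}_2(i/b,s_i)$, $\beta_i\in\overline{\mathbb{Q}}$, be the associated Hecke eigenform. Then $$L(f_{r,s},1)=\sum_{i\in(\mathbb{Z}/b\mathbb{Z})^\times}\beta_i\cdot F(i/b,s_i).$$
   Context: Let $\eta$ be the Dedekind eta function. For rational $r,s$ define $$\mathbb{K}_2(r,s)(\tau)=\frac{\eta(\tau/2)^{16s-8r-12}\,\eta(2\tau)^{8r+8s-12}}{\eta(\tau)^{24s-30}} .$$ Let $\mathbb{S}_2'=\{(r,s)\in\mathbb{Q}^2 : 0<r<s<3/2,\ 24s\in\mathbb{Z},\ 8(r+s)\in\mathbb{Z}\}$. Put $N(r)=48/\gcd(24r,24)$, which equals $2b$ when $r$ has denominator $b$ in lowest terms. When no variable is written, $\mathbb{K}_2(r,s)$ means $\mathbb{K}_2(r,s)(N(r)\tau)$, expanded in $q=e^{2\pi i\tau}$; for $(r,s)\in\mathbb{S}_2'$ it is a weight 3 cusp form. For such a form $f=\sum a_nq^n$, $L(f,s)$ is the analytic continuation of $\sum a_n n^{-s}$. The normalized hypergeometric value is $$F(r,s)=\frac{2^{1-4r}B(r,s-r)}{N(r)}\;{}_3F_2\!\left[\begin{matrix}1/2,\,1/2,\,r\\ 1,\,s\end{matrix};1\right],$$ where $B$ is the beta function.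 Conjugates: let $M$ be the least common denominator of $1/2,r,s$. Pairs $(r,s)$ and $(r',s')$ are conjugate if there is an integer $c$ coprime to $M$ with $r-cr'\in\mathbb{Z}$ and $s-cs'\in\mathbb{Z}$. A family is the set of conjugates in $\mathbb{S}_2'$ of a given pair. A family of conjugates $\{(r_i,s_i)\}_i$ is Galois if $r_i\ne r_j$ for $i\neq j$; it is then written $\{\mathbb{K}_2(i/b,s_i)\}_{i\in(\mathbb{Z}/b\mathbb{Z})^\times}$ (residues represented by $0<i<b$). For each Galois family there is a Hecke eigenform (simultaneous eigenvector of $T_p$ for $p$ coprime to 6) that is a linear combination of the members of the family with coefficients $\beta_i\in\overline{\mathbb{Q}}$, $\beta_1=1$; one such choice (unique up to quadratic twist) is fixed and called $f_{r,s}$. *)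

theory Defs
  imports
    "HOL-Complex_Analysis.Complex_Analysis"
    "HOL-Number_Theory.Totient"
begin

definition uhp :: "complex set" where
  "uhp = {\<tau>. Im \<tau> > 0}"

definition dedekind_eta :: "complex \<Rightarrow> complex" where
  "dedekind_eta \<tau> =
     exp (2 * of_real pi * \<i> * \<tau> / 24) *
     (\<Prod>n. 1 - exp (2 * of_real pi * \<i> * of_nat (Suc n) * \<tau>))"

text \<open>
  The power \<open>\<eta>(\<tau>)\<^sup>x\<close> for a real exponent, using the branch of \<open>log \<eta>\<close> on the upper half-plane
  that is real on the imaginary axis. Each factor \<open>1 - q\<^sup>n\<close> has positive real part, so the
  principal power is the right one factor by factor. For an integer exponent this is the usual
  integer power of \<open>dedekind_eta\<close>; all exponents are integers on the set \<open>S2'\<close> below.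
\<close>
definition eta_pow :: "complex \<Rightarrow> real \<Rightarrow> complex" where
  "eta_pow \<tau> x =
     exp (2 * of_real pi * \<i> * \<tau> * of_real x / 24) *
     (\<Prod>n. (1 - exp (2 * of_real pi * \<i> * of_nat (Suc n) * \<tau>)) powr of_real x)"

lemma eta_pow_of_int:
  assumes "\<tau> \<in> uhp"
  shows "eta_pow \<tau> (of_int m) = dedekind_eta \<tau> powi m"
proof -
  define q where "q = exp (2 * of_real pi * \<i> * \<tau>)"
  define g where "g = (\<lambda>n::nat. 1 - exp (2 * of_real pi * \<i> * of_nat (Suc n) * \<tau>))"
  have g_q: "g n = 1 - q ^ Suc n" for n
    unfolding g_def q_def exp_of_nat_mult [symmetric] by (simp add: algebra_simps)
  have q: "norm q < 1"
    using assms by (simp add: q_def uhp_def)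
  have q0: "q \<noteq> 0"
    by (simp add: q_def)
  have nz: "g n \<noteq> 0" for n
  proof
    assume "g n = 0"
    then have "norm q ^ Suc n = 1"
      by (metis g_q eq_iff_diff_eq_0 norm_one norm_power)
    moreover have "norm q ^ Suc n < 1"
      using q by (intro power_Suc_less_one) (auto simp: q0)
    ultimately show False by simp
  qed
  have "summable (\<lambda>n. norm (g n - 1))"
    using q by (simp add: g_q norm_power norm_mult summable_mult summable_geometric)
  then have "convergent_prod g"
    by (simp add: abs_convergent_prod_conv_summable [symmetric] abs_convergent_prod_imp_convergent_prod)
  then obtain P where P: "P \<noteq> 0" "(\<lambda>n. \<Prod>i\<le>n. g i) \<longlonglongrightarrow> P"
    using nz convergent_prod_iff_nz_lim by blast
  have prod_g: "prodinf g = P"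
    using P nz \<open>convergent_prod g\<close> by (simp add: prodinf_eq_lim limI)
  have powi_eq: "g n powr of_real (of_int m) = g n powi m" for n
    using nz by (simp add: powr_of_int power_int_def power_inverse)
  have prod_powi: "(\<Prod>i\<le>n. g i powi m) = (\<Prod>i\<le>n. g i) powi m" for n
    by (induction n) (simp_all add: power_int_mult_distrib)
  have "(\<lambda>n. (\<Prod>i\<le>n. g i) powi m) \<longlonglongrightarrow> P powi m"
    using P by (intro tendsto_intros)
  then have lim: "(\<lambda>n. \<Prod>i\<le>n. g i powi m) \<longlonglongrightarrow> P powi m"
    by (simp add: prod_powi)
  moreover have "P powi m \<noteq> 0"
    using P by simp
  ultimately have "convergent_prod (\<lambda>n. g n powi m)"
    using nz by (subst convergent_prod_iff_nz_lim) auto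
  then have "prodinf (\<lambda>n. g n powi m) = P powi m"
    using lim nz by (simp add: prodinf_eq_lim limI)
  moreover have "exp (2 * of_real pi * \<i> * \<tau> * of_real (of_int m) / 24) =
      exp (2 * of_real pi * \<i> * \<tau> / 24) powi m"
    by (simp add: exp_power_int algebra_simps)
  ultimately show ?thesis
    unfolding eta_pow_def dedekind_eta_def g_def [symmetric] power_int_mult_distrib
    by (simp only: powi_eq prod_g g_def [symmetric] fun_cong [OF g_def, symmetric])
qed

definition K2 :: "rat \<Rightarrow> rat \<Rightarrow> complex \<Rightarrow> complex" where
  "K2 r s \<tau> =
     eta_pow (\<tau> / 2) (of_rat (16 * s - 8 * r - 12)) *
     eta_pow (2 * \<tau>) (of_rat (8 * r + 8 * s - 12)) /
     eta_pow \<tau> (of_rat (24 * s - 30))"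

definition S2' :: "(rat \<times> rat) set" where
  "S2' = {(r, s). 0 < r \<and> r < s \<and> s < 3 / 2 \<and> 24 * s \<in> \<int> \<and> 8 * (r + s) \<in> \<int>}"

text \<open>On \<open>S2'\<close> the number \<open>24 * r\<close> is an integer, so the floor does nothing there.\<close>
definition N2 :: "rat \<Rightarrow> int" where
  "N2 r = 48 div gcd \<lfloor>24 * r\<rfloor> 24"

definition K2_form :: "rat \<Rightarrow> rat \<Rightarrow> complex \<Rightarrow> complex" where
  "K2_form r s \<tau> = K2 r s (of_int (N2 r) * \<tau>)"

text \<open>
  \<open>eval_fps\<close> is defined as the sum of the series, and makes sense at the boundary point 1: the
  series converges there when \<open>r < s\<close>.
\<close>
definition F_val :: "rat \<Rightarrow> rat \<Rightarrow> real" where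
  "F_val r s =
     2 powr (1 - 4 * of_rat r) * Beta (of_rat r) (of_rat (s - r)) / of_int (N2 r) *
     eval_fps (fps_hypergeo [1 / 2, 1 / 2, of_rat r] [1, of_rat s] 1) 1"

definition rat_denom :: "rat \<Rightarrow> int" where
  "rat_denom r = snd (quotient_of r)"

definition common_denom :: "rat \<Rightarrow> rat \<Rightarrow> int" where
  "common_denom r s = lcm 2 (lcm (rat_denom r) (rat_denom s))"

text \<open>
  The multiplier \<open>c\<close> is required to be coprime to the common denominators of both pairs. It then
  acts invertibly on both, which makes conjugacy an equivalence relation and makes conjugate pairs
  have the same common denominator. Coprimality to the common denominator of one pair only would
  not be symmetric: with \<open>c = 3\<close> it would relate \<open>(1/8, 3/4)\<close> to \<open>(1/24, 7/12)\<close>.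
\<close>
definition conjugate_pairs :: "rat \<times> rat \<Rightarrow> rat \<times> rat \<Rightarrow> bool" where
  "conjugate_pairs = (\<lambda>(r, s) (r', s').
     \<exists>c::int. coprime c (common_denom r s) \<and> coprime c (common_denom r' s') \<and>
       r - of_int c * r' \<in> \<int> \<and> s - of_int c * s' \<in> \<int>)"

definition conjugate_family :: "rat \<times> rat \<Rightarrow> (rat \<times> rat) set" where
  "conjugate_family P = {Q \<in> S2'. conjugate_pairs P Q}"

definition galois_family :: "(rat \<times> rat) set \<Rightarrow> bool" where
  "galois_family \<F> \<longleftrightarrow> (\<exists>P\<in>S2'. \<F> = conjugate_family P) \<and> inj_on fst \<F>"

definition slash :: "nat \<Rightarrow> int \<Rightarrow> int \<Rightarrow> int \<Rightarrow> int \<Rightarrow> (complex \<Rightarrow> complex) \<Rightarrow> complex \<Rightarrow> complex" where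
  "slash k a b c d f \<tau> =
     of_int (a * d - b * c) ^ (k - 1) *
     f ((of_int a * \<tau> + of_int b) / (of_int c * \<tau> + of_int d)) / (of_int c * \<tau> + of_int d) ^ k"

text \<open>
  Cusp forms for \<open>\<Gamma>\<^sub>1(L)\<close>. Every cusp is the image of infinity under some
  element of \<open>SL\<^sub>2(\<int>)\<close>; for a form that is holomorphic on the upper half-plane, having a Fourier
  expansion with only positive exponents amounts to tending to 0 as the imaginary part grows.
\<close>
definition cusp_form :: "nat \<Rightarrow> nat \<Rightarrow> (complex \<Rightarrow> complex) \<Rightarrow> bool" where
  "cusp_form k L f \<longleftrightarrow>
     f holomorphic_on uhp \<and>
     (\<forall>a b c d. a * d - b * c = 1 \<longrightarrow> [a = 1] (mod int L) \<longrightarrow> [d = 1] (mod int L) \<longrightarrow>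
        [c = 0] (mod int L) \<longrightarrow> (\<forall>\<tau>\<in>uhp. slash k a b c d f \<tau> = f \<tau>)) \<and>
     (\<forall>a b c d. a * d - b * c = 1 \<longrightarrow> (slash k a b c d f \<longlongrightarrow> 0) (filtercomap Im at_top))"

text \<open>
  The diamond operator for \<open>d\<close> coprime to \<open>L\<close> (with \<open>L > 0\<close>): its value on a form for \<open>\<Gamma>\<^sub>1(L)\<close> does
  not depend on the chosen matrix.
\<close>
definition diamond :: "nat \<Rightarrow> nat \<Rightarrow> int \<Rightarrow> (complex \<Rightarrow> complex) \<Rightarrow> complex \<Rightarrow> complex" where
  "diamond k L d f =
     (let (a, b, c, e) = (SOME (a, b, c, e). a * e - b * c = 1 \<and>
                            [c = 0] (mod int L) \<and> [e = d] (mod int L))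
      in slash k a b c e f)"

text \<open>
  The Hecke operator \<open>T\<^sub>p\<close> for a prime \<open>p\<close> not dividing the level. On Fourier coefficients it is
  \<open>a\<^sub>n(T\<^sub>p f) = a\<^sub>p\<^sub>n(f) + p\<^bsup>k-1\<^esup> a\<^bsub>n/p\<^esub>(\<langle>p\<rangle>f)\<close>.
\<close>
definition hecke :: "nat \<Rightarrow> nat \<Rightarrow> nat \<Rightarrow> (complex \<Rightarrow> complex) \<Rightarrow> complex \<Rightarrow> complex" where
  "hecke k L p f \<tau> =
     (\<Sum>j<p. slash k 1 (int j) 0 (int p) f \<tau>) +
     slash k (int p) 0 0 1 (diamond k L (int p) f) \<tau>"

text \<open>
  Simultaneous eigenvectors of \<open>T\<^sub>p\<close> for all primes \<open>p\<close> coprime to \<open>D\<close>. The level is left open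
  except that it only has prime factors dividing \<open>D\<close>, so that all these \<open>T\<^sub>p\<close> are of the form above;
  they do not depend on which such level is taken.
\<close>
definition hecke_eigenform :: "nat \<Rightarrow> nat \<Rightarrow> (complex \<Rightarrow> complex) \<Rightarrow> bool" where
  "hecke_eigenform D k f \<longleftrightarrow>
     (\<exists>L>0. (\<forall>p. prime p \<longrightarrow> p dvd L \<longrightarrow> p dvd D) \<and> cusp_form k L f \<and>
        (\<exists>\<tau>\<in>uhp. f \<tau> \<noteq> 0) \<and>
        (\<forall>p. prime p \<longrightarrow> coprime p D \<longrightarrow>
           (\<exists>ev. \<forall>\<tau>\<in>uhp. hecke k L p f \<tau> = ev * f \<tau>)))"

definition q_coeffs :: "(complex \<Rightarrow> complex) \<Rightarrow> nat \<Rightarrow> complex" where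
  "q_coeffs f = (THE a. \<forall>\<tau>\<in>uhp. (\<lambda>n. a n * exp (2 * of_real pi * \<i> * of_nat n * \<tau>)) sums f \<tau>)"

text \<open>
  For a cusp form the analytic continuation of the Dirichlet series is entire, and it is unique by
  the identity theorem.
\<close>
definition L_fun :: "(complex \<Rightarrow> complex) \<Rightarrow> complex \<Rightarrow> complex" where
  "L_fun f = (THE g. g holomorphic_on UNIV \<and>
     (\<exists>\<sigma>. \<forall>z. Re z > \<sigma> \<longrightarrow>
        (\<lambda>n. q_coeffs f (Suc n) / of_nat (Suc n) powr z) sums g z))"

end

theory Submission
  imports Defs "HOL-Real_Asymp.Real_Asymp"
begin

text \<open>
Both sides are integrals over the imaginary axis. For a cusp form \<open>f\<close> of moderate growth near the
real line, the Mellin transform of \<open>y \<mapsto> f(iy)\<close> is entire and equals \<open>(2\<pi>)\<^bsup>-z\<^esup> \<Gamma>(z) L(f, z)\<close>, so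
that \<open>L(f, 1) = 2\<pi> \<integral> f(iy) dy\<close> (\<open>L_fun_cusp_form_at_1\<close>). The integral is linear in \<open>f\<close>, and it
remains to integrate a single \<open>K\<^sub>2(r,s)\<close> over the imaginary axis. Its integrability there comes out of
the substitution below, while the decay of \<open>f\<close> at both ends of the axis comes from its modularity.

With the nome \<open>q = exp(\<pi>i\<tau>)\<close> and the classical theta constants, the eta quotient is
\<open>K\<^sub>2(r,s) = 16\<^bsup>-r\<^esup> \<lambda>\<^bsup>r\<^esup> (1 - \<lambda>)\<^bsup>s-r\<^esup> \<theta>\<^sub>3\<^sup>6\<close>, where \<open>\<lambda> = \<theta>\<^sub>2\<^sup>4/\<theta>\<^sub>3\<^sup>4\<close> is the modular lambda function. On the
imaginary axis \<open>t = \<lambda>\<close> runs once through the interval from 0 to 1, and there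
\<open>dt = -\<pi> t (1 - t) \<theta>\<^sub>3\<^sup>4 dy\<close> and \<open>\<theta>\<^sub>3\<^sup>2 = \<^sub>2F\<^sub>1(1/2, 1/2; 1; t)\<close>. The substitution therefore turns
\<open>\<integral> K\<^sub>2(iy) dy\<close> into a constant times \<open>\<integral> t\<^bsup>r-1\<^esup> (1 - t)\<^bsup>s-r-1\<^esup> \<^sub>2F\<^sub>1(1/2, 1/2; 1; t) dt\<close>, which is Euler's
integral for \<open>B(r, s - r) \<^sub>3F\<^sub>2(1/2, 1/2, r; 1, s; 1)\<close> (\<open>hypergeo_beta_integral\<close>,
\<open>K2_imaginary_axis_integral\<close>).

These facts about \<open>\<lambda>\<close> have one source. The theta identities that double the nome
express everything at \<open>q\<close> through the same quantities at \<open>q\<^sup>2\<close> (\<open>modular_lambda_landen\<close>); if a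
quotient of two expressions is unchanged by \<open>q \<mapsto> q\<^sup>2\<close> and continuous at \<open>q = 0\<close>, then it is
constant (\<open>square_invariant_const\<close>). For the derivative of \<open>\<lambda>\<close> this needs only calculus
(\<open>modular_lambda_has_derivative\<close>), for the hypergeometric function it needs Landen's
transformation (\<open>hyp_half_landen\<close>, \<open>hyp_half_modular_lambda\<close>), and the limit of \<open>\<lambda>\<close> for \<open>q \<rightarrow> 1\<close> is
the positive fixed point of the doubling map (\<open>modular_lambda_exceeds\<close>).

The theta identities come from rearranging sums over the square lattice according to the parity of
the sum of the coordinates (\<open>theta_phi_square\<close>, \<open>theta_psi_square\<close>). Their link to the eta function is
Gauss's product for the sum over the triangular numbers (\<open>theta_psi_product\<close>), from which the other
products follow (\<open>theta_products\<close>).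
\<close>

section \<open>Euler products and Gauss's product for the triangular theta series\<close>

text \<open>
Ramanujan's \<open>\<phi>(q) = \<Sum> q\<^bsup>n\<^sup>2\<^esup>\<close> over all integers, that is, \<open>\<theta>\<^sub>3\<close> in the nome \<open>q\<close>; then \<open>\<phi>(-q)\<close> is \<open>\<theta>\<^sub>4\<close>.
The one-sided form makes it a power series over the real and the complex numbers alike.
\<close>
definition theta_phi :: "'a::{real_normed_field,banach} \<Rightarrow> 'a" where
  "theta_phi q = 2 * (\<Sum>n. q ^ (n ^ 2)) - 1"

text \<open>
Ramanujan's \<open>\<psi>\<close>, the sum over the triangular numbers; \<open>\<theta>\<^sub>2 = 2 q\<^bsup>1/4\<^esup> \<psi>(q\<^sup>2)\<close> in the nome \<open>q\<close>.
\<close>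
definition theta_psi :: "'a::{real_normed_field,banach} \<Rightarrow> 'a" where
  "theta_psi q = (\<Sum>n. q ^ (n * (n + 1) div 2))"

definition euler_prod :: "complex \<Rightarrow> complex" where
  "euler_prod q = (\<Prod>n. 1 - q ^ Suc n)"

definition odd_prod :: "complex \<Rightarrow> complex" where
  "odd_prod q = (\<Prod>n. 1 - q ^ (2 * n + 1))"

lemma one_minus_power_nz:
  fixes q :: "'a::real_normed_field"
  assumes "norm q < 1" "n > 0"
  shows "1 - q ^ n \<noteq> 0"
proof
  assume "1 - q ^ n = 0"
  hence "norm q ^ n = 1" by (metis eq_iff_diff_eq_0 norm_one norm_power)
  moreover have "norm q ^ n < 1" using assms by (simp add: power_less_one_iff)
  ultimately show False by simp
qed

lemma summable_power_comp:
  fixes q :: "'a::{real_normed_field,banach}"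
  assumes "norm q < 1" "\<And>n. e n \<ge> n"
  shows "summable (\<lambda>n. norm (q ^ e n))"
proof (rule summable_comparison_test)
  show "\<exists>N. \<forall>n\<ge>N. norm (norm (q ^ e n)) \<le> norm q ^ n"
    using assms by (auto simp: norm_power intro!: power_decreasing)
  show "summable (\<lambda>n. norm q ^ n)" using assms by (simp add: summable_geometric)
qed

lemma convergent_prod_one_minus_power:
  fixes q :: complex
  assumes "norm q < 1" "\<And>n. e n \<ge> n"
  shows "convergent_prod (\<lambda>n. 1 - q ^ e n)"
  using summable_power_comp[OF assms]
  by (intro abs_convergent_prod_imp_convergent_prod)
     (simp add: abs_convergent_prod_conv_summable)

lemma prodinf_one_minus_power_nz:
  fixes q :: complex
  assumes "norm q < 1" "\<And>n. e n \<ge> n" "\<And>n. e n > 0"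
  shows "(\<Prod>n. 1 - q ^ e n) \<noteq> 0"
  using convergent_prod_one_minus_power[OF assms(1,2)] assms
  by (intro prodinf_nonzero) (use one_minus_power_nz in blast)+

lemma euler_prod_nz: "norm q < 1 \<Longrightarrow> euler_prod q \<noteq> 0"
  unfolding euler_prod_def by (rule prodinf_one_minus_power_nz) auto

lemma odd_prod_nz: "norm q < 1 \<Longrightarrow> odd_prod q \<noteq> 0"
  unfolding odd_prod_def by (rule prodinf_one_minus_power_nz) auto

lemma norm_power_less_1:
  fixes q :: "'a::real_normed_div_algebra"
  shows "norm q < 1 \<Longrightarrow> n > 0 \<Longrightarrow> norm (q ^ n) < 1"
  by (simp add: norm_power power_less_one_iff)

lemma euler_prod_split:
  assumes "norm q < 1"
  shows "euler_prod q = euler_prod (q\<^sup>2) * odd_prod q"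
proof -
  have q2: "norm (q\<^sup>2) < 1" using assms by (simp add: norm_power_less_1)
  have "(\<lambda>n. \<Prod>i\<le>n. 1 - q ^ Suc i) \<longlonglongrightarrow> euler_prod q"
    unfolding euler_prod_def using assms by (intro convergent_prod_LIMSEQ convergent_prod_one_minus_power) auto
  hence "(\<lambda>n. \<Prod>i\<le>2*n+1. 1 - q ^ Suc i) \<longlonglongrightarrow> euler_prod q"
    by (rule LIMSEQ_subseq_LIMSEQ[unfolded o_def]) (auto simp: strict_mono_def)
  moreover have "(\<lambda>n. \<Prod>i\<le>2*n+1. 1 - q ^ Suc i) =
      (\<lambda>n. (\<Prod>i\<le>n. 1 - (q\<^sup>2) ^ Suc i) * (\<Prod>i\<le>n. 1 - q ^ (2*i+1)))"
  proof
    fix n show "(\<Prod>i\<le>2*n+1. 1 - q ^ Suc i) = 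
      (\<Prod>i\<le>n. 1 - (q\<^sup>2) ^ Suc i) * (\<Prod>i\<le>n. 1 - q ^ (2*i+1))"
    proof (induction n)
      case 0
      show ?case by (simp add: power2_eq_square)
    next
      case (Suc n)
      have "2 * Suc n + 1 = Suc (Suc (2*n+1))" by simp
      then have "(\<Prod>i\<le>2*Suc n+1. 1 - q ^ Suc i) =
         (\<Prod>i\<le>2*n+1. 1 - q ^ Suc i) * ((1 - q ^ (2*Suc n+1)) * (1 - q ^ (2 * Suc (Suc n))))"
        by (simp add: mult.assoc del: power_Suc)
      also have "1 - q ^ (2 * Suc (Suc n)) = 1 - (q\<^sup>2) ^ Suc (Suc n)"
        by (simp only: power_mult)
      finally show ?case by (simp only: Suc.IH prod.atMost_Suc) (simp only: mult_ac)
    qed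
  qed
  moreover have "(\<lambda>n. (\<Prod>i\<le>n. 1 - (q\<^sup>2) ^ Suc i) * (\<Prod>i\<le>n. 1 - q ^ (2*i+1)))
     \<longlonglongrightarrow> euler_prod (q\<^sup>2) * odd_prod q"
    unfolding euler_prod_def odd_prod_def using assms q2
    by (intro tendsto_mult convergent_prod_LIMSEQ convergent_prod_one_minus_power) auto
  ultimately show ?thesis using LIMSEQ_unique by metis
qed

text \<open>
This relation gives access to products at \<open>-q\<close>, hence to \<open>\<theta>\<^sub>4\<close>.
\<close>
lemma odd_prod_mult_neg:
  assumes "norm q < 1"
  shows "odd_prod q * odd_prod (-q) = odd_prod (q\<^sup>2)"
proof -
  have *: "(1 - q ^ (2*n+1)) * (1 - (-q) ^ (2*n+1)) = 1 - (q\<^sup>2) ^ (2*n+1)" for n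
  proof -
    have "(-q) ^ (2*n+1) = - (q ^ (2*n+1))" by (simp add: power_mult)
    moreover have "(q\<^sup>2) ^ (2*n+1) = q ^ (2*n+1) * q ^ (2*n+1)"
      by (simp only: power2_eq_square power_mult_distrib)
    ultimately show ?thesis by (simp add: algebra_simps)
  qed
  have c: "convergent_prod (\<lambda>n. 1 - q ^ (2*n+1))" "convergent_prod (\<lambda>n. 1 - (-q) ^ (2*n+1))"
    using convergent_prod_one_minus_power[of q "\<lambda>n. 2 * n + 1"]
      convergent_prod_one_minus_power[of "-q" "\<lambda>n. 2 * n + 1"] assms by simp_all
  show ?thesis unfolding odd_prod_def
    using prodinf_mult[OF c] by (simp only: *)
qed

text \<open>
Shanks' finite form of Gauss's identity. When \<open>n\<close> grows by one, the change of the summand on the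
left is a difference in \<open>s\<close>, so the sum of the changes telescopes and leaves the two new powers on the
right.
\<close>
lemma shanks_identity:
  fixes x :: "'a::real_normed_field"
  assumes x: "norm x < 1"
  defines "p \<equiv> \<lambda>n. \<Prod>s<n. (1 - x ^ (2 * s+2)) / (1 - x ^ (2 * s+1))"
  shows "(\<Sum>s<n. p n / p s * x ^ (s * (2*n+1))) = (\<Sum>i<2*n. x ^ (i * (i+1) div 2))"
proof (induction n)
  case 0
  show ?case by simp
next
  case (Suc n)
  have nz: "1 - x ^ k \<noteq> 0" if "k > 0" for k
    using one_minus_power_nz[OF x that] .
  have pnz: "p k \<noteq> 0" for k
    unfolding p_def by (auto simp: prod_zero_iff nz simp del: power_Suc right_minus_eq)
  have pS: "p (Suc k) = p k * (1 - x ^ (2*k+2)) / (1 - x ^ (2*k+1))" for k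
    by (simp add: p_def)
  define y where "y = x ^ (2*n+1)"
  have y1: "1 - y \<noteq> 0" using nz[of "2*n+1"] by (simp add: y_def del: right_minus_eq)
  \<comment> \<open>the antidifference in \<open>s\<close>; it vanishes at 0, so only its value at \<open>n\<close> remains\<close>
  define V where "V = (\<lambda>s. p n / p s * y ^ s * (1 - x ^ (2 * s)) / (1 - y))"
  have d: "p (Suc n) / p s * x ^ (s * (2*Suc n+1)) - p n / p s * x ^ (s * (2*n+1)) = V (Suc s) - V s" for s
  proof -
    have e1: "x ^ (s * (2*Suc n+1)) = y ^ s * x ^ (2 * s)"
      unfolding y_def power_mult[symmetric] power_add[symmetric] by (rule arg_cong[of _ _ "\<lambda>k. x ^ k"]) (simp add: algebra_simps)
    have e2: "x ^ (s * (2*n+1)) = y ^ s"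
      unfolding y_def power_mult[symmetric] by (rule arg_cong[of _ _ "\<lambda>k. x ^ k"]) (simp add: algebra_simps)
    have e3: "p (Suc n) = p n * (1 - x * y) / (1 - y)"
      unfolding pS y_def by simp
    have e4: "V (Suc s) = p n / p s * y ^ s * y * (1 - x * x ^ (2 * s)) / (1 - y)"
    proof -
      have "V (Suc s) = p n / (p s * (1 - x ^ (2 * s+2)) / (1 - x ^ (2 * s+1))) * y ^ Suc s * (1 - x ^ (2 * s+2)) / (1 - y)"
        unfolding V_def pS by (simp del: power_Suc)
      moreover have "p n / (p s * c / a) * (Y * y) * c / (1 - y) = p n / p s * Y * y * a / (1 - y)"
        if "a \<noteq> 0" "c \<noteq> 0" for a c Y :: 'a
        using that pnz[of s] y1 by (simp add: field_simps)
      from this[OF nz[of "2 * s+1"] nz[of "2 * s+2"], of "y ^ s"]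
      have "p n / (p s * (1 - x ^ (2 * s+2)) / (1 - x ^ (2 * s+1))) * y ^ Suc s * (1 - x ^ (2 * s+2)) / (1 - y)
        = p n / p s * y ^ s * y * (1 - x ^ (2 * s+1)) / (1 - y)"
        by (simp add: mult.commute[of y])
      ultimately show ?thesis by simp
    qed
    have e5: "c * (1 - x * y) / (1 - y) * (Y * X) - c * Y =
        c * Y * y * (1 - x * X) / (1 - y) - c * Y * (1 - X) / (1 - y)" for c X Y :: 'a
      using y1 by (simp add: divide_simps) (simp add: algebra_simps)
    have e6: "V s = p n / p s * y ^ s * (1 - x ^ (2 * s)) / (1 - y)" by (simp add: V_def)
    show ?thesis unfolding e1 e2 e3 e4 e6
      using e5[of "p n / p s" "y ^ s" "x ^ (2 * s)"] by (simp add: mult.commute[of "p s"])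
  qed
  have "(\<Sum>s<n. p (Suc n) / p s * x ^ (s * (2*Suc n+1))) - (\<Sum>s<n. p n / p s * x ^ (s * (2*n+1))) = V n - V 0"
    unfolding sum_subtractf[symmetric] d by (rule sum_lessThan_telescope)
  hence "(\<Sum>s<Suc n. p (Suc n) / p s * x ^ (s * (2*Suc n+1))) =
     (\<Sum>i<2*n. x ^ (i * (i+1) div 2)) + V n - V 0 + p (Suc n) / p n * x ^ (n * (2*Suc n+1))"
    using Suc.IH by (simp add: algebra_simps)
  also have "V 0 = 0" by (simp add: V_def)
  also have "V n = y ^ n * (1 - x ^ (2*n)) / (1 - y)" using pnz by (simp add: V_def)
  also have "p (Suc n) / p n * x ^ (n * (2*Suc n+1)) = (1 - x * y) / (1 - y) * (y ^ n * x ^ (2*n))"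
  proof -
    have e1: "x ^ (n * (2*Suc n+1)) = y ^ n * x ^ (2*n)"
      unfolding y_def power_mult[symmetric] power_add[symmetric] by (rule arg_cong[of _ _ "\<lambda>k. x ^ k"]) (simp add: algebra_simps)
    show ?thesis unfolding e1 using pnz[of n] by (simp add: pS y_def)
  qed
  also have "(\<Sum>i<2*n. x ^ (i * (i+1) div 2)) + y ^ n * (1 - x ^ (2*n)) / (1 - y) - 0 + 
      (1 - x * y) / (1 - y) * (y ^ n * x ^ (2*n)) = (\<Sum>i<2*n. x ^ (i * (i+1) div 2)) + y ^ n * (1 + y)"
  proof -
    have xy: "x * x ^ (2*n) = y" by (simp add: y_def)
    have "y ^ n * (1 - x ^ (2*n)) / (1 - y) + (1 - x * y) / (1 - y) * (y ^ n * x ^ (2*n))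
       = y ^ n * (1 - y * (x * x ^ (2*n))) / (1 - y)" by (simp add: field_simps add_divide_distrib [symmetric])
    also have "\<dots> = y ^ n * (1 + y)" unfolding xy using y1 by (simp add: field_simps)
    finally show ?thesis by simp
  qed
  also have "\<dots> = (\<Sum>i<2*Suc n. x ^ (i * (i+1) div 2))"
  proof -
    have "2*n*(2*n+1) div 2 = (2*n+1)*n" by (metis div_mult_self1_is_m mult.assoc mult.commute zero_less_numeral)
    moreover have "(2*n+1)*(2*n+1+1) div 2 = (2*n+1)*(n+1)"
    proof -
      have "(2*n+1)*(2*n+1+1) = 2 * ((2*n+1)*(n+1))" by (simp add: algebra_simps)
      thus ?thesis by simp
    qed
    ultimately have "x ^ (2*n*(2*n+1) div 2) = y ^ n" "x ^ ((2*n+1)*(2*n+1+1) div 2) = y ^ n * y"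
      by (simp_all only: y_def power_mult) (simp_all add: power_mult power_add)
    moreover have "2 * Suc n = Suc (Suc (2*n))" by simp
    ultimately show ?thesis by (simp add: algebra_simps)
  qed
  finally show ?case .
qed

lemma triangle_ge: "n \<le> n * (n + 1) div (2::nat)"
proof (cases n)
  case (Suc m)
  hence "2 * n \<le> n * (n + 1)" by simp
  thus ?thesis by linarith
qed auto

text \<open>
In the limit of Shanks' identity only the summand with \<open>s = 0\<close> survives, and it tends to the
product; the others carry the factor \<open>x\<^bsup>s(2n+1)\<^esup>\<close> and bounded quotients of partial products.
\<close>
theorem theta_psi_product:
  assumes x: "norm x < 1"
  shows "theta_psi x * odd_prod x = euler_prod (x\<^sup>2)"
proof -
  define p where "p = (\<lambda>n. \<Prod>s<n. (1 - x ^ (2 * s+2)) / (1 - x ^ (2 * s+1)))"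
  have x2: "norm (x\<^sup>2) < 1" using x by (simp add: norm_power_less_1)
  define L where "L = euler_prod (x\<^sup>2) / odd_prod x"
  have Lnz: "L \<noteq> 0" unfolding L_def using euler_prod_nz[OF x2] odd_prod_nz[OF x] by simp
  have pnz: "p k \<noteq> 0" for k
    unfolding p_def by (auto simp: prod_zero_iff one_minus_power_nz[OF x] simp del: power_Suc right_minus_eq)
  have "(\<lambda>n. (\<Prod>s\<le>n. 1 - (x\<^sup>2) ^ Suc s) / (\<Prod>s\<le>n. 1 - x ^ (2 * s+1))) \<longlonglongrightarrow> L"
    unfolding L_def using odd_prod_nz[OF x] unfolding euler_prod_def odd_prod_def using x x2
    by (intro tendsto_divide convergent_prod_LIMSEQ convergent_prod_one_minus_power) auto
  also have "(\<lambda>n. (\<Prod>s\<le>n. 1 - (x\<^sup>2) ^ Suc s) / (\<Prod>s\<le>n. 1 - x ^ (2 * s+1))) = (\<lambda>n. p (Suc n))"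
    unfolding p_def prod_dividef[symmetric] lessThan_Suc_atMost power_mult[symmetric] by simp
  finally have lim: "p \<longlonglongrightarrow> L" by (simp only: filterlim_sequentially_Suc)
  have "Bseq p" using lim convergentI convergent_imp_Bseq by blast
  then obtain K1 where K1: "K1 > 0" "\<And>n. norm (p n) \<le> K1" by (auto simp: Bseq_def)
  have "Bseq (\<lambda>n. inverse (p n))" 
    using tendsto_inverse[OF lim Lnz] convergentI convergent_imp_Bseq by blast
  then obtain K2 where K2: "K2 > 0" "\<And>n. norm (inverse (p n)) \<le> K2" by (auto simp: Bseq_def)
  have "summable (\<lambda>n. x ^ (n * (n + 1) div 2))"
    by (rule summable_norm_cancel, rule summable_power_comp[OF x]) (use triangle_ge in auto)
  hence "(\<lambda>n. \<Sum>i<n. x ^ (i * (i+1) div 2)) \<longlonglongrightarrow> theta_psi x"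
    unfolding theta_psi_def by (rule summable_LIMSEQ)
  hence "(\<lambda>n. \<Sum>i<2*n. x ^ (i * (i+1) div 2)) \<longlonglongrightarrow> theta_psi x"
    by (rule LIMSEQ_subseq_LIMSEQ[unfolded o_def]) (auto simp: strict_mono_def)
  hence l1: "(\<lambda>n. \<Sum>s<n. p n / p s * x ^ (s * (2*n+1))) \<longlonglongrightarrow> theta_psi x"
    using shanks_identity[OF x] by (simp add: p_def)
  have l2: "(\<lambda>n. (\<Sum>s<n. p n / p s * x ^ (s * (2*n+1))) - p n) \<longlonglongrightarrow> 0"
  proof (rule tendsto_norm_zero_cancel, rule tendsto_sandwich[OF _ _ tendsto_const])
    have "(\<lambda>n. real n * norm x ^ n) \<longlonglongrightarrow> 0" 
      using powser_times_n_limit_0[of "norm x"] x by simp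
    hence "(\<lambda>n. K1 * K2 * (real n * norm x ^ n)) \<longlonglongrightarrow> K1 * K2 * 0" by (intro tendsto_intros)
    thus "(\<lambda>n. K1 * K2 * (real n * norm x ^ n)) \<longlonglongrightarrow> 0" by simp
    show "\<forall>\<^sub>F n in sequentially. norm ((\<Sum>s<n. p n / p s * x ^ (s * (2*n+1))) - p n) \<le> K1 * K2 * (real n * norm x ^ n)"
      using eventually_gt_at_top[of 0]
    proof eventually_elim
      case (elim n)
      have "(\<Sum>s<n. p n / p s * x ^ (s * (2*n+1))) = p n + (\<Sum>s\<in>{..<n}-{0}. p n / p s * x ^ (s * (2*n+1)))"
        using elim by (subst sum.remove[of _ 0]) (auto simp: p_def)
      hence "norm ((\<Sum>s<n. p n / p s * x ^ (s * (2*n+1))) - p n) = norm (\<Sum>s\<in>{..<n}-{0}. p n / p s * x ^ (s * (2*n+1)))"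
        by simp
      also have "\<dots> \<le> (\<Sum>s\<in>{..<n}-{0}. K1 * K2 * norm x ^ n)"
      proof (rule sum_norm_le)
        fix s assume "s \<in> {..<n}-{0}"
        hence s: "s \<ge> 1" by auto
        have "n * 1 \<le> (2*n+1) * s" by (intro mult_mono) (use s in auto)
        hence le: "norm x ^ (s * (2*n+1)) \<le> norm x ^ n"
          using x by (intro power_decreasing) (auto simp: mult.commute)
        have "norm (p n / p s * x ^ (s * (2*n+1))) = norm (p n) * norm (inverse (p s)) * norm x ^ (s * (2*n+1))"
          by (simp add: norm_mult norm_divide norm_power divide_inverse norm_inverse)
        also have "\<dots> \<le> K1 * K2 * norm x ^ n"
          by (intro mult_mono K1(2) K2(2) le) (use K1 K2 in auto)
        finally show "norm (p n / p s * x ^ (s * (2*n+1))) \<le> K1 * K2 * norm x ^ n" .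
      qed
      also have "\<dots> = real (card ({..<n}-{0})) * (K1 * K2 * norm x ^ n)" by simp
      also have "\<dots> \<le> real n * (K1 * K2 * norm x ^ n)"
        using K1 K2 by (intro mult_right_mono) (auto simp: card_Diff_singleton_if)
      finally show ?case by (simp add: mult_ac)
    qed
  qed auto
  have "theta_psi x - L = 0" using LIMSEQ_unique[OF tendsto_diff[OF l1 lim] l2] .
  thus ?thesis using odd_prod_nz[OF x] by (simp add: L_def)
qed

section \<open>Theta identities from a change of lattice\<close>

lemma has_sum_times:
  fixes f :: "'a \<Rightarrow> complex" and g :: "'b \<Rightarrow> complex"
  assumes f: "(f has_sum a) A" "(\<lambda>x. norm (f x)) summable_on A" and g: "(g has_sum b) B" "(\<lambda>x. norm (g x)) summable_on B"
  shows "((\<lambda>(x, y). f x * g y) has_sum a * b) (A \<times> B)"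
proof (rule has_sum_SigmaI)
  show "((\<lambda>y. case (x, y) of (x, y) \<Rightarrow> f x * g y) has_sum f x * b) B" for x
    using has_sum_cmult_right[OF g(1)] by simp
  show "((\<lambda>x. f x * b) has_sum a * b) A" by (rule has_sum_cmult_left[OF f(1)])
  have "(\<lambda>(x, y). norm (f x) * norm (g y)) summable_on A \<times> B"
  proof (rule summable_on_SigmaI)
    show "((\<lambda>y. case (x, y) of (x, y) \<Rightarrow> norm (f x) * norm (g y)) has_sum norm (f x) * (\<Sum>\<^sub>\<infinity>y\<in>B. norm (g y))) B" for x
      using has_sum_cmult_right[OF has_sum_infsum[OF g(2)]] by simp
    show "(\<lambda>x. norm (f x) * (\<Sum>\<^sub>\<infinity>y\<in>B. norm (g y))) summable_on A"
      using summable_on_cmult_left[OF f(2)] by simp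
  qed auto
  thus "(\<lambda>(x, y). f x * g y) summable_on A \<times> B"
    using abs_summable_summable[of "\<lambda>(x, y). f x * g y" "A \<times> B"]
    by (simp add: case_prod_unfold norm_mult)
qed

lemma has_sum_int_split:
  fixes f :: "int \<Rightarrow> complex"
  assumes "summable (\<lambda>n. norm (f (int n)))" "summable (\<lambda>n. norm (f (- int (Suc n))))"
  shows "(f has_sum (\<Sum>n. f (int n)) + (\<Sum>n. f (- int (Suc n)))) UNIV" and "(\<lambda>x. norm (f x)) summable_on UNIV"
proof -
  have s: "(g has_sum (\<Sum>n. g (int n)) + (\<Sum>n. g (- int (Suc n)))) UNIV"
    if "summable (\<lambda>n. norm (g (int n)))" "summable (\<lambda>n. norm (g (- int (Suc n))))"
    for g :: "int \<Rightarrow> 'b::banach"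
  proof -
    have "((\<lambda>n. g (int n)) has_sum (\<Sum>n. g (int n))) UNIV"
      by (intro norm_summable_imp_has_sum that summable_sums summable_norm_cancel[OF that(1)])
    hence 1: "(g has_sum (\<Sum>n. g (int n))) (range int)"
      by (subst has_sum_reindex) (auto simp: o_def)
    have "((\<lambda>n. g (- int (Suc n))) has_sum (\<Sum>n. g (- int (Suc n)))) UNIV"
      by (intro norm_summable_imp_has_sum that summable_sums summable_norm_cancel[OF that(2)])
    hence 2: "(g has_sum (\<Sum>n. g (- int (Suc n)))) (range (\<lambda>n. - int (Suc n)))"
      by (subst has_sum_reindex) (auto simp: o_def inj_on_def)
    have "range int \<inter> range (\<lambda>n. - int (Suc n)) = {}" by auto
    moreover have "range int \<union> range (\<lambda>n. - int (Suc n)) = UNIV"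
    proof -
      have "x \<in> range int \<union> range (\<lambda>n. - int (Suc n))" for x
        by (cases x rule: int_cases) auto
      thus ?thesis by blast
    qed
    ultimately show ?thesis using has_sum_Un_disjoint[OF 1 2] by simp
  qed
  show "(f has_sum (\<Sum>n. f (int n)) + (\<Sum>n. f (- int (Suc n)))) UNIV" by (rule s[OF assms])
  show "(\<lambda>x. norm (f x)) summable_on UNIV" 
    using s[of "\<lambda>n. norm (f n)"] assms by (auto simp: summable_on_def)
qed

lemma theta_phi_summable:
  fixes q :: "'a::{real_normed_field,banach}"
  shows "norm q < 1 \<Longrightarrow> summable (\<lambda>n. norm (q ^ (n\<^sup>2)))"
  by (rule summable_power_comp) (auto simp: power2_eq_square)

lemma theta_psi_summable:
  fixes q :: "'a::{real_normed_field,banach}"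
  shows "norm q < 1 \<Longrightarrow> summable (\<lambda>n. norm (q ^ (n * (n + 1) div 2)))"
  by (rule summable_power_comp) (use triangle_ge in auto)

lemma theta_phi_has_sum:
  fixes q :: complex
  assumes q: "norm q < 1"
  shows "((\<lambda>n::int. q ^ nat (n\<^sup>2)) has_sum theta_phi q) UNIV"
    and "(\<lambda>n::int. norm (q ^ nat (n\<^sup>2))) summable_on UNIV"
proof -
  have e: "nat ((int n)\<^sup>2) = n\<^sup>2" for n
    by (metis nat_int of_nat_power)
  have e': "nat ((- int (Suc n))\<^sup>2) = (Suc n)\<^sup>2" for n
    by (metis nat_int of_nat_power power2_minus)
  have s: "summable (\<lambda>n. norm (q ^ (n\<^sup>2)))" using q by (rule theta_phi_summable)
  have s': "summable (\<lambda>n. norm (q ^ ((Suc n)\<^sup>2)))" using s by (subst summable_Suc_iff)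
  have "(\<Sum>n. q ^ ((Suc n)\<^sup>2)) = (\<Sum>n. q ^ (n\<^sup>2)) - 1"
    using suminf_split_head[OF summable_norm_cancel[OF s]] by simp
  hence "theta_phi q = (\<Sum>n. q ^ (n\<^sup>2)) + (\<Sum>n. q ^ ((Suc n)\<^sup>2))"
    by (simp add: theta_phi_def)
  with has_sum_int_split[of "\<lambda>n::int. q ^ nat (n\<^sup>2)"] s s'
  show "((\<lambda>n::int. q ^ nat (n\<^sup>2)) has_sum theta_phi q) UNIV" "(\<lambda>n::int. norm (q ^ nat (n\<^sup>2))) summable_on UNIV"
    by (simp_all only: e e')
qed

lemma theta_psi_has_sum:
  fixes q :: complex
  assumes q: "norm q < 1"
  shows "((\<lambda>n::int. q ^ nat (n * (n + 1) div 2)) has_sum 2 * theta_psi q) UNIV"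
    and "(\<lambda>n::int. norm (q ^ nat (n * (n + 1) div 2))) summable_on UNIV"
proof -
  have e: "nat (int n * (int n + 1) div 2) = n * (n + 1) div 2" for n
    by (metis int_ops(2,7) int_ops(5) nat_int nat_numeral_as_int of_nat_1 of_nat_numeral zdiv_int)
  have e': "nat (- int (Suc n) * (- int (Suc n) + 1) div 2) = n * (n + 1) div 2" for n
  proof -
    have "- int (Suc n) * (- int (Suc n) + 1) = int n * (int n + 1)" by (simp add: algebra_simps)
    thus ?thesis by (simp only: e)
  qed
  have s: "summable (\<lambda>n. norm (q ^ (n * (n + 1) div 2)))" using q by (rule theta_psi_summable)
  have "2 * theta_psi q = (\<Sum>n. q ^ (n * (n + 1) div 2)) + (\<Sum>n. q ^ (n * (n + 1) div 2))"
    by (simp add: theta_psi_def)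
  with has_sum_int_split[of "\<lambda>n::int. q ^ nat (n * (n + 1) div 2)"] s
  show "((\<lambda>n::int. q ^ nat (n * (n + 1) div 2)) has_sum 2 * theta_psi q) UNIV"
       "(\<lambda>n::int. norm (q ^ nat (n * (n + 1) div 2))) summable_on UNIV"
    by (simp_all only: e e')
qed

lemma bij_parity_sum:
  "bij_betw (\<lambda>(a, b). (a + b + of_bool c, a - b)) UNIV {(m, n::int). odd (m + n) = c}"
proof (rule bij_betwI[where g = "\<lambda>(m, n). ((m - of_bool c + n) div 2, (m - of_bool c - n) div 2)"])
  show "(\<lambda>(a, b). (a + b + of_bool c, a - b)) \<in> UNIV \<rightarrow> {(m, n::int). odd (m + n) = c}"
    by (cases c) auto
  show "(\<lambda>(m, n). ((m - of_bool c + n) div 2, (m - of_bool c - n) div 2)) \<in>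
     {(m, n::int). odd (m + n) = c} \<rightarrow> UNIV" by simp
next
  fix x :: "int \<times> int"
  show "(\<lambda>(m, n). ((m - of_bool c + n) div 2, (m - of_bool c - n) div 2))
      ((\<lambda>(a, b). (a + b + of_bool c, a - b)) x) = x"
    by (cases x) simp
next
  fix y assume "y \<in> {(m, n::int). odd (m + n) = c}"
  thus "(\<lambda>(a, b). (a + b + of_bool c, a - b)) ((\<lambda>(m, n). ((m - of_bool c + n) div 2, (m - of_bool c - n) div 2)) y) = y"
    by (cases c; cases y) (simp_all, presburger+)
qed

text \<open>
Pairs with even coordinate sum are \<open>(a + b, a - b)\<close> and pairs with odd coordinate sum are
\<open>(a + b + 1, a - b)\<close>, each in one way.
\<close>
lemma has_sum_parity_split:
  fixes f :: "int \<times> int \<Rightarrow> complex"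
  assumes "((\<lambda>(a, b). f (a + b, a - b)) has_sum A) UNIV"
    and "((\<lambda>(a, b). f (a + b + 1, a - b)) has_sum B) UNIV"
  shows "(f has_sum A + B) UNIV"
proof -
  have 1: "(f has_sum A) {(m, n::int). odd (m + n) = False}"
    using assms(1) has_sum_reindex_bij_betw[OF bij_parity_sum[of False], of f A]
    by (simp add: case_prod_unfold)
  have 2: "(f has_sum B) {(m, n::int). odd (m + n) = True}"
    using assms(2) has_sum_reindex_bij_betw[OF bij_parity_sum[of True], of f B]
    by (simp add: case_prod_unfold)
  have "{(m, n::int). odd (m + n) = False} \<union> {(m, n::int). odd (m + n) = True} = UNIV" by auto
  thus ?thesis using has_sum_Un_disjoint[OF 1 2] by auto
qed

lemma triangle_int: "2 * ((n::int) * (n + 1) div 2) = n * (n + 1)"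
proof -
  have "even (n * (n + 1))" by simp
  thus ?thesis by simp
qed

lemma triangle_int_nonneg: "(n::int) * (n + 1) div 2 \<ge> 0"
proof -
  have "n * (n + 1) \<ge> 0" by (cases "n \<ge> 0") (auto intro: mult_nonpos_nonpos)
  thus ?thesis by simp
qed

text \<open>
Parity splitting of \<open>\<Sum> q\<^bsup>m\<^sup>2 + n\<^sup>2\<^esup>\<close>: the even part has exponents \<open>2(a\<^sup>2 + b\<^sup>2)\<close>, and the odd part has
exponents \<open>1 + 4(T\<^sub>a + T\<^sub>b)\<close> with triangular numbers \<open>T\<close>.
\<close>
theorem theta_phi_square:
  fixes q :: complex
  assumes q: "norm q < 1"
  shows "(theta_phi q)\<^sup>2 = (theta_phi (q\<^sup>2))\<^sup>2 + 4 * q * (theta_psi (q ^ 4))\<^sup>2"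
proof -
  have q2: "norm (q\<^sup>2) < 1" and q4: "norm (q ^ 4) < 1" using q by (simp_all add: norm_power_less_1)
  let ?f = "\<lambda>(m::int, n::int). q ^ nat (m\<^sup>2) * q ^ nat (n\<^sup>2)"
  have 1: "(?f has_sum theta_phi q * theta_phi q) UNIV"
    using has_sum_times[OF theta_phi_has_sum[OF q] theta_phi_has_sum[OF q]] by simp
  have f: "?f (m, n) = q ^ nat (m\<^sup>2 + n\<^sup>2)" for m n :: int
    by (simp add: power_add[symmetric] nat_add_distrib)
  have "(?f has_sum theta_phi (q\<^sup>2) * theta_phi (q\<^sup>2) + q * (2 * theta_psi (q ^ 4) * (2 * theta_psi (q ^ 4)))) UNIV"
  proof (rule has_sum_parity_split)
    have "?f (a + b, a - b) = (case (a, b) of (a, b) \<Rightarrow> (q\<^sup>2) ^ nat (a\<^sup>2) * (q\<^sup>2) ^ nat (b\<^sup>2))" for a b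
    proof -
      have "(a + b)\<^sup>2 + (a - b)\<^sup>2 = 2 * (a\<^sup>2 + b\<^sup>2)" by (simp add: power2_eq_square algebra_simps)
      thus ?thesis unfolding f by (simp add: power_add[symmetric] power_mult[symmetric] nat_mult_distrib nat_add_distrib)
    qed
    thus "((\<lambda>(a, b). ?f (a + b, a - b)) has_sum theta_phi (q\<^sup>2) * theta_phi (q\<^sup>2)) UNIV"
      using has_sum_times[OF theta_phi_has_sum[OF q2] theta_phi_has_sum[OF q2]] by (simp add: case_prod_unfold)
    have "?f (a + b + 1, a - b) = (case (a, b) of (a, b) \<Rightarrow> q * ((q ^ 4) ^ nat (a * (a + 1) div 2) * (q ^ 4) ^ nat (b * (b + 1) div 2)))" for a b
    proof -
      have "(a + b + 1)\<^sup>2 + (a - b)\<^sup>2 = 1 + 2 * (a * (a + 1)) + 2 * (b * (b + 1))" by (simp add: power2_eq_square algebra_simps)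
      also have "\<dots> = 1 + 2 * (2 * (a * (a + 1) div 2)) + 2 * (2 * (b * (b + 1) div 2))"
        by (simp only: triangle_int)
      also have "\<dots> = 1 + 4 * (a * (a + 1) div 2 + b * (b + 1) div 2)"
      proof -
        have "1 + 2 * (2 * u) + 2 * (2 * v) = 1 + 4 * (u + v)" for u v :: int by simp
        thus ?thesis .
      qed
      finally have "nat ((a + b + 1)\<^sup>2 + (a - b)\<^sup>2) = nat (1 + 4 * (a * (a + 1) div 2 + b * (b + 1) div 2))"
        by (rule arg_cong)
      also have "\<dots> = 1 + 4 * (nat (a * (a + 1) div 2) + nat (b * (b + 1) div 2))"
        using triangle_int_nonneg[of a] triangle_int_nonneg[of b] by (simp add: nat_add_distrib nat_mult_distrib del: div_mult_self1_is_m)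
      finally have e: "nat ((a + b + 1)\<^sup>2 + (a - b)\<^sup>2) = 1 + 4 * (nat (a * (a + 1) div 2) + nat (b * (b + 1) div 2))" .
      show ?thesis unfolding f e by (simp add: power_add power_mult power_mult_distrib)
    qed
    thus "((\<lambda>(a, b). ?f (a + b + 1, a - b)) has_sum q * (2 * theta_psi (q ^ 4) * (2 * theta_psi (q ^ 4)))) UNIV"
      using has_sum_cmult_right[OF has_sum_times[OF theta_psi_has_sum[OF q4] theta_psi_has_sum[OF q4]], of q]
      by (simp add: case_prod_unfold)
  qed
  from has_sum_unique[OF 1 this] show ?thesis by (simp add: power2_eq_square)
qed

text \<open>
Parity splitting again, now of a sum of two triangular numbers: both parts have exponents of the
form \<open>2 T\<^sub>a + d\<^sup>2\<close>, and each yields the product on the right.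
\<close>
theorem theta_psi_square:
  fixes q :: complex
  assumes q: "norm q < 1"
  shows "(theta_psi q)\<^sup>2 = theta_phi q * theta_psi (q\<^sup>2)"
proof -
  have q2: "norm (q\<^sup>2) < 1" using q by (simp add: norm_power_less_1)
  define T where "T = (\<lambda>n::int. n * (n + 1) div 2)"
  have T: "2 * T n = n * (n + 1)" "T n \<ge> 0" for n
    using triangle_int triangle_int_nonneg by (auto simp: T_def)
  let ?f = "\<lambda>(a::int, d::int). (q\<^sup>2) ^ nat (T a) * q ^ nat (d\<^sup>2)"
  let ?g = "\<lambda>(m::int, n::int). q ^ nat (T m) * q ^ nat (T n)"
  have 1: "(?f has_sum 2 * theta_psi (q\<^sup>2) * theta_phi q) UNIV"
    using has_sum_times[OF theta_psi_has_sum[OF q2] theta_phi_has_sum[OF q]] by (simp add: T_def)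
  have 2: "(?g has_sum 2 * theta_psi q * (2 * theta_psi q)) UNIV"
    using has_sum_times[OF theta_psi_has_sum[OF q] theta_psi_has_sum[OF q]] by (simp add: T_def)
  have "(?g has_sum 2 * theta_psi (q\<^sup>2) * theta_phi q + 2 * theta_psi (q\<^sup>2) * theta_phi q) UNIV"
  proof (rule has_sum_parity_split)
    have "?g (a + b, a - b) = ?f (a, b)" for a b
    proof -
      have "2 * (T (a + b) + T (a - b)) = 2 * (2 * T a + b\<^sup>2)" 
        unfolding distrib_left T by (simp add: power2_eq_square algebra_simps)
      hence "nat (T (a + b) + T (a - b)) = nat (2 * T a + b\<^sup>2)" by simp
      hence "nat (T (a + b)) + nat (T (a - b)) = 2 * nat (T a) + nat (b\<^sup>2)"
        by (simp add: nat_add_distrib nat_mult_distrib T(2))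
      hence "q ^ (nat (T (a + b)) + nat (T (a - b))) = q ^ (2 * nat (T a) + nat (b\<^sup>2))" by simp
      thus ?thesis by (simp add: power_add power_mult)
    qed
    thus "((\<lambda>(a, b). ?g (a + b, a - b)) has_sum 2 * theta_psi (q\<^sup>2) * theta_phi q) UNIV"
      using 1 by (simp add: case_prod_unfold)
    have 3: "?g (a + b + 1, a - b) = ?f (b, a + 1)" for a b
    proof -
      have "2 * (T (a + b + 1) + T (a - b)) = 2 * (2 * T b + (a + 1)\<^sup>2)" 
        unfolding distrib_left T by (simp add: power2_eq_square algebra_simps)
      hence "nat (T (a + b + 1) + T (a - b)) = nat (2 * T b + (a + 1)\<^sup>2)" by simp
      hence "nat (T (a + b + 1)) + nat (T (a - b)) = 2 * nat (T b) + nat ((a + 1)\<^sup>2)"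
        by (simp add: nat_add_distrib nat_mult_distrib T(2))
      hence "q ^ (nat (T (a + b + 1)) + nat (T (a - b))) = q ^ (2 * nat (T b) + nat ((a + 1)\<^sup>2))" by simp
      thus ?thesis by (simp add: power_add power_mult)
    qed
    have "bij_betw (\<lambda>(a, b). (b, a + 1)) UNIV (UNIV :: (int \<times> int) set)"
      by (rule bij_betwI[where g = "\<lambda>(a, b). (b - 1, a)"]) auto
    from has_sum_reindex_bij_betw[OF this, of ?f] 1 
    show "((\<lambda>(a, b). ?g (a + b + 1, a - b)) has_sum 2 * theta_psi (q\<^sup>2) * theta_phi q) UNIV"
      using 3 by (simp add: case_prod_unfold)
  qed
  from has_sum_unique[OF 2 this] show ?thesis by (simp add: power2_eq_square mult_ac)
qed

text \<open>
Gauss's product for \<open>\<psi>\<close> gives the other two, since \<open>\<phi>(q) = \<psi>(q)\<^sup>2 / \<psi>(q\<^sup>2)\<close>. In particular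
neither series vanishes in the unit disc.
\<close>
lemma theta_products:
  assumes q: "norm q < 1"
  shows "theta_psi q = euler_prod (q\<^sup>2) / odd_prod q"
    and "theta_phi q = euler_prod (q\<^sup>2) * (odd_prod (q\<^sup>2))\<^sup>2 / (odd_prod q)\<^sup>2"
    and "theta_phi (-q) = euler_prod (q\<^sup>2) * (odd_prod q)\<^sup>2"
    and "theta_phi q \<noteq> 0" "theta_psi q \<noteq> 0"
proof -
  have q2: "norm (q\<^sup>2) < 1" using q by (simp add: norm_power_less_1)
  have psi: "theta_psi x = euler_prod (x\<^sup>2) / odd_prod x" if "norm x < 1" for x
    using theta_psi_product[OF that] odd_prod_nz[OF that] by (simp add: field_simps)
  have phi: "theta_phi x = euler_prod (x\<^sup>2) * (odd_prod (x\<^sup>2))\<^sup>2 / (odd_prod x)\<^sup>2" if x: "norm x < 1" for x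
  proof -
    have x2: "norm (x\<^sup>2) < 1" using x by (simp add: norm_power_less_1)
    have x4: "norm ((x\<^sup>2)\<^sup>2) < 1" using x2 norm_power_less_1[of "x\<^sup>2" 2] by simp
    have nz: "theta_psi (x\<^sup>2) \<noteq> 0" using psi[OF x2] euler_prod_nz[OF x4] odd_prod_nz[OF x2] by simp
    have "theta_phi x = (theta_psi x)\<^sup>2 / theta_psi (x\<^sup>2)"
      using theta_psi_square[OF x] nz by simp
    also have "\<dots> = euler_prod (x\<^sup>2) * (odd_prod (x\<^sup>2))\<^sup>2 / (odd_prod x)\<^sup>2"
    proof -
      have "(E2 / a)\<^sup>2 / (E4 / b) = E2 * b\<^sup>2 / a\<^sup>2" if "E2 = E4 * b" "E4 \<noteq> 0" "a \<noteq> 0" "b \<noteq> 0"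
        for E2 E4 a b :: complex
        using that(2-4) unfolding that(1) by (simp add: divide_simps power2_eq_square)
      from this[OF euler_prod_split[OF x2] euler_prod_nz[OF x4] odd_prod_nz[OF x] odd_prod_nz[OF x2]]
      show ?thesis unfolding psi[OF x] psi[OF x2] .
    qed
    finally show ?thesis .
  qed
  show "theta_psi q = euler_prod (q\<^sup>2) / odd_prod q" by (rule psi[OF q])
  show 1: "theta_phi q = euler_prod (q\<^sup>2) * (odd_prod (q\<^sup>2))\<^sup>2 / (odd_prod q)\<^sup>2" by (rule phi[OF q])
  have "theta_phi (-q) = euler_prod (q\<^sup>2) * (odd_prod q * odd_prod (-q))\<^sup>2 / (odd_prod (-q))\<^sup>2"
    using phi[of "-q"] q unfolding odd_prod_mult_neg[OF q] by simp
  thus "theta_phi (-q) = euler_prod (q\<^sup>2) * (odd_prod q)\<^sup>2"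
    using odd_prod_nz[of "-q"] q by (simp add: power_mult_distrib)
  show "theta_phi q \<noteq> 0" "theta_psi q \<noteq> 0"
    using 1 psi[OF q] euler_prod_nz[OF q2] odd_prod_nz[OF q] odd_prod_nz[OF q2] by auto
qed

lemma theta_phi_mult_neg:
  fixes q :: complex
  assumes q: "norm q < 1"
  shows "theta_phi q * theta_phi (-q) = (theta_phi (-(q\<^sup>2)))\<^sup>2"
proof -
  have q2: "norm (q\<^sup>2) < 1" using q by (simp add: norm_power_less_1)
  have "E2 * b\<^sup>2 / a\<^sup>2 * (E2 * a\<^sup>2) = (E4 * b\<^sup>2)\<^sup>2" if "E2 = E4 * b" "a \<noteq> 0"
    for E2 E4 a b :: complex
    using that(2) unfolding that(1) by (simp add: power2_eq_square)
  from this[OF euler_prod_split[OF q2] odd_prod_nz[OF q]]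
  show ?thesis unfolding theta_products(2,3)[OF q] theta_products(3)[OF q2] .
qed

section \<open>The modular lambda function on the unit interval\<close>

lemma powser_reindex:
  fixes q :: real
  assumes e: "strict_mono e" "\<And>n. e n \<ge> n" and q: "norm q < 1"
  shows "(\<Sum>n. q ^ e n) = eval_fps (Abs_fps (\<lambda>m. of_bool (m \<in> range e))) q"
proof -
  have "(\<lambda>n. q ^ e n) sums (\<Sum>n. q ^ e n)"
    by (intro summable_sums summable_norm_cancel[OF summable_power_comp[OF q e(2)]])
  also have "(\<lambda>n. q ^ e n) = (\<lambda>n. of_bool (e n \<in> range e) * q ^ e n)" by auto
  finally have "(\<lambda>m. of_bool (m \<in> range e) * q ^ m) sums (\<Sum>n. q ^ e n)"
    by (subst (asm) sums_mono_reindex[OF e(1)]) auto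
  thus ?thesis by (simp add: eval_fps_def sums_iff)
qed

lemma conv_radius_powser_reindex:
  "fps_conv_radius (Abs_fps (\<lambda>m. of_bool (m \<in> A)) :: real fps) \<ge> 1"
  unfolding fps_conv_radius_def
proof (rule conv_radius_geI_ex')
  fix r :: real assume r: "r > 0" "ereal r < 1"
  show "summable (\<lambda>n. fps_nth (Abs_fps (\<lambda>m. of_bool (m \<in> A)) :: real fps) n * of_real r ^ n)"
  proof (rule summable_comparison_test)
    show "\<exists>N. \<forall>n\<ge>N. norm (fps_nth (Abs_fps (\<lambda>m. of_bool (m \<in> A)) :: real fps) n * of_real r ^ n) \<le> r ^ n"
      using r by auto
    show "summable (\<lambda>n. r ^ n)" using r by (simp add: summable_geometric)
  qed
qed

text \<open>
A series \<open>\<Sum> q\<^bsup>e(n)\<^esup>\<close> is a power series with coefficients 0 and 1, hence continuously differentiable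
on the open unit interval.
\<close>
lemma powser_reindex_deriv:
  assumes e: "strict_mono e" "\<And>n. e n \<ge> n"
  obtains d where "\<And>q::real. norm q < 1 \<Longrightarrow> ((\<lambda>q. \<Sum>n. q ^ e n) has_real_derivative d q) (at q)"
    "\<And>q. norm q < 1 \<Longrightarrow> isCont d q"
proof -
  define F :: "real fps" where "F = Abs_fps (\<lambda>m. of_bool (m \<in> range e))"
  have R: "fps_conv_radius F \<ge> 1" unfolding F_def by (rule conv_radius_powser_reindex)
  hence R': "fps_conv_radius (fps_deriv F) \<ge> 1"
    using fps_conv_radius_deriv[of F] by simp
  show thesis
  proof (rule that[of "eval_fps (fps_deriv F)"])
    fix q :: real assume q: "norm q < 1"
    hence lt: "ereal (norm q) < 1" by simp
    have "(eval_fps F has_real_derivative eval_fps (fps_deriv F) q) (at q)"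
      by (rule has_field_derivative_eval_fps) (use less_le_trans[OF lt R] in simp)
    thus "((\<lambda>q. \<Sum>n. q ^ e n) has_real_derivative eval_fps (fps_deriv F) q) (at q)"
    proof (rule has_field_derivative_transform_within_open)
      show "open (ball 0 1 :: real set)" by simp
      show "eval_fps F x = (\<Sum>n. x ^ e n)" if "x \<in> ball 0 1" for x
        using powser_reindex[OF e, of x] that by (simp add: F_def)
    qed (use q in auto)
    have "ball 0 1 \<subseteq> eball (0 :: real) (fps_conv_radius (fps_deriv F))"
    proof
      fix x :: real assume "x \<in> ball 0 1"
      hence "ereal (norm x) < 1" by simp
      thus "x \<in> eball 0 (fps_conv_radius (fps_deriv F))" using less_le_trans[OF _ R'] by simp
    qed
    hence "continuous_on (ball 0 1) (eval_fps (fps_deriv F))"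
      using continuous_on_eval_fps continuous_on_subset by blast
    thus "isCont (eval_fps (fps_deriv F)) q"
      using q by (auto simp: continuous_on_eq_continuous_at)
  qed
qed

lemma theta_phi_deriv:
  obtains d where "\<And>q::real. norm q < 1 \<Longrightarrow> (theta_phi has_real_derivative d q) (at q)"
    "\<And>q. norm q < 1 \<Longrightarrow> isCont d q"
proof -
  have "strict_mono (\<lambda>n::nat. n\<^sup>2)" by (auto simp: strict_mono_def power_strict_mono)
  moreover have "n \<le> n\<^sup>2" for n :: nat by (simp add: power2_eq_square)
  ultimately obtain d where d: "\<And>q::real. norm q < 1 \<Longrightarrow> ((\<lambda>q. \<Sum>n. q ^ n\<^sup>2) has_real_derivative d q) (at q)"
    "\<And>q. norm q < 1 \<Longrightarrow> isCont d q" using powser_reindex_deriv by blast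
  show thesis
  proof (rule that[of "\<lambda>q. 2 * d q"])
    fix q :: real assume q: "norm q < 1"
    show "(theta_phi has_real_derivative 2 * d q) (at q)"
      unfolding theta_phi_def using d(1)[OF q] by (auto intro!: derivative_eq_intros)
    show "isCont (\<lambda>q. 2 * d q) q" using d(2)[OF q] by simp
  qed
qed

lemma theta_psi_deriv:
  obtains d where "\<And>q::real. norm q < 1 \<Longrightarrow> (theta_psi has_real_derivative d q) (at q)"
    "\<And>q. norm q < 1 \<Longrightarrow> isCont d q"
proof -
  have "strict_mono (\<lambda>n::nat. n * (n + 1) div 2)"
  proof (subst strict_mono_Suc_iff, intro allI)
    fix n :: nat
    have "Suc n * (Suc n + 1) = n * (n + 1) + 2 * (n + 1)" by (simp add: algebra_simps)
    thus "n * (n + 1) div 2 < Suc n * (Suc n + 1) div 2" by simp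
  qed
  then obtain d where d: "\<And>q::real. norm q < 1 \<Longrightarrow> ((\<lambda>q. \<Sum>n. q ^ (n * (n + 1) div 2)) has_real_derivative d q) (at q)"
    "\<And>q. norm q < 1 \<Longrightarrow> isCont d q" using powser_reindex_deriv triangle_ge by blast
  show thesis
    by (rule that[of d]) (use d in \<open>auto simp: theta_psi_def [abs_def]\<close>)
qed

lemma theta_of_real:
  assumes "norm t < 1"
  shows "theta_phi (of_real t :: complex) = of_real (theta_phi t)"
    and "theta_psi (of_real t :: complex) = of_real (theta_psi t)"
  using suminf_of_real[OF summable_norm_cancel[OF theta_phi_summable[OF assms]], where 'a = complex]
        suminf_of_real[OF summable_norm_cancel[OF theta_psi_summable[OF assms]], where 'a = complex]
  by (simp_all add: theta_phi_def theta_psi_def)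

text \<open>
The theta series have real coefficients, so the complex identities restrict to real arguments.
\<close>
lemma theta_real_identities:
  fixes q :: real
  assumes q: "norm q < 1"
  shows "(theta_phi q)\<^sup>2 = (theta_phi (q\<^sup>2))\<^sup>2 + 4 * q * (theta_psi (q ^ 4))\<^sup>2"
    and "(theta_phi (-q))\<^sup>2 = (theta_phi (q\<^sup>2))\<^sup>2 - 4 * q * (theta_psi (q ^ 4))\<^sup>2"
    and "(theta_psi q)\<^sup>2 = theta_phi q * theta_psi (q\<^sup>2)"
    and "theta_phi q * theta_phi (-q) = (theta_phi (-(q\<^sup>2)))\<^sup>2"
    and "theta_phi q \<noteq> 0" "theta_psi q \<noteq> 0"
proof -
  have q2: "norm (q\<^sup>2) < 1" and q4: "norm (q ^ 4) < 1"
    using norm_power_less_1[OF q, of 2] norm_power_less_1[OF q, of 4] by simp_all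
  define c where "c = complex_of_real q"
  have c: "norm c < 1" "norm (-c) < 1" using q by (simp_all add: c_def)
  have tr: "theta_phi c = of_real (theta_phi q)" "theta_phi (-c) = of_real (theta_phi (-q))"
    "theta_phi (c\<^sup>2) = of_real (theta_phi (q\<^sup>2))"  "theta_phi (-(c\<^sup>2)) = of_real (theta_phi (-(q\<^sup>2)))"
    "theta_psi (c ^ 4) = of_real (theta_psi (q ^ 4))" "theta_psi c = of_real (theta_psi q)"
    "theta_psi (c\<^sup>2) = of_real (theta_psi (q\<^sup>2))"
    using theta_of_real[OF q] theta_of_real[OF q2] theta_of_real(2)[OF q4] 
      theta_of_real(1)[of "-q"] theta_of_real(1)[of "-(q\<^sup>2)"] q q2 by (simp_all add: c_def)
  have "of_real ((theta_phi q)\<^sup>2) = (of_real ((theta_phi (q\<^sup>2))\<^sup>2 + 4 * q * (theta_psi (q ^ 4))\<^sup>2) :: complex)"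
    using theta_phi_square[OF c(1)] by (simp only: tr) (simp add: c_def)
  thus "(theta_phi q)\<^sup>2 = (theta_phi (q\<^sup>2))\<^sup>2 + 4 * q * (theta_psi (q ^ 4))\<^sup>2"
    by (simp only: of_real_eq_iff)
  have "of_real ((theta_phi (-q))\<^sup>2) = (of_real ((theta_phi (q\<^sup>2))\<^sup>2 - 4 * q * (theta_psi (q ^ 4))\<^sup>2) :: complex)"
    using theta_phi_square[OF c(2)] by (simp add: tr) (simp add: c_def)
  thus "(theta_phi (-q))\<^sup>2 = (theta_phi (q\<^sup>2))\<^sup>2 - 4 * q * (theta_psi (q ^ 4))\<^sup>2"
    by (simp only: of_real_eq_iff)
  have "of_real ((theta_psi q)\<^sup>2) = (of_real (theta_phi q * theta_psi (q\<^sup>2)) :: complex)"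
    using theta_psi_square[OF c(1)] by (simp add: tr)
  thus "(theta_psi q)\<^sup>2 = theta_phi q * theta_psi (q\<^sup>2)"
    by (simp only: of_real_eq_iff)
  have "of_real (theta_phi q * theta_phi (-q)) = (of_real ((theta_phi (-(q\<^sup>2)))\<^sup>2) :: complex)"
    using theta_phi_mult_neg[OF c(1)] by (simp add: tr)
  thus "theta_phi q * theta_phi (-q) = (theta_phi (-(q\<^sup>2)))\<^sup>2"
    by (simp only: of_real_eq_iff)
  show "theta_phi q \<noteq> 0" "theta_psi q \<noteq> 0"
    using theta_products(4,5)[OF c(1)] by (simp_all add: tr)
qed

lemma theta_ge_1:
  fixes q :: real
  assumes "0 \<le> q" "q < 1"
  shows "theta_phi q \<ge> 1" "theta_psi q \<ge> 1"
proof -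
  have q: "norm q < 1" using assms by simp
  have "(\<Sum>n\<in>{0}. q ^ n\<^sup>2) \<le> (\<Sum>n. q ^ n\<^sup>2)"
    by (rule sum_le_suminf[OF summable_norm_cancel[OF theta_phi_summable[OF q]]]) (use assms in auto)
  thus "theta_phi q \<ge> 1" by (simp add: theta_phi_def)
  have "(\<Sum>n\<in>{0}. q ^ (n * (n + 1) div 2)) \<le> (\<Sum>n. q ^ (n * (n + 1) div 2))"
    by (rule sum_le_suminf[OF summable_norm_cancel[OF theta_psi_summable[OF q]]]) (use assms in auto)
  thus "theta_psi q \<ge> 1" by (simp add: theta_psi_def)
qed

lemma theta_0: "theta_phi (0::real) = 1" "theta_psi (0::real) = 1"
proof -
  show "theta_phi (0::real) = 1"
    unfolding theta_phi_def by (subst suminf_finite[of "{0}"]) auto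
  show "theta_psi (0::real) = 1"
    unfolding theta_psi_def 
  proof (subst suminf_finite[of "{0}"])
    fix n :: nat assume "n \<notin> {0}"
    hence "n * (n + 1) div 2 > 0" using triangle_ge[of n] by auto
    thus "(0::real) ^ (n * (n + 1) div 2) = 0" by simp
  qed auto
qed

text \<open>
Iterating \<open>x \<mapsto> x\<^sup>2\<close> drives every point of the interval to 0 without changing the value of \<open>f\<close>.
\<close>
lemma square_invariant_const:
  fixes f :: "real \<Rightarrow> real"
  assumes f: "\<And>x. 0 < x \<Longrightarrow> x < 1 \<Longrightarrow> f x = f (x\<^sup>2)" and c: "isCont f 0" and x: "0 < x" "x < 1"
  shows "f x = f 0"
proof -
  have *: "f (x ^ (2 ^ n)) = f x" for n
  proof (induction n)
    case (Suc n)
    have "f (x ^ (2 ^ n)) = f ((x ^ (2 ^ n))\<^sup>2)" using x by (intro f) (auto simp: power_less_one_iff)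
    thus ?case using Suc by (simp add: power_mult[symmetric] mult.commute)
  qed auto
  have "(\<lambda>n. x ^ n) \<longlonglongrightarrow> 0" using x by (intro LIMSEQ_power_zero) auto
  hence "(\<lambda>n. x ^ (2 ^ n)) \<longlonglongrightarrow> 0"
    by (rule LIMSEQ_subseq_LIMSEQ[unfolded o_def]) (auto simp: strict_mono_def)
  hence "(\<lambda>n. f (x ^ (2 ^ n))) \<longlonglongrightarrow> f 0" by (rule isCont_tendsto_compose[OF c])
  thus ?thesis unfolding * by (simp add: LIMSEQ_const_iff)
qed

text \<open>
\<open>\<lambda> = \<theta>\<^sub>2\<^sup>4 / \<theta>\<^sub>3\<^sup>4\<close> in the nome \<open>q\<close>.
\<close>
definition modular_lambda :: "real \<Rightarrow> real" where
  "modular_lambda q = 16 * q * theta_psi (q\<^sup>2) ^ 4 / theta_phi q ^ 4"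

text \<open>
The elliptic modulus \<open>\<theta>\<^sub>2\<^sup>2 / \<theta>\<^sub>3\<^sup>2\<close> at the nome \<open>q\<^sup>2\<close>, written without fractional powers of \<open>q\<close>. It is the
parameter in which passing from \<open>q\<^sup>2\<close> to \<open>q\<close> becomes Landen's transformation.
\<close>
definition landen_k :: "real \<Rightarrow> real" where
  "landen_k q = 4 * q * (theta_psi (q ^ 4))\<^sup>2 / (theta_phi (q\<^sup>2))\<^sup>2"

text \<open>
The doubling formulas. The first two are \<open>\<theta>\<^sub>3(q)\<^sup>2\<close> and \<open>\<theta>\<^sub>4(q)\<^sup>2\<close> as sum and difference of \<open>\<theta>\<^sub>3(q\<^sup>2)\<^sup>2\<close> and
\<open>\<theta>\<^sub>2(q\<^sup>2)\<^sup>2\<close>; the sixth is Jacobi's identity \<open>\<theta>\<^sub>3\<^sup>4 - \<theta>\<^sub>2\<^sup>4 = \<theta>\<^sub>4\<^sup>4\<close>, which bounds \<open>\<lambda>\<close> by 1.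
\<close>
lemma modular_lambda_landen:
  assumes q: "0 \<le> q" "q < 1"
  shows "(theta_phi q)\<^sup>2 = (theta_phi (q\<^sup>2))\<^sup>2 * (1 + landen_k q)"
    and "(theta_phi (-q))\<^sup>2 = (theta_phi (q\<^sup>2))\<^sup>2 * (1 - landen_k q)"
    and "landen_k q \<ge> 0"
    and "modular_lambda q = 4 * landen_k q / (1 + landen_k q)\<^sup>2"
    and "modular_lambda (q\<^sup>2) = (landen_k q)\<^sup>2"
    and "1 - modular_lambda q = theta_phi (-q) ^ 4 / theta_phi q ^ 4"
    and "theta_phi (-q) \<noteq> 0"
    and "0 < q \<Longrightarrow> 0 < modular_lambda q" "modular_lambda q < 1"
    and "0 < q \<Longrightarrow> 0 < landen_k q" "landen_k q < 1"
proof -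
  have n: "norm q < 1" and n2: "norm (q\<^sup>2) < 1" using q by (simp_all add: power_less_one_iff)
  have q2: "0 \<le> q\<^sup>2" "q\<^sup>2 < 1" "0 \<le> q ^ 4" "q ^ 4 < 1" using q by (auto simp: power_less_one_iff)
  define a where "a = theta_phi (q\<^sup>2)"
  define b where "b = theta_psi (q ^ 4)"
  define k where "k = landen_k q"
  have a: "a > 0" "b > 0" using theta_ge_1(1)[OF q2(1,2)] theta_ge_1(2)[OF q2(3,4)] by (auto simp: a_def b_def)
  have k: "k = 4 * q * b\<^sup>2 / a\<^sup>2" by (simp add: k_def landen_k_def a_def b_def)
  show k0: "landen_k q \<ge> 0" and "0 < q \<Longrightarrow> 0 < landen_k q" using a q k by (auto simp: k_def[symmetric])
  have k1: "k \<ge> 0" using k0 by (simp add: k_def)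
  have ka: "4 * q * b\<^sup>2 = k * a\<^sup>2" using a k by simp
  have p: "(theta_phi q)\<^sup>2 = a\<^sup>2 * (1 + k)"
    using theta_real_identities(1)[OF n] ka by (simp add: a_def b_def algebra_simps)
  thus "(theta_phi q)\<^sup>2 = (theta_phi (q\<^sup>2))\<^sup>2 * (1 + landen_k q)" by (simp add: a_def k_def)
  have m: "(theta_phi (-q))\<^sup>2 = a\<^sup>2 * (1 - k)"
    using theta_real_identities(2)[OF n] ka by (simp add: a_def b_def algebra_simps)
  thus "(theta_phi (-q))\<^sup>2 = (theta_phi (q\<^sup>2))\<^sup>2 * (1 - landen_k q)" by (simp add: a_def k_def)
  have ps: "(theta_psi (q\<^sup>2))\<^sup>2 = a * b"
    using theta_real_identities(3)[OF n2] by (simp add: a_def b_def)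
  have "theta_psi (q\<^sup>2) ^ 4 = ((theta_psi (q\<^sup>2))\<^sup>2)\<^sup>2" by simp
  also have "\<dots> = a\<^sup>2 * b\<^sup>2" unfolding ps by (simp add: power_mult_distrib)
  finally have ps4: "theta_psi (q\<^sup>2) ^ 4 = a\<^sup>2 * b\<^sup>2" .
  have p4: "theta_phi q ^ 4 = a ^ 4 * (1 + k)\<^sup>2"
  proof -
    have "theta_phi q ^ 4 = ((theta_phi q)\<^sup>2)\<^sup>2" by simp
    thus ?thesis unfolding p by (simp add: power_mult_distrib)
  qed
  have m4: "theta_phi (-q) ^ 4 = a ^ 4 * (1 - k)\<^sup>2"
  proof -
    have "theta_phi (-q) ^ 4 = ((theta_phi (-q))\<^sup>2)\<^sup>2" by simp
    thus ?thesis unfolding m by (simp add: power_mult_distrib)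
  qed
  have lam: "modular_lambda q = 4 * k / (1 + k)\<^sup>2"
  proof -
    have "modular_lambda q = 4 * a\<^sup>2 * (4 * q * b\<^sup>2) / (a ^ 4 * (1 + k)\<^sup>2)"
      unfolding modular_lambda_def ps4 p4 by (simp add: mult_ac)
    also have "\<dots> = 4 * (a ^ 4) * k / (a ^ 4 * (1 + k)\<^sup>2)" 
      unfolding ka by (simp add: mult_ac power4_eq_xxxx power2_eq_square)
    also have "\<dots> = 4 * k / (1 + k)\<^sup>2" using a by simp
    finally show ?thesis .
  qed
  thus "modular_lambda q = 4 * landen_k q / (1 + landen_k q)\<^sup>2" by (simp add: k_def)
  show "modular_lambda (q\<^sup>2) = (landen_k q)\<^sup>2"
  proof -
    have "modular_lambda (q\<^sup>2) = 16 * q\<^sup>2 * b ^ 4 / a ^ 4"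
      by (simp add: modular_lambda_def a_def b_def power_mult[symmetric])
    thus ?thesis by (simp add: k_def[symmetric] k power_divide power_mult_distrib)
  qed
  show "1 - modular_lambda q = theta_phi (-q) ^ 4 / theta_phi q ^ 4"
  proof -
    have "1 - modular_lambda q = (1 - k)\<^sup>2 / (1 + k)\<^sup>2"
      unfolding lam using k1 by (simp add: divide_simps) (simp add: power2_eq_square algebra_simps)
    thus ?thesis unfolding m4 p4 using a by simp
  qed
  show "theta_phi (-q) \<noteq> 0" using theta_real_identities(5)[of "-q"] n by simp
  hence kn1: "k \<noteq> 1" using m4 by auto
  have "(theta_phi (-q))\<^sup>2 > 0" using \<open>theta_phi (-q) \<noteq> 0\<close> by simp
  hence k2: "k < 1" unfolding m using a by (simp add: zero_less_mult_iff)
  thus "landen_k q < 1" by (simp add: k_def)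
  show "0 < modular_lambda q" if "0 < q"
    using that theta_ge_1[OF q] theta_ge_1[OF q2(1,2)] by (auto simp: modular_lambda_def)
  have "0 < (1 - k)\<^sup>2" using kn1 by simp
  hence "4 * k < (1 + k)\<^sup>2" by (simp add: power2_eq_square algebra_simps)
  thus "modular_lambda q < 1" unfolding lam using k1 by simp
qed

text \<open>
The logarithmic derivative \<open>q \<lambda>'/\<lambda>\<close> is \<open>\<theta>\<^sub>4\<^sup>4\<close>. Differentiating the two doubling formulas for \<open>\<lambda>\<close> shows
that \<open>q \<lambda>'/\<lambda>\<close> picks up the factor \<open>(1 - k)/(1 + k)\<close> when \<open>q\<^sup>2\<close> is replaced by \<open>q\<close>, and so does \<open>\<theta>\<^sub>4\<^sup>4\<close>.
The quotient is thus invariant under \<open>q \<mapsto> q\<^sup>2\<close>, and it is 1 at 0.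
\<close>
theorem modular_lambda_has_derivative:
  assumes q: "0 < q" "q < 1"
  shows "(modular_lambda has_real_derivative modular_lambda q * theta_phi (-q) ^ 4 / q) (at q)"
proof -
  obtain d1 where d1: "\<And>q::real. norm q < 1 \<Longrightarrow> (theta_phi has_real_derivative d1 q) (at q)"
    "\<And>q. norm q < 1 \<Longrightarrow> isCont d1 q" using theta_phi_deriv by blast
  obtain d2 where d2: "\<And>q::real. norm q < 1 \<Longrightarrow> (theta_psi has_real_derivative d2 q) (at q)"
    "\<And>q. norm q < 1 \<Longrightarrow> isCont d2 q" using theta_psi_deriv by blast
  have c1: "isCont theta_phi q" "isCont theta_psi q" if "norm q < 1" for q :: real
    using d1(1)[OF that] d2(1)[OF that] DERIV_isCont by blast+
  \<comment> \<open>the logarithmic derivative \<open>q \<lambda>'/\<lambda>\<close>, in a form that is continuous at 0\<close>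
  define W where "W = (\<lambda>q::real. 1 + 8 * q\<^sup>2 * d2 (q\<^sup>2) / theta_psi (q\<^sup>2) - 4 * q * d1 q / theta_phi q)"
  have sq: "norm (q\<^sup>2) < 1" "norm (q ^ 4) < 1" if "norm q < 1" for q :: real
    using norm_power_less_1[OF that, of 2] norm_power_less_1[OF that, of 4] by simp_all
  have dpsi: "((\<lambda>q. theta_psi (q\<^sup>2)) has_real_derivative d2 (q\<^sup>2) * (2 * q)) (at q)" if "norm q < 1" for q
    by (rule DERIV_chain2[where f = theta_psi and g = "\<lambda>q. q\<^sup>2", OF d2(1)[OF sq(1)[OF that]]]) (auto intro!: derivative_eq_intros)
  have dlam: "(modular_lambda has_real_derivative modular_lambda q * W q / q) (at q)" if "0 < q" "q < 1" for q
  proof -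
    have n: "norm q < 1" using that by simp
    have nz: "theta_phi q \<noteq> 0" "theta_psi (q\<^sup>2) \<noteq> 0"
      using theta_real_identities(5)[OF n] theta_real_identities(6)[OF sq(1)[OF n]] by auto
    have 1: "((\<lambda>q. 16 * q * theta_psi (q\<^sup>2) ^ 4) has_real_derivative
        16 * theta_psi (q\<^sup>2) ^ 4 + 16 * q * (4 * theta_psi (q\<^sup>2) ^ 3 * (d2 (q\<^sup>2) * (2 * q)))) (at q)"
      using dpsi[OF n] by (auto intro!: derivative_eq_intros)
    have 2: "((\<lambda>q. theta_phi q ^ 4) has_real_derivative 4 * theta_phi q ^ 3 * d1 q) (at q)"
      using d1(1)[OF n] by (auto intro!: derivative_eq_intros)
    have "((16 * P ^ 4 + 16 * q * (4 * P ^ 3 * (D2 * (2 * q)))) * F ^ 4 - 16 * q * P ^ 4 * (4 * F ^ 3 * D1)) / (F ^ 4 * F ^ 4)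
       = 16 * q * P ^ 4 / F ^ 4 * (1 + 8 * q\<^sup>2 * D2 / P - 4 * q * D1 / F) / q"
      if "P \<noteq> 0" "F \<noteq> 0" for P F D1 D2 :: real
      using that \<open>0 < q\<close> by (simp add: divide_simps) (simp add: algebra_simps eval_nat_numeral)
    from this[OF nz(2,1)] DERIV_divide[OF 1 2] nz show ?thesis
      unfolding modular_lambda_def[abs_def] W_def by simp
  qed
  have W0: "W 0 = 1" by (simp add: W_def)
  have "isCont d2 (0\<^sup>2)" "isCont theta_psi ((0::real)\<^sup>2)" "isCont d1 0" "isCont theta_phi (0::real)"
    using d2(2)[of 0] d1(2)[of 0] c1[of 0] by simp_all
  hence W_cont: "isCont W 0"
    unfolding W_def
    by (intro continuous_intros isCont_o2[of "0::real" "\<lambda>q. q\<^sup>2"]) (auto simp: theta_0)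
  have W_step: "W q = W (q\<^sup>2) * (1 - landen_k q) / (1 + landen_k q)" if q: "0 < q" "q < 1" for q
  proof -
    have n: "norm q < 1" using q by simp
    have n2: "norm (q\<^sup>2) < 1" by (rule sq(1)[OF n])
    have n4: "norm (q ^ 4) < 1" by (rule sq(2)[OF n])
    have nz: "theta_phi (q\<^sup>2) \<noteq> 0" using theta_real_identities(5)[OF n2] .
    have "landen_k differentiable (at q)"
    proof -
      have "theta_psi differentiable (at (q ^ 4))" "theta_phi differentiable (at (q\<^sup>2))"
        using d1(1)[OF n2] d2(1)[OF n4] real_differentiable_def by blast+
      hence "(\<lambda>q. theta_psi (q ^ 4)) differentiable (at q)" "(\<lambda>q. theta_phi (q\<^sup>2)) differentiable (at q)"
        using differentiable_chain_at[of "\<lambda>q. q ^ 4" q theta_psi] differentiable_chain_at[of "\<lambda>q. q\<^sup>2" q theta_phi]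
        by (auto simp: o_def)
      thus ?thesis unfolding landen_k_def using nz by (intro derivative_intros) auto
    qed
    then obtain k' where k': "(landen_k has_real_derivative k') (at q)"
      using real_differentiable_def by blast
    define k where "k = landen_k q"
    have k: "0 < k" "k < 1" using modular_lambda_landen(10,11)[of q] q by (auto simp: k_def)
    have "((\<lambda>q. modular_lambda (q\<^sup>2)) has_real_derivative modular_lambda (q\<^sup>2) * W (q\<^sup>2) / q\<^sup>2 * (2 * q)) (at q)"
      by (rule DERIV_chain2[OF dlam]) (use q in \<open>auto intro!: derivative_eq_intros simp: power_less_one_iff\<close>)
    moreover have "((\<lambda>q. modular_lambda (q\<^sup>2)) has_real_derivative 2 * k * k') (at q)"
    proof (rule has_field_derivative_transform_within_open)
      show "((\<lambda>q. (landen_k q)\<^sup>2) has_real_derivative 2 * k * k') (at q)"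
        using k' by (auto intro!: derivative_eq_intros simp: k_def)
      show "open {0<..<1::real}" "q \<in> {0<..<1}" using q by auto
    qed (use modular_lambda_landen(5) in auto)
    ultimately have e1: "modular_lambda (q\<^sup>2) * W (q\<^sup>2) / q\<^sup>2 * (2 * q) = 2 * k * k'" by (rule DERIV_unique)
    have "modular_lambda (q\<^sup>2) = k\<^sup>2" using modular_lambda_landen(5)[of q] q by (simp add: k_def)
    hence e1': "W (q\<^sup>2) = q * k' / k"
      using e1 q k by (simp add: field_simps power2_eq_square)
    have "(modular_lambda has_real_derivative 4 * k' * (1 - k) / (1 + k) ^ 3) (at q)"
    proof (rule has_field_derivative_transform_within_open)
      have 1: "((\<lambda>q. 4 * landen_k q) has_real_derivative 4 * k') (at q)"
        using k' by (auto intro!: derivative_eq_intros)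
      have 2: "((\<lambda>q. (1 + landen_k q)\<^sup>2) has_real_derivative 2 * (1 + k) * k') (at q)"
        using k' by (auto intro!: derivative_eq_intros simp: k_def)
      have "(4 * k' * (1 + k)\<^sup>2 - 4 * k * (2 * (1 + k) * k')) / ((1 + k)\<^sup>2 * (1 + k)\<^sup>2) = 4 * k' * (1 - k) / (1 + k) ^ 3"
        using k by (simp add: divide_simps) (simp add: algebra_simps eval_nat_numeral)
      with DERIV_divide[OF 1 2] k
      show "((\<lambda>q. 4 * landen_k q / (1 + landen_k q)\<^sup>2) has_real_derivative 4 * k' * (1 - k) / (1 + k) ^ 3) (at q)"
        by (simp add: k_def)
      show "open {0<..<1::real}" "q \<in> {0<..<1}" using q by auto
    qed (use modular_lambda_landen(4) in auto)
    with dlam[OF q] have "modular_lambda q * W q / q = 4 * k' * (1 - k) / (1 + k) ^ 3" by (rule DERIV_unique)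
    moreover have "modular_lambda q = 4 * k / (1 + k)\<^sup>2" using modular_lambda_landen(4)[of q] q by (simp add: k_def)
    ultimately have "(4 * k / (1 + k)\<^sup>2) * W q / q * (q * (1 + k)\<^sup>2 / (4 * k)) =
        4 * k' * (1 - k) / (1 + k) ^ 3 * (q * (1 + k)\<^sup>2 / (4 * k))" by simp
    hence "W q = q * k' / k * (1 - k) / (1 + k)"
      using q k by (simp add: power2_eq_square power3_eq_cube) (simp add: mult_ac)
    thus ?thesis unfolding e1' k_def .
  qed
  define D where "D = (\<lambda>q. W q / theta_phi (-q) ^ 4)"
  have "D q = D 0"
  proof (rule square_invariant_const[OF _ _ q])
    show "isCont D 0" unfolding D_def using W_cont c1(1)[of "-0"]
      by (intro continuous_intros isCont_o2[of 0 uminus theta_phi]) (auto simp: theta_0)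
  next
    fix q :: real assume q: "0 < q" "q < 1"
    have q2: "0 \<le> q\<^sup>2" "q\<^sup>2 < 1" using q by (auto simp: power_less_one_iff)
    define k where "k = landen_k q"
    define a where "a = theta_phi (q\<^sup>2)"
    have k: "0 < k" "k < 1" using modular_lambda_landen(10,11)[of q] q by (auto simp: k_def)
    have a: "a > 0" using theta_ge_1(1)[OF q2] by (auto simp: a_def)
    have m: "(theta_phi (-q))\<^sup>2 = a\<^sup>2 * (1 - k)" and p: "(theta_phi q)\<^sup>2 = a\<^sup>2 * (1 + k)"
      using modular_lambda_landen(1,2)[of q] q by (auto simp: a_def k_def)
    have "theta_phi (-q) ^ 4 = ((theta_phi (-q))\<^sup>2)\<^sup>2" by simp
    hence m4: "theta_phi (-q) ^ 4 = a ^ 4 * (1 - k)\<^sup>2" unfolding m by (simp add: power_mult_distrib)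
    have "theta_phi (-(q\<^sup>2)) ^ 4 = ((theta_phi (-(q\<^sup>2)))\<^sup>2)\<^sup>2" by simp
    also have "\<dots> = (theta_phi q)\<^sup>2 * (theta_phi (-q))\<^sup>2"
      using theta_real_identities(4)[of q] q by (simp add: power_mult_distrib[symmetric])
    finally have s4: "theta_phi (-(q\<^sup>2)) ^ 4 = a ^ 4 * ((1 + k) * (1 - k))"
      unfolding m p by (simp add: mult_ac power4_eq_xxxx power2_eq_square)
    have "D q = W (q\<^sup>2) * (1 - k) / (1 + k) / (a ^ 4 * (1 - k)\<^sup>2)"
      unfolding D_def m4 W_step[OF q] k_def ..
    also have "\<dots> = D (q\<^sup>2)" unfolding D_def s4 using a k by (simp add: power2_eq_square divide_simps)
    finally show "D q = D (q\<^sup>2)" .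
  qed
  hence "W q = theta_phi (-q) ^ 4"
    using modular_lambda_landen(7)[of q] q by (simp add: D_def W0 theta_0 field_simps)
  thus ?thesis using dlam[OF q] by simp
qed

lemma modular_lambda_strict_mono:
  assumes "0 < a" "a < b" "b < 1"
  shows "modular_lambda a < modular_lambda b"
proof (rule DERIV_pos_imp_increasing[OF assms(2)])
  fix x assume "a \<le> x" "x \<le> b"
  hence x: "0 < x" "x < 1" using assms by auto
  have "theta_phi (-x) \<noteq> 0" "modular_lambda x > 0" using modular_lambda_landen(7,8)[of x] x by auto
  hence "modular_lambda x * theta_phi (-x) ^ 4 / x > 0" using x by simp
  thus "\<exists>y. (modular_lambda has_real_derivative y) (at x) \<and> 0 < y"
    using modular_lambda_has_derivative[OF x] by blast
qed

lemma modular_lambda_isCont_0: "isCont modular_lambda 0"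
proof -
  obtain d1 where d1: "\<And>q::real. norm q < 1 \<Longrightarrow> (theta_phi has_real_derivative d1 q) (at q)"
    "\<And>q. norm q < 1 \<Longrightarrow> isCont d1 q" using theta_phi_deriv by blast
  obtain d2 where d2: "\<And>q::real. norm q < 1 \<Longrightarrow> (theta_psi has_real_derivative d2 q) (at q)"
    "\<And>q. norm q < 1 \<Longrightarrow> isCont d2 q" using theta_psi_deriv by blast
  have "isCont theta_psi ((0::real)\<^sup>2)" "isCont theta_phi (0::real)"
    using d1(1)[of 0, THEN DERIV_isCont] d2(1)[of 0, THEN DERIV_isCont] by simp_all
  moreover from this(1) have "isCont (\<lambda>q::real. theta_psi (q\<^sup>2)) 0"
    by (intro isCont_o2[where g = theta_psi and f = "\<lambda>q. q\<^sup>2"]) auto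
  ultimately show ?thesis unfolding modular_lambda_def
    by (intro isCont_divide isCont_mult isCont_power continuous_const continuous_ident) (auto simp: theta_0)
qed

text \<open>
Along the sequence of repeated square roots of some \<open>q\<close> the values of \<open>\<lambda>\<close> increase, and their limit
is fixed by \<open>x \<mapsto> 4\<surd>x / (1 + \<surd>x)\<^sup>2\<close>. The only positive fixed point is 1.
\<close>
lemma modular_lambda_exceeds:
  assumes "t < 1"
  shows "\<exists>q. 0 < q \<and> q < 1 \<and> t < modular_lambda q"
proof -
  \<comment> \<open>each term is the square root of the one before\<close>
  define x where "x = (\<lambda>n. exp (- (1 / 2 ^ n) :: real))"
  have x: "0 < x n" "x n < 1" for n by (auto simp: x_def)
  have xs: "(x (Suc n))\<^sup>2 = x n" for n
    by (simp add: x_def power2_eq_square exp_add[symmetric])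
  define l where "l = (\<lambda>n. modular_lambda (x n))"
  have l: "0 < l n" "l n < 1" for n
    using modular_lambda_landen(8,9)[of "x n"] x[of n] by (auto simp: l_def)
  \<comment> \<open>Landen's formula without denominators; \<open>sqrt (l n)\<close> is the modulus\<close>
  have step: "l (Suc n) * (1 + sqrt (l n))\<^sup>2 = 4 * sqrt (l n)" for n
  proof -
    have "sqrt (l n) = landen_k (x (Suc n))"
      using modular_lambda_landen(3,5)[of "x (Suc n)"] x[of "Suc n"] by (simp add: xs l_def)
    moreover have "1 + landen_k (x (Suc n)) \<noteq> 0"
      using modular_lambda_landen(3)[of "x (Suc n)"] x[of "Suc n"] by auto
    ultimately show ?thesis
      using modular_lambda_landen(4)[of "x (Suc n)"] x[of "Suc n"] by (simp add: l_def)
  qed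
  have mono: "incseq l"
  proof (rule incseq_SucI)
    fix n
    have "x n < x (Suc n)"
      by (simp add: x_def field_simps)
    from modular_lambda_strict_mono[OF x(1) this x(2)]
    show "l n \<le> l (Suc n)" by (simp add: l_def)
  qed
  obtain L where L: "l \<longlonglongrightarrow> L" "\<And>n. l n \<le> L"
    using incseq_convergent[OF mono, of 1] l(2)[THEN less_imp_le] by metis
  have Lpos: "L > 0" using L(2)[of 0] l(1)[of 0] by simp
  have "(\<lambda>n. l (Suc n) * (1 + sqrt (l n))\<^sup>2) \<longlonglongrightarrow> L * (1 + sqrt L)\<^sup>2"
    by (intro tendsto_intros L(1) LIMSEQ_Suc)
  moreover have "(\<lambda>n. 4 * sqrt (l n)) \<longlonglongrightarrow> 4 * sqrt L" by (intro tendsto_intros L(1))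
  ultimately have eq: "L * (1 + sqrt L)\<^sup>2 = 4 * sqrt L" unfolding step by (rule LIMSEQ_unique)
  define u where "u = sqrt L"
  have u: "u > 0" "L = u\<^sup>2" using Lpos by (auto simp: u_def)
  have "u * (u * (1 + u)\<^sup>2) = u * 4" using eq u unfolding u_def[symmetric] by (simp add: power2_eq_square mult_ac)
  hence "u * (1 + u)\<^sup>2 = 4" using u by simp
  have "u \<ge> 1"
  proof (rule ccontr)
    assume "\<not> u \<ge> 1"
    hence u1: "u < 1" by simp
    hence "(1 + u)\<^sup>2 < 2\<^sup>2" using u by (intro power_strict_mono) auto
    hence "u * (1 + u)\<^sup>2 < 1 * 4" using u(1) u1 by (intro mult_strict_mono) auto
    with \<open>u * (1 + u)\<^sup>2 = 4\<close> show False by simp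
  qed
  hence "L \<ge> 1" using u by simp
  hence "\<forall>\<^sub>F n in sequentially. t < l n" using assms by (intro order_tendstoD(1)[OF L(1)]) simp
  then obtain n where "t < l n" by (auto simp: eventually_sequentially)
  thus ?thesis using x[of n] by (auto simp: l_def)
qed

lemma modular_lambda_image: "modular_lambda ` {0<..<1} = {0<..<1}"
proof (intro equalityI subsetI)
  fix t :: real assume "t \<in> {0<..<1}"
  hence t: "0 < t" "t < 1" by auto
  obtain q where q: "0 < q" "q < 1" "t < modular_lambda q" using modular_lambda_exceeds[OF t(2)] by blast
  have c: "\<forall>x. 0 \<le> x \<and> x \<le> q \<longrightarrow> isCont modular_lambda x"
  proof (intro allI impI)
    fix x assume "0 \<le> x \<and> x \<le> q"
    then consider "x = 0" | "0 < x" "x < 1" using q by linarith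
    thus "isCont modular_lambda x"
      using modular_lambda_isCont_0 modular_lambda_has_derivative[THEN DERIV_isCont] by cases auto
  qed
  have "modular_lambda 0 = 0" by (simp add: modular_lambda_def)
  with IVT[of modular_lambda 0 t q] q t c obtain x where x: "0 \<le> x" "x \<le> q" "modular_lambda x = t" by auto
  with \<open>modular_lambda 0 = 0\<close> t have "x \<noteq> 0" by auto
  with x q show "t \<in> modular_lambda ` {0<..<1}" by (intro image_eqI[of _ _ x]) auto
qed (use modular_lambda_landen(8,9) in auto)

lemma modular_lambda_inj: "inj_on modular_lambda {0<..<1}"
proof (rule inj_onI)
  fix x y :: real assume "x \<in> {0<..<1}" "y \<in> {0<..<1}" "modular_lambda x = modular_lambda y"
  thus "x = y" using modular_lambda_strict_mono[of x y] modular_lambda_strict_mono[of y x]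
    by (cases x y rule: linorder_cases) auto
qed

section \<open>Landen's transformation and the hypergeometric function of lambda\<close>

lemma has_integral_termwise:
  fixes f :: "nat \<Rightarrow> real \<Rightarrow> 'b::banach"
  assumes cont: "\<And>n. continuous_on {a..b} (f n)"
    and le: "\<And>n x. x \<in> {a..b} \<Longrightarrow> norm (f n x) \<le> M n" and M: "summable M"
    and I: "\<And>n. (f n has_integral I n) {a..b}"
  shows "((\<lambda>x. \<Sum>n. f n x) has_integral (\<Sum>n. I n)) {a..b}" and "I sums (\<Sum>n. I n)"
proof -
  have u: "uniform_limit {a..b} (\<lambda>n x. \<Sum>i<n. f i x) (\<lambda>x. suminf (\<lambda>i. f i x)) sequentially"
    by (rule Weierstrass_m_test[OF le M])
  have c: "continuous_on {a..b} (\<lambda>x. \<Sum>i<n. f i x)" for n by (intro continuous_intros cont)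
  obtain I' J where IJ: "\<And>n. ((\<lambda>x. \<Sum>i<n. f i x) has_integral I' n) {a..b}"
    "((\<lambda>x. suminf (\<lambda>i. f i x)) has_integral J) {a..b}" "I' \<longlonglongrightarrow> J"
    using uniform_limit_integral[OF u c trivial_limit_sequentially] by blast
  have "((\<lambda>x. \<Sum>i<n. f i x) has_integral (\<Sum>i<n. I i)) {a..b}" for n
    by (intro has_integral_sum I) auto
  hence "I' n = (\<Sum>i<n. I i)" for n using IJ(1) has_integral_unique by blast
  hence "I' = (\<lambda>n. \<Sum>i<n. I i)" by auto
  hence "I sums J" using IJ(3) by (simp add: sums_def)
  thus "((\<lambda>x. \<Sum>n. f n x) has_integral (\<Sum>n. I n)) {a..b}" "I sums (\<Sum>n. I n)"
    using IJ(2) by (auto simp: sums_iff)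
qed

text \<open>
The Taylor coefficients of \<open>(1 - x)\<^bsup>-1/2\<^esup>\<close>.
\<close>
definition half_coeff :: "nat \<Rightarrow> real" where
  "half_coeff n = pochhammer (1 / 2) n / fact n"

text \<open>
The Gauss hypergeometric function \<open>\<^sub>2F\<^sub>1(1/2, 1/2; 1; x)\<close>.
\<close>
definition hyp_half :: "real \<Rightarrow> real" where
  "hyp_half x = (\<Sum>n. (half_coeff n)\<^sup>2 * x ^ n)"

lemma half_coeff_Suc: "half_coeff (Suc n) = half_coeff n * (2 * real n + 1) / (2 * real n + 2)"
  by (simp add: half_coeff_def pochhammer_Suc field_simps)

lemma half_coeff_0 [simp]: "half_coeff 0 = 1" by (simp add: half_coeff_def)

lemma half_coeff_bounds: "0 < half_coeff n" "half_coeff n \<le> 1"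
proof -
  show p: "0 < half_coeff n" for n by (induction n) (auto simp: half_coeff_Suc)
  show "half_coeff n \<le> 1"
  proof (induction n)
    case (Suc n)
    have "half_coeff (Suc n) = half_coeff n * ((2 * real n + 1) / (2 * real n + 2))"
      by (simp add: half_coeff_Suc)
    also have "\<dots> \<le> 1 * 1" by (intro mult_mono Suc) (auto simp: p less_imp_le)
    finally show ?case by simp
  qed auto
qed

lemma half_coeff_gbinomial:
  fixes z :: "'a::{real_field}"
  shows "(- (1/2) gchoose n) * (-z) ^ n = of_real (half_coeff n) * z ^ n"
proof -
  have "pochhammer (1/2 :: 'a) n = of_real (pochhammer (1/2) n)"
    by (induction n) (simp_all add: pochhammer_Suc)
  moreover have "(-1) ^ n * (-z) ^ n = z ^ n" by (simp add: power_mult_distrib[symmetric])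
  ultimately show ?thesis by (simp add: gbinomial_pochhammer half_coeff_def)
qed

lemma half_binomial_series_complex:
  fixes z :: complex
  assumes "norm z < 1"
  shows "(\<lambda>n. of_real (half_coeff n) * z ^ n) sums (1 - z) powr (-1/2)"
  using gen_binomial_complex[of "-z" "-1/2"] assms
  by (simp add: half_coeff_gbinomial)

lemma half_binomial_series_real:
  fixes x :: real
  assumes "\<bar>x\<bar> < 1"
  shows "(\<lambda>n. half_coeff n * x ^ n) sums (1 - x) powr (-1/2)"
  using gen_binomial_real[of "-x" "-1/2"] assms
  by (simp add: half_coeff_gbinomial)

lemma summable_half_coeff:
  assumes "0 \<le> k" "k < 1"
  shows "summable (\<lambda>n. half_coeff n * k ^ n)"
  using half_binomial_series_real[of k] assms by (simp add: sums_iff)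

lemma has_integral_cis:
  "((\<lambda>t. cis (of_int m * t)) has_integral complex_of_real (if m = 0 then 2 * pi else 0)) {0..2*pi}"
proof (cases "m = 0")
  case True
  thus ?thesis using has_integral_const_real[of "1::complex" 0 "2 * pi"]
    by (simp add: scaleR_conv_of_real)
next
  case False
  have "((\<lambda>t. cis (of_int m * t)) has_integral 
      (cis (of_int m * (2*pi)) / (\<i> * of_int m) - cis (of_int m * 0) / (\<i> * of_int m))) {0..2*pi}"
  proof (rule fundamental_theorem_of_calculus)
    fix x :: real
    have "((\<lambda>t. exp (\<i> * (of_int m * of_real t)) / (\<i> * of_int m)) has_vector_derivative 
        exp (\<i> * (of_int m * of_real x))) (at x within {0..2*pi})"
    proof -
      have "((\<lambda>z. exp (c * z) / c) has_field_derivative exp (c * z)) (at z)" if "c \<noteq> 0" for c z :: complex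
        using that by (auto intro!: derivative_eq_intros)
      from this[of "\<i> * of_int m" "of_real x"]
      have "((\<lambda>z. exp (\<i> * (of_int m * z)) / (\<i> * of_int m)) has_field_derivative 
        exp (\<i> * (of_int m * of_real x))) (at (of_real x))"
        using False by (simp add: mult.assoc)
      thus ?thesis using has_vector_derivative_real_field by blast
    qed
    thus "((\<lambda>t. cis (of_int m * t) / (\<i> * of_int m)) has_vector_derivative cis (of_int m * x)) (at x within {0..2*pi})"
      by (simp add: cis_conv_exp)
  qed simp
  moreover have "cis (of_int m * (2*pi)) = 1"
    using cis_multiple_2pi[of "of_int m"] by (simp add: mult_ac)
  ultimately show ?thesis using False by simp
qed

text \<open>
Parseval's identity for \<open>(1 - k e\<^bsup>it\<^esup>)\<^bsup>-1/2\<^esup> = \<Sum> c\<^sub>n e\<^bsup>int\<^esup>\<close>, whose absolute square is the integrand.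
\<close>
lemma hyp_half_parseval:
  assumes k: "0 \<le> k" "k < 1"
  shows "((\<lambda>t. norm (1 - of_real k * cis t) powr (-1)) has_integral 2 * pi * hyp_half (k\<^sup>2)) {0..2*pi}"
proof -
  define c where "c = (\<lambda>n. half_coeff n * k ^ n)"
  have c0: "c n \<ge> 0" for n using k half_coeff_bounds(1)[of n] by (auto simp: c_def)
  have cs: "summable c" unfolding c_def using summable_half_coeff[OF k] .
  define w where "w = (\<lambda>t. (1 - of_real k * cis t) powr (-1/2))"
  have nk: "norm (of_real k * cis t) < 1" for t using k by (simp add: norm_mult)
  have w: "(\<lambda>n. of_real (c n) * cis (real n * t)) sums w t" for t
    using half_binomial_series_complex[OF nk[of t]]
    by (simp add: w_def c_def power_mult_distrib Complex.DeMoivre mult_ac)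
  have wc: "(\<lambda>n. of_real (c n) * cis (- real n * t)) sums cnj (w t)" for t
    using sums_cnj[THEN iffD2, OF w[of t]] by (simp add: cis_cnj)
  have cont: "continuous_on {0..2*pi} (\<lambda>t. of_real (c n) * cis (x * t))" for n x
    by (intro continuous_intros)
  have "continuous_on {0..2*pi} (\<lambda>t. \<Sum>n. of_real (c n) * cis (- real n * t))"
  proof (rule uniform_limit_theorem[OF _ Weierstrass_m_test[OF _ cs]])
    show "\<forall>\<^sub>F n in sequentially. continuous_on {0..2*pi} (\<lambda>t. \<Sum>i<n. of_real (c i) * cis (- real i * t))"
      by (intro always_eventually allI continuous_intros)
  qed (use c0 in \<open>auto simp: norm_mult\<close>)
  hence contw: "continuous_on {0..2*pi} (\<lambda>t. cnj (w t))" using wc by (simp add: sums_iff)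
  have int1: "((\<lambda>t. cis (real m * t) * cnj (w t)) has_integral of_real (2 * pi * c m)) {0..2*pi}" for m
  proof -
    have "((\<lambda>t. \<Sum>n. of_real (c n) * cis (of_int (int m - int n) * t)) has_integral 
       (\<Sum>n. of_real (c n) * complex_of_real (if int m - int n = 0 then 2 * pi else 0))) {0..2*pi}"
    proof (rule has_integral_termwise(1)[OF cont _ cs])
      show "norm (of_real (c n) * cis (of_int (int m - int n) * t)) \<le> c n" for n t
        using c0[of n] by (simp add: norm_mult)
      show "((\<lambda>t. of_real (c n) * cis (of_int (int m - int n) * t)) has_integral
          of_real (c n) * complex_of_real (if int m - int n = 0 then 2 * pi else 0)) {0..2*pi}" for n
        by (rule has_integral_mult_right[OF has_integral_cis])
    qed
    also have "(\<lambda>t. \<Sum>n. of_real (c n) * cis (of_int (int m - int n) * t)) = (\<lambda>t. cis (real m * t) * cnj (w t))"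
    proof
      fix t 
      have "(\<lambda>n. of_real (c n) * cis (of_int (int m - int n) * t)) = (\<lambda>n. cis (real m * t) * (of_real (c n) * cis (- real n * t)))"
        by (simp add: cis_mult algebra_simps)
      thus "(\<Sum>n. of_real (c n) * cis (of_int (int m - int n) * t)) = cis (real m * t) * cnj (w t)"
        using sums_mult[OF wc[of t], of "cis (real m * t)"] by (simp add: sums_iff)
    qed
    also have "(\<Sum>n. of_real (c n) * complex_of_real (if int m - int n = 0 then 2 * pi else 0)) = of_real (2 * pi * c m)"
      by (subst suminf_finite[of "{m}"]) auto
    finally show ?thesis by simp
  qed
  obtain B where "\<forall>z\<in>(\<lambda>t. cnj (w t)) ` {0..2*pi}. norm z \<le> B"
    using compact_imp_bounded[OF compact_continuous_image[OF contw compact_Icc]] unfolding bounded_iff by blast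
  hence B: "norm (cnj (w t)) \<le> B" if "t \<in> {0..2*pi}" for t using that by blast
  have "((\<lambda>t. \<Sum>m. of_real (c m) * (cis (real m * t) * cnj (w t))) has_integral (\<Sum>m. of_real (c m) * of_real (2 * pi * c m))) {0..2*pi}"
  proof (rule has_integral_termwise(1))
    show "summable (\<lambda>m. c m * B)" by (intro summable_mult2 cs)
    show "continuous_on {0..2*pi} (\<lambda>t. of_real (c m) * (cis (real m * t) * cnj (w t)))" for m
      by (intro continuous_intros contw)
    show "norm (of_real (c m) * (cis (real m * t) * cnj (w t))) \<le> c m * B" if "t \<in> {0..2*pi}" for m t
      using B[OF that] c0[of m] by (auto simp: norm_mult intro!: mult_left_mono)
    show "((\<lambda>t. of_real (c m) * (cis (real m * t) * cnj (w t))) has_integral of_real (c m) * of_real (2 * pi * c m)) {0..2*pi}" for m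
      by (intro has_integral_mult_right int1)
  qed
  also have "(\<lambda>t. \<Sum>m. of_real (c m) * (cis (real m * t) * cnj (w t))) = (\<lambda>t. of_real (norm (1 - of_real k * cis t) powr (-1)))"
  proof
    fix t
    have "(\<Sum>m. of_real (c m) * (cis (real m * t) * cnj (w t))) = w t * cnj (w t)"
      using sums_mult2[OF w[of t], of "cnj (w t)"] by (simp add: sums_iff mult_ac)
    also have "\<dots> = of_real ((norm (w t))\<^sup>2)" by (rule complex_norm_square[symmetric])
    also have "(norm (w t))\<^sup>2 = norm (1 - of_real k * cis t) powr (-1)"
    proof -
      have "norm (w t) = norm (1 - of_real k * cis t) powr (-1/2)"
        unfolding w_def by (subst norm_powr_real_powr') auto
      thus ?thesis by (simp only: power2_eq_square powr_add[symmetric]) simp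
    qed
    finally show "(\<Sum>m. of_real (c m) * (cis (real m * t) * cnj (w t))) = of_real (norm (1 - of_real k * cis t) powr (-1))" .
  qed
  also have "(\<Sum>m. of_real (c m) * of_real (2 * pi * c m)) = complex_of_real (2 * pi * hyp_half (k\<^sup>2))"
  proof -
    have le: "(c m)\<^sup>2 \<le> c m" for m
    proof -
      have "c m \<le> 1 * 1" unfolding c_def using k half_coeff_bounds[of m] by (intro mult_mono power_le_one) auto
      thus ?thesis using c0[of m] by (simp add: power2_eq_square mult_left_le)
    qed
    have "summable (\<lambda>m. (c m)\<^sup>2)"
      by (rule summable_comparison_test'[OF cs]) (use le in auto)
    hence "summable (\<lambda>m. 2 * pi * (c m)\<^sup>2)" by (intro summable_mult)
    hence "(\<Sum>m. complex_of_real (2 * pi * (c m)\<^sup>2)) = of_real (\<Sum>m. 2 * pi * (c m)\<^sup>2)"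
      by (simp add: suminf_of_real)
    also have "(\<Sum>m. 2 * pi * (c m)\<^sup>2) = 2 * pi * hyp_half (k\<^sup>2)"
      using \<open>summable (\<lambda>m. (c m)\<^sup>2)\<close> by (subst suminf_mult) (auto simp: hyp_half_def c_def power_mult_distrib power_mult[symmetric] mult.commute)
    also have "(\<lambda>m. complex_of_real (2 * pi * (c m)\<^sup>2)) = (\<lambda>m. of_real (c m) * of_real (2 * pi * c m))"
      by (simp add: power2_eq_square mult_ac)
    finally show ?thesis .
  qed
  finally have "((\<lambda>t. complex_of_real (norm (1 - of_real k * cis t) powr (-1))) has_integral
      complex_of_real (2 * pi * hyp_half (k\<^sup>2))) {0..2*pi}" .
  from has_integral_linear[OF this bounded_linear_Re] show ?thesis by (simp only: o_def Re_complex_of_real)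
qed

lemma wallis_integral:
  "((\<lambda>t. (cos (t / 2))\<^sup>2 ^ n) has_integral 2 * pi * half_coeff n) {0..2*pi}"
proof (induction n)
  case 0
  thus ?case using has_integral_const_real[of "1::real" 0 "2 * pi"] by simp
next
  case (Suc n)
  define m where "m = 2 * n"
  have "((\<lambda>t. - (real m + 1) / 2 * (cos (t / 2))\<^sup>2 ^ n + (real m + 2) / 2 * (cos (t / 2))\<^sup>2 ^ Suc n) has_integral
     (cos (2*pi / 2) ^ (m + 1) * sin (2*pi / 2) - cos (0 / 2) ^ (m + 1) * sin (0 / 2))) {0..2*pi}"
  proof (rule fundamental_theorem_of_calculus)
    fix x :: real
    have s: "(sin (x / 2))\<^sup>2 = 1 - (cos (x / 2))\<^sup>2" by (simp add: sin_squared_eq)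
    have "((\<lambda>t. cos (t / 2) ^ (m + 1) * sin (t / 2)) has_real_derivative
        (real m + 1) * cos (x / 2) ^ m * (- sin (x / 2) / 2) * sin (x / 2) + cos (x / 2) ^ (m + 1) * (cos (x / 2) / 2))
        (at x within {0..2*pi})"
      by (auto intro!: derivative_eq_intros simp: algebra_simps simp del: power_Suc)
    also have "(real m + 1) * cos (x / 2) ^ m * (- sin (x / 2) / 2) * sin (x / 2) + cos (x / 2) ^ (m + 1) * (cos (x / 2) / 2)
      = (- (real m + 1) / 2) * cos (x / 2) ^ m * (sin (x / 2))\<^sup>2 + cos (x / 2) ^ m * (cos (x / 2))\<^sup>2 / 2"
      by (simp add: power2_eq_square field_simps)
    also have "\<dots> = - (real m + 1) / 2 * (cos (x / 2))\<^sup>2 ^ n + (real m + 2) / 2 * (cos (x / 2))\<^sup>2 ^ Suc n"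
    proof -
      have "cos (x / 2) ^ m = (cos (x / 2))\<^sup>2 ^ n" by (simp only: m_def power_mult)
      thus ?thesis unfolding s by (simp only: power_Suc) (simp add: field_simps)
    qed
    finally show "((\<lambda>t. cos (t / 2) ^ (m + 1) * sin (t / 2)) has_vector_derivative
        - (real m + 1) / 2 * (cos (x / 2))\<^sup>2 ^ n + (real m + 2) / 2 * (cos (x / 2))\<^sup>2 ^ Suc n) (at x within {0..2*pi})"
      by (simp add: has_real_derivative_iff_has_vector_derivative)
  qed simp
  hence "((\<lambda>t. - (real m + 1) / 2 * (cos (t / 2))\<^sup>2 ^ n + (real m + 2) / 2 * (cos (t / 2))\<^sup>2 ^ Suc n) has_integral 0) {0..2*pi}"
    by simp
  note * = has_integral_add[OF this has_integral_mult_right[OF Suc, of "(real m + 1) / 2"]]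
  have "((\<lambda>t. (real m + 2) / 2 * (cos (t / 2))\<^sup>2 ^ Suc n) has_integral (real m + 1) / 2 * (2 * pi * half_coeff n)) {0..2*pi}"
  proof -
    have "- (real m + 1) / 2 * X + (real m + 2) / 2 * Y + (real m + 1) / 2 * X = (real m + 2) / 2 * Y" for X Y
      by (simp add: field_simps)
    with * show ?thesis by (simp only: add_0_left)
  qed
  note * = has_integral_mult_right[OF this, of "2 / (real m + 2)"]
  have "((\<lambda>t. (cos (t / 2))\<^sup>2 ^ Suc n) has_integral 2 / (real m + 2) * ((real m + 1) / 2 * (2 * pi * half_coeff n))) {0..2*pi}"
  proof -
    have "2 / (real m + 2) * ((real m + 2) / 2 * Y) = Y" for Y by simp
    with * show ?thesis by (simp only:)
  qed
  also have "2 / (real m + 2) * ((real m + 1) / 2 * (2 * pi * half_coeff n)) = 2 * pi * half_coeff (Suc n)"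
    by (simp add: half_coeff_Suc m_def field_simps)
  finally show ?case .
qed

text \<open>
The complete elliptic integral of the first kind: the binomial series of the integrand is
integrated termwise with Wallis' formula.
\<close>
lemma hyp_half_elliptic:
  assumes m: "0 \<le> m" "m < 1"
  shows "((\<lambda>t. (1 - m * (cos (t / 2))\<^sup>2) powr (-1/2)) has_integral 2 * pi * hyp_half m) {0..2*pi}"
proof -
  have c1: "(cos (t / 2))\<^sup>2 \<le> 1" for t :: real using cos_squared_eq[of "t/2"] by simp
  have le: "norm (half_coeff n * m ^ n * (cos (t / 2))\<^sup>2 ^ n) \<le> half_coeff n * m ^ n" for n t
  proof -
    have "half_coeff n * m ^ n * (cos (t / 2))\<^sup>2 ^ n \<le> half_coeff n * m ^ n * 1"
      using m half_coeff_bounds(1)[of n] c1[of t] power_le_one[of "(cos (t / 2))\<^sup>2" n] by (intro mult_left_mono) auto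
    moreover have "0 \<le> half_coeff n * m ^ n * (cos (t / 2))\<^sup>2 ^ n"
      using m half_coeff_bounds(1)[of n] by (intro mult_nonneg_nonneg) auto
    ultimately show ?thesis by (simp only: real_norm_def abs_of_nonneg mult_1_right)
  qed
  have cont: "continuous_on {0..2*pi} (\<lambda>t. half_coeff n * m ^ n * (cos (t / 2))\<^sup>2 ^ n)" for n
    by (intro continuous_intros) simp
  have int: "((\<lambda>t. half_coeff n * m ^ n * (cos (t / 2))\<^sup>2 ^ n) has_integral half_coeff n * m ^ n * (2 * pi * half_coeff n)) {0..2*pi}" for n
    by (intro has_integral_mult_right wallis_integral)
  note s = has_integral_termwise(2)[OF cont le summable_half_coeff[OF m] int]
  note has_integral_termwise(1)[OF cont le summable_half_coeff[OF m] int]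
  also have "(\<lambda>t. \<Sum>n. half_coeff n * m ^ n * (cos (t / 2))\<^sup>2 ^ n) = (\<lambda>t. (1 - m * (cos (t / 2))\<^sup>2) powr (-1/2))"
  proof
    fix t :: real
    have "m * (cos (t / 2))\<^sup>2 \<le> m * 1" by (intro mult_left_mono c1 m)
    hence "\<bar>m * (cos (t / 2))\<^sup>2\<bar> < 1" using m by simp
    from half_binomial_series_real[OF this]
    show "(\<Sum>n. half_coeff n * m ^ n * (cos (t / 2))\<^sup>2 ^ n) = (1 - m * (cos (t / 2))\<^sup>2) powr (-1/2)"
      by (simp add: sums_iff power_mult_distrib mult_ac)
  qed
  also have "(\<Sum>n. half_coeff n * m ^ n * (2 * pi * half_coeff n)) = 2 * pi * hyp_half m"
  proof -
    have "(\<lambda>n. 2 * pi * ((half_coeff n)\<^sup>2 * m ^ n)) sums (\<Sum>n. half_coeff n * m ^ n * (2 * pi * half_coeff n))"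
      using s by (simp add: power2_eq_square mult_ac)
    hence "(\<lambda>n. 1 / (2 * pi) * (2 * pi * ((half_coeff n)\<^sup>2 * m ^ n))) sums (1 / (2 * pi) * (\<Sum>n. half_coeff n * m ^ n * (2 * pi * half_coeff n)))"
      by (intro sums_mult)
    hence "hyp_half m = 1 / (2 * pi) * (\<Sum>n. half_coeff n * m ^ n * (2 * pi * half_coeff n))"
      by (simp add: hyp_half_def sums_iff)
    thus ?thesis by simp
  qed
  finally show ?thesis .
qed

text \<open>
The integrands of the two preceding integral representations agree up to the factor \<open>1 + k\<close>, because
\<open>|1 - k e\<^bsup>it\<^esup>|\<^sup>2 = (1 + k)\<^sup>2 - 4k cos\<^sup>2(t/2)\<close>.
\<close>
theorem hyp_half_landen:
  assumes k: "0 \<le> k" "k < 1"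
  shows "hyp_half (4 * k / (1 + k)\<^sup>2) = (1 + k) * hyp_half (k\<^sup>2)"
proof -
  define m where "m = 4 * k / (1 + k)\<^sup>2"
  have "0 < (1 - k)\<^sup>2" using k by simp
  hence "4 * k < (1 + k)\<^sup>2" by (simp add: power2_eq_square algebra_simps)
  hence m: "0 \<le> m" "m < 1" using k by (simp_all add: m_def)
  have sq: "(x\<^sup>2) powr (-1/2) = x powr (-1)" if "x \<ge> 0" for x :: real
  proof (cases "x = 0")
    case False
    hence "x\<^sup>2 = x powr 2" using that by (simp add: powr_numeral)
    thus ?thesis by (simp only: powr_powr) simp
  qed simp
  have eq: "norm (1 - of_real k * cis t) powr (-1) = 1 / (1 + k) * (1 - m * (cos (t / 2))\<^sup>2) powr (-1/2)" for t
  proof -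
    have "(norm (1 - of_real k * cis t))\<^sup>2 = (1 - k * cos t)\<^sup>2 + (k * sin t)\<^sup>2"
      by (simp add: cmod_power2)
    also have "\<dots> = 1 - 2 * k * cos t + k\<^sup>2 * ((sin t)\<^sup>2 + (cos t)\<^sup>2)"
    proof -
      have "(1 - k * c)\<^sup>2 + (k * s)\<^sup>2 = 1 - 2 * k * c + k\<^sup>2 * (s\<^sup>2 + c\<^sup>2)" for c s :: real
        by (simp add: power2_eq_square algebra_simps)
      thus ?thesis .
    qed
    also have "\<dots> = 1 - 2 * k * cos (2 * (t / 2)) + k\<^sup>2" by simp
    also have "\<dots> = (1 + k)\<^sup>2 - 4 * k * (cos (t / 2))\<^sup>2"
      unfolding cos_double_cos by (simp add: power2_eq_square algebra_simps)
    also have "\<dots> = (1 + k)\<^sup>2 * (1 - m * (cos (t / 2))\<^sup>2)"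
    proof -
      have "(1 + k)\<^sup>2 * m = 4 * k" using k by (simp add: m_def)
      thus ?thesis by (simp only: right_diff_distrib mult.assoc[symmetric] mult_1_right)
    qed
    finally have e: "(norm (1 - of_real k * cis t))\<^sup>2 = (1 + k)\<^sup>2 * (1 - m * (cos (t / 2))\<^sup>2)" .
    have pos: "0 \<le> 1 - m * (cos (t / 2))\<^sup>2"
    proof -
      have "(cos (t / 2))\<^sup>2 \<le> 1" by (simp add: abs_square_le_1)
      hence "m * (cos (t / 2))\<^sup>2 \<le> 1 * 1" by (rule mult_mono[rotated]) (use m in \<open>simp_all add: less_imp_le\<close>)
      thus ?thesis by simp
    qed
    have "norm (1 - of_real k * cis t) powr (-1) = ((norm (1 - of_real k * cis t))\<^sup>2) powr (-1/2)"
      by (rule sq[symmetric]) simp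
    also have "\<dots> = ((1 + k)\<^sup>2) powr (-1/2) * (1 - m * (cos (t / 2))\<^sup>2) powr (-1/2)"
      unfolding e using pos by (intro powr_mult)
    also have "((1 + k)\<^sup>2) powr (-1/2) = (1 + k) powr (-1)"
      using k by (intro sq) simp
    also have "(1 + k) powr (-1) = 1 / (1 + k)" using k by (simp add: powr_neg_one)
    finally show ?thesis .
  qed
  have "2 * pi * hyp_half (k\<^sup>2) = 1 / (1 + k) * (2 * pi * hyp_half m)"
    using hyp_half_parseval[OF k] has_integral_mult_right[OF hyp_half_elliptic[OF m], of "1 / (1 + k)"]
    unfolding eq by (rule has_integral_unique)
  hence "2 * pi * hyp_half (k\<^sup>2) = 2 * pi * (hyp_half m / (1 + k))" by simp
  hence "hyp_half (k\<^sup>2) = hyp_half m / (1 + k)" by (simp only: mult_cancel_left) simp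
  hence "(1 + k) * hyp_half (k\<^sup>2) = hyp_half m" using k by simp
  thus ?thesis unfolding m_def by (rule sym)
qed

text \<open>
By Landen's transformation both sides change by the same factor \<open>1 + k\<close> under \<open>q \<mapsto> q\<^sup>2\<close>.
\<close>
theorem hyp_half_modular_lambda:
  assumes q: "0 < q" "q < 1"
  shows "hyp_half (modular_lambda q) = (theta_phi q)\<^sup>2"
proof -
  define R where "R = (\<lambda>q. hyp_half (modular_lambda q) / (theta_phi q)\<^sup>2)"
  have "R q = R 0"
  proof (rule square_invariant_const[OF _ _ q])
    fix q :: real assume q: "0 < q" "q < 1"
    define k where "k = landen_k q"
    have k: "0 < k" "k < 1" using modular_lambda_landen(10,11)[of q] q by (auto simp: k_def)
    have "hyp_half (modular_lambda q) = (1 + k) * hyp_half (modular_lambda (q\<^sup>2))"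
      using modular_lambda_landen(4,5)[of q] q hyp_half_landen[of k] k by (simp add: k_def)
    moreover have "(theta_phi q)\<^sup>2 = (theta_phi (q\<^sup>2))\<^sup>2 * (1 + k)"
      using modular_lambda_landen(1)[of q] q by (simp add: k_def)
    ultimately show "R q = R (q\<^sup>2)" using k by (simp add: R_def)
  next
    obtain d1 where d1: "\<And>q::real. norm q < 1 \<Longrightarrow> (theta_phi has_real_derivative d1 q) (at q)"
      "\<And>q. norm q < 1 \<Longrightarrow> isCont d1 q" using theta_phi_deriv by blast
    have "isCont theta_phi (0::real)" using d1(1)[of 0, THEN DERIV_isCont] by simp
    moreover have "isCont hyp_half (modular_lambda 0)"
    proof -
      have "summable (\<lambda>n. (half_coeff n)\<^sup>2 * (1/2) ^ n)"
      proof (rule summable_comparison_test')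
        show "summable (\<lambda>n. (1/2::real) ^ n)" by (simp add: summable_geometric)
        show "norm ((half_coeff n)\<^sup>2 * (1/2) ^ n) \<le> (1/2) ^ n" for n
          using half_coeff_bounds[of n] by (simp add: power_le_one mult_left_le_one_le)
      qed
      from isCont_powser[OF this, of "modular_lambda 0"] show ?thesis
        by (simp add: hyp_half_def[abs_def] modular_lambda_def)
    qed
    hence "isCont (\<lambda>q. hyp_half (modular_lambda q)) 0"
      by (intro isCont_o2[OF modular_lambda_isCont_0])
    ultimately show "isCont R 0" unfolding R_def
      by (intro isCont_divide isCont_power) (auto simp: theta_0)
  qed
  also have "R 0 = 1" by (simp add: R_def theta_0 hyp_half_def modular_lambda_def)
  finally show ?thesis using theta_ge_1(1)[of q] q by (simp add: R_def)
qed

section \<open>The hypergeometric value as a beta integral\<close>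

lemma absolutely_integrable_termwise:
  fixes f :: "nat \<Rightarrow> real \<Rightarrow> 'b::euclidean_space"
  assumes f: "\<And>n. f n absolutely_integrable_on S"
    and summ: "\<And>x. x \<in> S \<Longrightarrow> summable (\<lambda>n. norm (f n x))"
    and sumi: "summable (\<lambda>n. integral S (\<lambda>x. norm (f n x)))"
  shows "(\<lambda>x. \<Sum>n. f n x) absolutely_integrable_on S"
    and "(\<lambda>n. integral S (f n)) sums integral S (\<lambda>x. \<Sum>n. f n x)"
proof -
  define g where "g = (\<lambda>n x. indicat_real S x *\<^sub>R f n x)"
  have g: "integrable lebesgue (g n)" for n
    using f[of n] by (simp add: g_def set_integrable_def)
  have "summable (\<lambda>n. norm (g n x))" for x
    using summ[of x] by (cases "x \<in> S") (auto simp: g_def)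
  hence ae: "AE x in lebesgue. summable (\<lambda>n. norm (g n x))" by simp
  have gi: "integral\<^sup>L lebesgue (g n) = integral S (f n)" for n
    using set_lebesgue_integral_eq_integral(2)[OF f[of n]] by (simp add: g_def set_lebesgue_integral_def)
  have "(\<lambda>x. norm (g n x)) = (\<lambda>x. indicat_real S x *\<^sub>R norm (f n x))" for n
    by (auto simp: g_def indicator_def)
  hence "integral\<^sup>L lebesgue (\<lambda>x. norm (g n x)) = integral S (\<lambda>x. norm (f n x))" for n
    using set_lebesgue_integral_eq_integral(2)[OF absolutely_integrable_norm[OF f[of n]]]
    by (simp add: set_lebesgue_integral_def o_def)
  hence sg: "summable (\<lambda>n. integral\<^sup>L lebesgue (\<lambda>x. norm (g n x)))" using sumi by simp
  have e: "(\<lambda>x. \<Sum>n. g n x) = (\<lambda>x. indicat_real S x *\<^sub>R (\<Sum>n. f n x))"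
    by (auto simp: g_def indicator_def)
  show ai: "(\<lambda>x. \<Sum>n. f n x) absolutely_integrable_on S"
    using integrable_suminf[OF g ae sg] by (simp add: set_integrable_def e)
  show "(\<lambda>n. integral S (f n)) sums integral S (\<lambda>x. \<Sum>n. f n x)"
    using sums_integral[OF g ae sg] set_lebesgue_integral_eq_integral(2)[OF ai]
    by (simp add: gi e set_lebesgue_integral_def)
qed

lemma Beta_pochhammer_shift:
  fixes a b :: real
  assumes "a > 0" "b > 0"
  shows "Beta (a + of_nat n) b = Beta a b * pochhammer a n / pochhammer (a + b) n"
proof -
  have "a \<notin> \<int>\<^sub>\<le>\<^sub>0" "a + b \<notin> \<int>\<^sub>\<le>\<^sub>0" using assms by (auto elim!: nonpos_Ints_cases)
  moreover have "Gamma a > 0" "Gamma (a + b) > 0" "Gamma (a + b + n) > 0"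
    using assms by (auto intro!: Gamma_real_pos)
  ultimately show ?thesis
    by (simp add: pochhammer_Gamma Beta_def field_simps)
qed

lemma hypergeo_term:
  fixes r s :: real
  shows "fps_nth (fps_hypergeo [1/2, 1/2, r] [1, s] 1) n = (half_coeff n)\<^sup>2 * (pochhammer r n / pochhammer s n)"
  by (simp add: half_coeff_def power2_eq_square pochhammer_fact[symmetric])

text \<open>
The ratio of consecutive terms is \<open>1 - (1 + s - r)/n + O(1/n\<^sup>2)\<close>, so Raabe's test applies at the
boundary of the disc of convergence.
\<close>
lemma hypergeo_summable:
  fixes r s :: real
  assumes rs: "0 < r" "r < s"
  shows "summable (\<lambda>n. (half_coeff n)\<^sup>2 * (pochhammer r n / pochhammer s n))"
proof (rule raabes_test_convergence)
  define f where "f = (\<lambda>n. (half_coeff n)\<^sup>2 * (pochhammer r n / pochhammer s n))"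
  have pos: "f n > 0" for n
    using half_coeff_bounds(1)[of n] rs by (auto simp: f_def intro!: mult_pos_pos divide_pos_pos pochhammer_pos)
  thus "\<forall>\<^sub>F n in sequentially. f n > 0" by simp
  have step: "f (Suc n) = f n * (((2 * real n + 1) / (2 * real n + 2))\<^sup>2 * ((r + real n) / (s + real n)))" for n
    by (simp add: f_def half_coeff_Suc pochhammer_Suc power_mult_distrib power_divide) (simp add: mult_ac)
  have ratio: "f n / f (Suc n) = ((2 * real n + 2) / (2 * real n + 1))\<^sup>2 * ((s + real n) / (r + real n))" for n
    unfolding step using pos[of n] rs by (simp add: power_divide)
  have "(\<lambda>n. real n * (((2 * real n + 2) / (2 * real n + 1))\<^sup>2 * ((s + real n) / (r + real n)) - 1)) \<longlonglongrightarrow> 1 + s - r"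
    by real_asymp
  hence "(\<lambda>n. ereal (real n * (f n / f (Suc n) - 1))) \<longlonglongrightarrow> ereal (1 + s - r)"
    unfolding ratio by (rule tendsto_ereal)
  hence "liminf (\<lambda>n. ereal (real n * (f n / f (Suc n) - 1))) = ereal (1 + s - r)"
    by (intro lim_imp_Liminf) auto
  thus "1 < liminf (\<lambda>n. ereal (real n * (f n / f (Suc n) - 1)))" using rs by simp
qed

text \<open>
Termwise integration of the series of \<open>hyp_half\<close>; the \<open>n\<close>-th term contributes
\<open>B(r + n, s - r) = B(r, s - r) (r)\<^sub>n / (s)\<^sub>n\<close>. All terms are positive, so convergence of the resulting
series justifies the interchange.
\<close>
theorem hypergeo_beta_integral:
  fixes r s :: real
  assumes rs: "0 < r" "r < s"
  defines "h \<equiv> (\<lambda>t. t powr (r - 1) * (1 - t) powr (s - r - 1) * hyp_half t)"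
  shows "h absolutely_integrable_on {0<..<1}"
    and "integral {0<..<1} h = Beta r (s - r) * eval_fps (fps_hypergeo [1/2, 1/2, r] [1, s] 1) 1"
proof -
  define f where "f = (\<lambda>n t. (half_coeff n)\<^sup>2 * (t powr (r + real n - 1) * (1 - t) powr (s - r - 1)))"
  have B: "((\<lambda>t. t powr (r + real n - 1) * (1 - t) powr (s - r - 1)) has_integral Beta (r + real n) (s - r)) {0<..<1}" for n
    using has_integral_Beta_real[of "r + real n" "s - r"] rs by (simp add: has_integral_Icc_iff_Ioo)
  have fi: "(f n has_integral (half_coeff n)\<^sup>2 * Beta (r + real n) (s - r)) {0<..<1}" for n
    unfolding f_def by (intro has_integral_mult_right B)
  have f0: "f n t \<ge> 0" if "t \<in> {0<..<1}" for n t
    using that by (auto simp: f_def intro!: mult_nonneg_nonneg)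
  have fa: "f n absolutely_integrable_on {0<..<1}" for n
    using fi[of n] f0 by (subst absolutely_integrable_on_iff_nonneg) (auto simp: integrable_on_def)
  have b: "(half_coeff n)\<^sup>2 * Beta (r + real n) (s - r) = Beta r (s - r) * ((half_coeff n)\<^sup>2 * (pochhammer r n / pochhammer s n))" for n
    using Beta_pochhammer_shift[of r "s - r" n] rs by simp
  have sm: "summable (\<lambda>n. (half_coeff n)\<^sup>2 * (pochhammer r n / pochhammer s n))"
    by (rule hypergeo_summable[OF rs])
  have fn: "integral {0<..<1} (f n) = (half_coeff n)\<^sup>2 * Beta (r + real n) (s - r)" for n
    using fi by (rule integral_unique)
  have "integral {0<..<1} (\<lambda>t. norm (f n t)) = integral {0<..<1} (f n)" for n
    using f0 by (intro integral_cong) auto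
  hence sumi: "summable (\<lambda>n. integral {0<..<1} (\<lambda>t. norm (f n t)))"
    using summable_mult[OF sm, of "Beta r (s - r)"] by (simp only: fn b)
  have f_eq: "f n t = t powr (r - 1) * (1 - t) powr (s - r - 1) * ((half_coeff n)\<^sup>2 * t ^ n)" if "t \<in> {0<..<1}" for n t
  proof -
    have "t powr (r + real n - 1) = t powr (r - 1) * t ^ n"
      using that by (simp add: powr_realpow[symmetric] powr_add[symmetric] algebra_simps)
    thus ?thesis by (simp add: f_def)
  qed
  have Gs: "summable (\<lambda>n. (half_coeff n)\<^sup>2 * t ^ n)" if "t \<in> {0<..<1}" for t
  proof (rule summable_comparison_test')
    show "summable (\<lambda>n. t ^ n)" using that by (simp add: summable_geometric)
    show "norm ((half_coeff n)\<^sup>2 * t ^ n) \<le> t ^ n" for n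
      using half_coeff_bounds[of n] that by (simp add: abs_mult power_le_one mult_left_le_one_le)
  qed
  have summ: "summable (\<lambda>n. norm (f n t))" if "t \<in> {0<..<1}" for t
  proof -
    have "(\<lambda>n. norm (f n t)) = (\<lambda>n. t powr (r - 1) * (1 - t) powr (s - r - 1) * ((half_coeff n)\<^sup>2 * t ^ n))"
      using f0[OF that] f_eq[OF that] by auto
    thus ?thesis by (simp only:) (rule summable_mult[OF Gs[OF that]])
  qed
  have h: "(\<Sum>n. f n t) = h t" if "t \<in> {0<..<1}" for t
    using suminf_mult[OF Gs[OF that], of "t powr (r - 1) * (1 - t) powr (s - r - 1)"]
    by (simp add: f_eq[OF that] h_def hyp_half_def)
  note T = absolutely_integrable_termwise[OF fa summ sumi]
  show "h absolutely_integrable_on {0<..<1}"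
    using T(1) by (rule absolutely_integrable_spike[OF _ negligible_empty]) (use h in auto)
  have "integral {0<..<1} h = integral {0<..<1} (\<lambda>t. \<Sum>n. f n t)"
    by (intro integral_cong) (use h in auto)
  also have "\<dots> = (\<Sum>n. Beta r (s - r) * ((half_coeff n)\<^sup>2 * (pochhammer r n / pochhammer s n)))"
    using T(2) by (simp add: sums_iff fn b)
  also have "\<dots> = Beta r (s - r) * eval_fps (fps_hypergeo [1/2, 1/2, r] [1, s] 1) 1"
    unfolding eval_fps_def hypergeo_term using suminf_mult[OF sm] by simp
  finally show "integral {0<..<1} h = Beta r (s - r) * eval_fps (fps_hypergeo [1/2, 1/2, r] [1, s] 1) 1" .
qed

section \<open>The eta quotients in terms of theta functions\<close>

text \<open>
A common logarithm \<open>L\<close> of the Euler product serves for all exponents at once, and it is real on the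
imaginary axis. Products of powers of eta thereby become linear combinations of exponents.
\<close>
lemma eta_pow_exp:
  assumes "\<tau> \<in> uhp"
  obtains L where "euler_prod (exp (2 * pi * \<i> * \<tau>)) = exp L"
    "\<And>x. eta_pow \<tau> x = exp (2 * of_real pi * \<i> * \<tau> * of_real x / 24 + of_real x * L)"
    "Re \<tau> = 0 \<Longrightarrow> L \<in> \<real>"
proof -
  define q where "q = exp (2 * pi * \<i> * \<tau>)"
  have q: "norm q < 1" using assms by (simp add: q_def uhp_def)
  define g where "g = (\<lambda>n::nat. 1 - q ^ Suc n)"
  have g_q: "1 - exp (2 * of_real pi * \<i> * of_nat (Suc n) * \<tau>) = g n" for n
    unfolding g_def q_def exp_of_nat_mult[symmetric] by (simp add: mult_ac)
  have nz: "g n \<noteq> 0" for n using one_minus_power_nz[OF q, of "Suc n"] by (simp add: g_def del: power_Suc)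
  have "convergent_prod g" unfolding g_def using q by (intro convergent_prod_one_minus_power) auto
  hence s: "summable (\<lambda>n. Ln (g n))" using convergent_prod_iff_summable_complex nz by blast
  define L where "L = (\<Sum>n. Ln (g n))"
  show thesis
  proof (rule that[of L])
    have "prodinf (\<lambda>n. exp (Ln (g n))) = exp L" unfolding L_def by (rule prodinf_exp[OF s])
    thus "euler_prod (exp (2 * pi * \<i> * \<tau>)) = exp L"
      using nz by (simp add: euler_prod_def g_def q_def)
    show "eta_pow \<tau> x = exp (2 * of_real pi * \<i> * \<tau> * of_real x / 24 + of_real x * L)" for x
    proof -
      have "prodinf (\<lambda>n. exp (of_real x * Ln (g n))) = exp (\<Sum>n. of_real x * Ln (g n))"
        by (rule prodinf_exp[OF summable_mult[OF s]])
      also have "(\<Sum>n. of_real x * Ln (g n)) = of_real x * L" unfolding L_def by (rule suminf_mult[OF s])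
      also have "(\<lambda>n. exp (of_real x * Ln (g n))) = (\<lambda>n. g n powr of_real x)" using nz by (simp add: powr_def)
      finally show ?thesis unfolding eta_pow_def g_q exp_add by simp
    qed
    show "L \<in> \<real>" if "Re \<tau> = 0"
    proof -
      have "\<tau> = \<i> * of_real (Im \<tau>)" using that by (simp add: complex_eq_iff)
      hence "2 * pi * \<i> * \<tau> = of_real (- 2 * pi * Im \<tau>)" by (simp add: complex_eq_iff)
      hence qr: "q = of_real (exp (- 2 * pi * Im \<tau>))" unfolding q_def by (simp only: exp_of_real)
      have "Ln (g n) \<in> \<real>" for n
      proof -
        define x where "x = 1 - exp (- 2 * pi * Im \<tau>) ^ Suc n"
        have "g n = of_real x" by (simp add: g_def qr x_def del: power_Suc)
        moreover have "x > 0" unfolding x_def using assms 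
          by (simp add: uhp_def power_less_one_iff del: power_Suc)
        ultimately show ?thesis by (simp add: Ln_of_real)
      qed
      hence "(\<lambda>n. Ln (g n)) = (\<lambda>n. of_real (Re (Ln (g n))))" by auto
      moreover have "(\<lambda>n. Re (Ln (g n))) sums Re L" using s by (simp add: L_def sums_Re summable_sums)
      ultimately have "(\<lambda>n. Ln (g n)) sums of_real (Re L)" using sums_of_real by metis
      hence "L = of_real (Re L)" using s by (simp add: L_def sums_iff)
      thus ?thesis by (metis Reals_of_real)
    qed
  qed
qed

text \<open>
The absolute value of \<open>16\<^bsup>-r\<^esup> \<lambda>\<^bsup>r\<^esup> (1 - \<lambda>)\<^bsup>s-r\<^esup> \<theta>\<^sub>3\<^sup>6\<close>, with \<open>\<lambda>\<close> and \<open>1 - \<lambda>\<close> written as quotients of theta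
functions. On the imaginary axis \<open>K\<^sub>2\<close> is positive, so its absolute value determines it.
\<close>
lemma K2_norm:
  assumes tau: "\<tau> \<in> uhp"
  defines "q \<equiv> exp (pi * \<i> * \<tau>)"
  shows "norm (K2 r s \<tau>) = norm q powr of_rat r * norm (theta_psi (q\<^sup>2)) powr (4 * of_rat r) *
      norm (theta_phi (-q)) powr (4 * (of_rat s - of_rat r)) * norm (theta_phi q) powr (6 - 4 * of_rat s)"
    and "Re \<tau> = 0 \<Longrightarrow> K2 r s \<tau> = of_real (norm (K2 r s \<tau>))"
proof -
  define R S :: real where "R = of_rat r" and "S = of_rat s"
  define y where "y = Im \<tau>"
  have y: "y > 0" using tau by (simp add: uhp_def y_def)
  have nq: "norm q = exp (- pi * y)" by (simp add: q_def y_def)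
  have q: "norm q < 1" using y by (simp add: nq)
  have q2: "norm (q\<^sup>2) < 1" and q4: "norm (q ^ 4) < 1" using q by (simp_all add: norm_power_less_1)
  have u: "\<tau> / 2 \<in> uhp" "2 * \<tau> \<in> uhp" using tau by (simp_all add: uhp_def)
  obtain L1 where L1: "euler_prod (exp (2 * pi * \<i> * (\<tau> / 2))) = exp L1"
    "\<And>x. eta_pow (\<tau> / 2) x = exp (2 * of_real pi * \<i> * (\<tau> / 2) * of_real x / 24 + of_real x * L1)"
    "Re (\<tau> / 2) = 0 \<Longrightarrow> L1 \<in> \<real>" using eta_pow_exp[OF u(1)] by blast
  obtain L2 where L2: "euler_prod (exp (2 * pi * \<i> * \<tau>)) = exp L2"
    "\<And>x. eta_pow \<tau> x = exp (2 * of_real pi * \<i> * \<tau> * of_real x / 24 + of_real x * L2)"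
    "Re \<tau> = 0 \<Longrightarrow> L2 \<in> \<real>" using eta_pow_exp[OF tau] by blast
  obtain L4 where L4: "euler_prod (exp (2 * pi * \<i> * (2 * \<tau>))) = exp L4"
    "\<And>x. eta_pow (2 * \<tau>) x = exp (2 * of_real pi * \<i> * (2 * \<tau>) * of_real x / 24 + of_real x * L4)"
    "Re (2 * \<tau>) = 0 \<Longrightarrow> L4 \<in> \<real>" using eta_pow_exp[OF u(2)] by blast
  have qe: "exp (2 * pi * \<i> * (\<tau> / 2)) = q" "exp (2 * pi * \<i> * \<tau>) = q\<^sup>2" "exp (2 * pi * \<i> * (2 * \<tau>)) = q ^ 4"
    unfolding q_def exp_of_nat_mult[symmetric] by (simp_all add: mult_ac)
  have e: "euler_prod q = exp L1" "euler_prod (q\<^sup>2) = exp L2" "euler_prod (q ^ 4) = exp L4"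
    using L1(1) L2(1) L4(1) unfolding qe .
  have o1: "odd_prod q = exp (L1 - L2)"
    using euler_prod_split[OF q] by (simp add: e exp_diff)
  have o2: "odd_prod (q\<^sup>2) = exp (L2 - L4)"
    using euler_prod_split[OF q2] by (simp add: e exp_diff power_mult[symmetric])
  have psi: "theta_psi (q\<^sup>2) = exp (L4 - (L2 - L4))"
  proof -
    have "(q\<^sup>2)\<^sup>2 = q ^ 4" by (simp add: power_mult[symmetric])
    thus ?thesis using theta_products(1)[OF q2] by (simp only: e o2 exp_diff)
  qed
  have phi: "theta_phi q = exp (L2 + 2 * (L2 - L4) - 2 * (L1 - L2))"
  proof -
    have "exp (u + 2 * a - 2 * b) = exp u * (exp a)\<^sup>2 / (exp b)\<^sup>2" for u a b :: complex
      by (simp add: exp_add exp_diff exp_double)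
    thus ?thesis using theta_products(2)[OF q] by (simp only: e o1 o2)
  qed
  have phim: "theta_phi (-q) = exp (L2 + 2 * (L1 - L2))"
  proof -
    have "exp (u + 2 * a) = exp u * (exp a)\<^sup>2" for u a :: complex
      by (simp add: exp_add exp_double)
    thus ?thesis using theta_products(3)[OF q] by (simp only: e o1)
  qed
  define A where "A = 
     (2 * of_real pi * \<i> * (\<tau> / 2) * of_real (16 * S - 8 * R - 12) / 24 + of_real (16 * S - 8 * R - 12) * L1) +
     (2 * of_real pi * \<i> * (2 * \<tau>) * of_real (8 * R + 8 * S - 12) / 24 + of_real (8 * R + 8 * S - 12) * L4) -
     (2 * of_real pi * \<i> * \<tau> * of_real (24 * S - 30) / 24 + of_real (24 * S - 30) * L2)"
  have K: "K2 r s \<tau> = exp A"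
    unfolding K2_def L1(2) L2(2) L4(2) A_def exp_add exp_diff
    by (simp add: R_def S_def of_rat_add of_rat_diff of_rat_mult)
  have "norm (K2 r s \<tau>) = exp (Re A)" by (simp add: K)
  also have "Re A = - pi * y * R + 4 * R * Re (L4 - (L2 - L4)) + 4 * (S - R) * Re (L2 + 2 * (L1 - L2)) +
       (6 - 4 * S) * Re (L2 + 2 * (L2 - L4) - 2 * (L1 - L2))"
    unfolding A_def y_def by (simp add: algebra_simps add_divide_distrib diff_divide_distrib)
  also have "exp \<dots> = norm q powr R * norm (theta_psi (q\<^sup>2)) powr (4 * R) *
      norm (theta_phi (-q)) powr (4 * (S - R)) * norm (theta_phi q) powr (6 - 4 * S)"
    unfolding psi phi phim nq norm_exp_eq_Re exp_powr_real exp_add[symmetric] by (simp only: mult_ac)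
  finally show "norm (K2 r s \<tau>) = norm q powr of_rat r * norm (theta_psi (q\<^sup>2)) powr (4 * of_rat r) *
      norm (theta_phi (-q)) powr (4 * (of_rat s - of_rat r)) * norm (theta_phi q) powr (6 - 4 * of_rat s)"
    by (simp add: R_def S_def)
  show "K2 r s \<tau> = of_real (norm (K2 r s \<tau>))" if re: "Re \<tau> = 0"
  proof -
    have "\<i> * \<tau> = of_real (- y)" using re by (simp add: complex_eq_iff y_def)
    hence it: "\<i> * \<tau> \<in> \<real>" by simp
    have "A = of_real (2 * pi / 2 * (16 * S - 8 * R - 12) / 24) * (\<i> * \<tau>) + of_real (16 * S - 8 * R - 12) * L1 +
      (of_real (2 * pi * 2 * (8 * R + 8 * S - 12) / 24) * (\<i> * \<tau>) + of_real (8 * R + 8 * S - 12) * L4) -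
      (of_real (2 * pi * (24 * S - 30) / 24) * (\<i> * \<tau>) + of_real (24 * S - 30) * L2)"
      unfolding A_def by (simp add: mult_ac)
    moreover have "L1 \<in> \<real>" "L2 \<in> \<real>" "L4 \<in> \<real>" using L1(3) L2(3) L4(3) re by auto
    ultimately have "A \<in> \<real>" using it by (auto intro!: Reals_add Reals_diff Reals_mult Reals_of_real)
    hence "A = of_real (Re A)" by (simp add: complex_is_Real_iff complex_eq_iff)
    hence "exp A = of_real (exp (Re A))" by (metis exp_of_real)
    thus ?thesis unfolding K norm_exp_eq_Re .
  qed
qed

lemma theta_norm_bounds:
  fixes q :: complex
  assumes q: "norm q < 1"
  shows "norm (theta_phi q) \<le> 2 / (1 - norm q)" "norm (theta_psi q) \<le> 1 / (1 - norm q)"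
proof -
  have g: "(\<Sum>n. norm q ^ n) = 1 / (1 - norm q)" "summable (\<lambda>n. norm q ^ n)"
    using q by (simp_all add: suminf_geometric summable_geometric)
  have le: "norm (\<Sum>n. q ^ e n) \<le> (\<Sum>n. norm q ^ e n)" "(\<Sum>n. norm q ^ e n) \<le> 1 / (1 - norm q)" if "\<And>n. e n \<ge> n" for e
  proof -
    have s: "summable (\<lambda>n. norm q ^ e n)" using summable_power_comp[OF q that] by (simp add: norm_power)
    show "norm (\<Sum>n. q ^ e n) \<le> (\<Sum>n. norm q ^ e n)"
      using summable_norm[of "\<lambda>n. q ^ e n"] s by (simp add: norm_power)
    show "(\<Sum>n. norm q ^ e n) \<le> 1 / (1 - norm q)"
      unfolding g(1)[symmetric] using that q by (intro suminf_le s g(2) power_decreasing) auto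
  qed
  show "norm (theta_psi q) \<le> 1 / (1 - norm q)"
    using le[of "\<lambda>n. n * (n + 1) div 2"] triangle_ge unfolding theta_psi_def by force
  have s: "summable (\<lambda>n. q ^ n\<^sup>2)" by (rule summable_norm_cancel[OF theta_phi_summable[OF q]])
  have "theta_phi q = 1 + 2 * (\<Sum>n. q ^ (Suc n)\<^sup>2)"
    using suminf_split_head[OF s] by (simp add: theta_phi_def)
  hence "norm (theta_phi q) \<le> 1 + 2 * norm (\<Sum>n. q ^ (Suc n)\<^sup>2)"
    using norm_triangle_ineq[of 1 "2 * (\<Sum>n. q ^ (Suc n)\<^sup>2)"] by (simp add: norm_mult)
  also have "norm (\<Sum>n. q ^ (Suc n)\<^sup>2) \<le> (\<Sum>n. norm q ^ (Suc n)\<^sup>2)"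
    by (rule le(1)) (simp add: power2_eq_square)
  also have "(\<Sum>n. norm q ^ (Suc n)\<^sup>2) \<le> (\<Sum>n. norm q ^ Suc n)"
    using q by (intro suminf_le power_decreasing)
       (auto simp: power2_eq_square summable_geometric simp del: power_Suc intro: summable_ignore_initial_segment[of _ 1, simplified] 
         summable_power_comp[of "norm q" "\<lambda>n. (Suc n)\<^sup>2", simplified])
  also have "\<dots> = 1 / (1 - norm q) - 1"
    using suminf_split_head[OF g(2)] g(1) by simp
  also have "1 + 2 * (1 / (1 - norm q) - 1) \<le> 2 / (1 - norm q)" by simp
  finally show "norm (theta_phi q) \<le> 2 / (1 - norm q)" by simp
qed

text \<open>
On \<open>S\<^sub>2'\<close> all theta exponents in the formula for \<open>K\<^sub>2\<close> are nonnegative and add up to 6, and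
each theta series is at most \<open>2 / (1 - |q|)\<close>.
\<close>
lemma K2_growth:
  assumes tau: "\<tau> \<in> uhp" and rs: "0 < r" "r < s" "s < 3/2"
  shows "norm (K2 r s \<tau>) \<le> (2 * (1 + pi * Im \<tau>) / (pi * Im \<tau>)) ^ 6"
proof -
  define R S :: real where "R = of_rat r" and "S = of_rat s"
  have "of_rat s < (of_rat (3/2) :: real)" using rs(3) by (simp only: of_rat_less)
  hence RS: "0 < R" "R < S" "S < 3/2" using rs by (simp_all add: R_def S_def of_rat_less of_rat_divide)
  define q where "q = exp (pi * \<i> * \<tau>)"
  define z where "z = pi * Im \<tau>"
  have z: "z > 0" using tau by (simp add: z_def uhp_def)
  have nq: "norm q = exp (-z)" by (simp add: q_def z_def)
  hence q: "norm q < 1" using z by simp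
  define M where "M = 2 / (1 - norm q)"
  have "1 + z \<le> exp z" by (rule exp_ge_add_one_self)
  hence "exp (-z) \<le> 1 / (1 + z)" using z by (simp add: exp_minus field_simps)
  hence "1 - norm q \<ge> z / (1 + z)" using z unfolding nq by (simp add: field_simps)
  hence "M \<le> 2 / (z / (1 + z))" unfolding M_def using z q by (intro divide_left_mono) auto
  hence Mz: "M \<le> 2 * (1 + z) / z" by simp
  have M1: "M > 0" using q by (simp add: M_def)
  have "norm q ^ 2 \<le> norm q" using q by (simp add: power2_eq_square mult_left_le)
  hence "1 / (1 - norm (q\<^sup>2)) \<le> 1 / (1 - norm q)" using q norm_power_less_1[OF q, of 2]
    by (intro divide_left_mono) (auto simp: norm_power)
  also have "\<dots> \<le> M" unfolding M_def using q by (intro divide_right_mono) auto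
  finally have psi: "norm (theta_psi (q\<^sup>2)) \<le> M"
    using theta_norm_bounds(2)[of "q\<^sup>2"] norm_power_less_1[OF q, of 2] by simp
  have phi: "norm (theta_phi q) \<le> M" "norm (theta_phi (-q)) \<le> M"
    using theta_norm_bounds(1)[of q] theta_norm_bounds(1)[of "-q"] q by (auto simp: M_def)
  have "norm (K2 r s \<tau>) = norm q powr R * norm (theta_psi (q\<^sup>2)) powr (4 * R) *
      norm (theta_phi (-q)) powr (4 * (S - R)) * norm (theta_phi q) powr (6 - 4 * S)"
    unfolding R_def S_def q_def by (rule K2_norm(1)[OF tau])
  also have "\<dots> \<le> 1 * M powr (4 * R) * M powr (4 * (S - R)) * M powr (6 - 4 * S)"
    using RS q by (intro mult_mono powr_mono2 psi phi mult_nonneg_nonneg) (auto simp: powr_le1)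
  also have "\<dots> = M powr 6" by (simp add: powr_add[symmetric])
  also have "\<dots> = M ^ 6" using M1 by (simp add: powr_numeral)
  also have "\<dots> \<le> (2 * (1 + z) / z) ^ 6" using M1 Mz by (intro power_mono) auto
  finally show ?thesis by (simp add: z_def)
qed

text \<open>
The substitution \<open>t = \<lambda>(e\<^bsup>-\<pi>y\<^esup>)\<close> in Euler's integral.
\<close>
theorem K2_imaginary_axis_integral:
  assumes rs: "0 < r" "r < s"
  shows "(\<lambda>y. norm (K2 r s (\<i> * of_real y))) absolutely_integrable_on {0<..}"
    and "integral {0<..} (\<lambda>y. norm (K2 r s (\<i> * of_real y))) =
      16 powr (- of_rat r) / pi * (Beta (of_rat r) (of_rat (s - r)) * eval_fps (fps_hypergeo [1/2, 1/2, of_rat r] [1, of_rat s] 1) 1)"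
proof -
  define R S :: real where "R = of_rat r" and "S = of_rat s"
  have RS: "0 < R" "R < S" using rs by (simp_all add: R_def S_def of_rat_less)
  define h where "h = (\<lambda>t. t powr (R - 1) * (1 - t) powr (S - R - 1) * hyp_half t)"
  define q where "q = (\<lambda>y::real. exp (- pi * y))"
  define g where "g = (\<lambda>y. modular_lambda (q y))"
  define g' where "g' = (\<lambda>y. modular_lambda (q y) * theta_phi (- q y) ^ 4 / q y * (- pi * q y))"
  have q: "0 < q y" "q y < 1" if "y > 0" for y using that by (auto simp: q_def)
  have qim: "q ` {0<..} = {0<..<1}"
  proof (intro equalityI subsetI)
    fix x :: real assume x: "x \<in> {0<..<1}"
    hence "x = q (- ln x / pi)" by (simp add: q_def)
    moreover have "- ln x / pi > 0" using x by (simp add: divide_neg_pos)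
    ultimately show "x \<in> q ` {0<..}" by blast
  qed (use q in auto)
  have der: "(g has_field_derivative g' y) (at y within {0<..})" if "y \<in> {0<..}" for y
    unfolding g_def g'_def
  proof (rule DERIV_chain2[where f = modular_lambda and g = q])
    show "(modular_lambda has_real_derivative modular_lambda (q y) * theta_phi (- q y) ^ 4 / q y) (at (q y))"
      using modular_lambda_has_derivative q that by simp
    show "(q has_real_derivative - pi * q y) (at y within {0<..})"
      unfolding q_def by (auto intro!: derivative_eq_intros)
  qed
  have inj: "inj_on g {0<..}"
  proof -
    have "inj_on q {0<..}" by (auto simp: q_def inj_on_def)
    hence "inj_on (modular_lambda \<circ> q) {0<..}"
      using modular_lambda_inj by (intro comp_inj_on) (simp_all only: qim)
    thus ?thesis by (simp add: g_def o_def)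
  qed
  have im: "g ` {0<..} = {0<..<1}"
    using modular_lambda_image qim unfolding g_def by (metis image_image)
  have eq: "\<bar>g' y\<bar> * h (g y) = pi * 16 powr R * norm (K2 r s (\<i> * of_real y))" if y: "y \<in> {0<..}" for y
  proof -
    define x where "x = q y"
    have x: "0 < x" "x < 1" using q y by (auto simp: x_def)
    define l where "l = modular_lambda x"
    have l: "0 < l" "l < 1" using modular_lambda_landen(8,9)[of x] x by (auto simp: l_def)
    have uh: "\<i> * of_real y \<in> uhp" using y by (simp add: uhp_def)
    have nx: "norm x < 1" "norm (x\<^sup>2) < 1" using x by (auto simp: power_less_one_iff)
    have ex: "exp (pi * \<i> * (\<i> * of_real y)) = complex_of_real x"
    proof -
      have "pi * \<i> * (\<i> * of_real y) = complex_of_real (- pi * y)" by (simp add: complex_eq_iff)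
      thus ?thesis unfolding x_def q_def by (simp only: exp_of_real)
    qed
    define P F m where "P = theta_psi (x\<^sup>2)" and "F = theta_phi x" and "m = \<bar>theta_phi (-x)\<bar>"
    have F: "F > 0" "P > 0" using theta_ge_1[of x] theta_ge_1[of "x\<^sup>2"] x nx by (auto simp: F_def P_def)
    have m: "m > 0" using modular_lambda_landen(7)[of x] x by (auto simp: m_def)
    have m4: "theta_phi (-x) ^ 4 = m ^ 4" by (simp add: m_def power_even_abs)
    have K: "norm (K2 r s (\<i> * of_real y)) = x powr R * P powr (4 * R) * m powr (4 * (S - R)) * F powr (6 - 4 * S)"
    proof -
      have "theta_psi ((complex_of_real x)\<^sup>2) = of_real P" "theta_phi (complex_of_real x) = of_real F"
         "theta_phi (- complex_of_real x) = of_real (theta_phi (-x))"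
        using theta_of_real[OF nx(1)] theta_of_real(2)[OF nx(2)] theta_of_real(1)[of "-x"] nx
        by (simp_all add: P_def F_def)
      thus ?thesis using K2_norm(1)[OF uh, of r s] F x unfolding ex by (simp add: R_def S_def m_def)
    qed
    have l1: "l = 16 * x * P ^ 4 / F ^ 4" by (simp add: l_def modular_lambda_def P_def F_def)
    have l2: "1 - l = m ^ 4 / F ^ 4" using modular_lambda_landen(6)[of x] x by (simp add: l_def F_def m4)
    have G: "hyp_half l = F\<^sup>2" using hyp_half_modular_lambda[OF x] by (simp add: l_def F_def)
    have "\<bar>g' y\<bar> * h (g y) = pi * l * m ^ 4 * (l powr (R - 1) * (1 - l) powr (S - R - 1) * F\<^sup>2)"
      unfolding g'_def g_def h_def x_def[symmetric] l_def[symmetric] G m4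
      using x l m by (simp add: abs_mult)
    also have "\<dots> = pi * (l * l powr (R - 1)) * ((1 - l) * (1 - l) powr (S - R - 1)) * (F ^ 4 * F\<^sup>2)"
    proof -
      have "m ^ 4 = (1 - l) * F ^ 4" using l2 F by simp
      thus ?thesis by (simp only: mult_ac)
    qed
    also have "l * l powr (R - 1) = l powr R" using l by (simp add: powr_diff)
    also have "(1 - l) * (1 - l) powr (S - R - 1) = (1 - l) powr (S - R)" using l by (simp add: powr_diff)
    also have "l powr R = 16 powr R * x powr R * P powr (4 * R) / F powr (4 * R)"
      unfolding l1 using x F by (simp add: powr_mult powr_divide powr_powr flip: powr_numeral)
    also have "(1 - l) powr (S - R) = m powr (4 * (S - R)) / F powr (4 * (S - R))"
      unfolding l2 using m F by (simp add: powr_divide powr_powr flip: powr_numeral)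
    also have "F ^ 4 * F\<^sup>2 = F powr 6" using F by (simp add: powr_numeral)
    also have "F powr 6 = F powr (4 * R) * F powr (4 * (S - R)) * F powr (6 - 4 * S)"
      by (simp add: powr_add[symmetric])
    finally show ?thesis unfolding K using F by (simp add: field_simps)
  qed
  have hi: "h absolutely_integrable_on g ` {0<..} \<and> integral (g ` {0<..}) h = integral {0<..<1} h"
    using hypergeo_beta_integral(1)[OF RS] unfolding im h_def by simp
  have "(\<lambda>y. \<bar>g' y\<bar> * h (g y)) absolutely_integrable_on {0<..} \<and> integral {0<..} (\<lambda>y. \<bar>g' y\<bar> * h (g y)) = integral {0<..<1} h"
    by (rule has_absolute_integral_change_of_variables_1'[THEN iffD2, OF _ _ _ hi]) (use der inj in auto)
  hence 1: "(\<lambda>y. \<bar>g' y\<bar> * h (g y)) absolutely_integrable_on {0<..}" 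
    and 2: "integral {0<..} (\<lambda>y. \<bar>g' y\<bar> * h (g y)) = integral {0<..<1} h" by auto
  have 3: "(\<lambda>y. pi * 16 powr R * norm (K2 r s (\<i> * of_real y))) absolutely_integrable_on {0<..}"
    by (rule absolutely_integrable_spike[OF 1 negligible_empty]) (use eq in auto)
  have "(\<lambda>y. 1 / (pi * 16 powr R) * (pi * 16 powr R * norm (K2 r s (\<i> * of_real y)))) absolutely_integrable_on {0<..}"
    by (intro set_integrable_mult_right 3)
  thus "(\<lambda>y. norm (K2 r s (\<i> * of_real y))) absolutely_integrable_on {0<..}" by simp
  have "pi * 16 powr R * integral {0<..} (\<lambda>y. norm (K2 r s (\<i> * of_real y))) =
     integral {0<..} (\<lambda>y. pi * 16 powr R * norm (K2 r s (\<i> * of_real y)))" by simp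
  also have "\<dots> = integral {0<..<1} h" unfolding 2[symmetric] by (intro integral_cong) (use eq in auto)
  also have "\<dots> = Beta R (S - R) * eval_fps (fps_hypergeo [1/2, 1/2, R] [1, S] 1) 1"
    unfolding h_def by (rule hypergeo_beta_integral(2)[OF RS])
  finally show "integral {0<..} (\<lambda>y. norm (K2 r s (\<i> * of_real y))) =
      16 powr (- of_rat r) / pi * (Beta (of_rat r) (of_rat (s - r)) * eval_fps (fps_hypergeo [1/2, 1/2, of_rat r] [1, of_rat s] 1) 1)"
    by (simp add: R_def S_def of_rat_diff powr_minus field_simps)
qed

section \<open>Periodic functions on the upper half-plane\<close>

lemma periodic_int:
  fixes g :: "complex \<Rightarrow> complex"
  assumes per: "\<And>\<tau>. \<tau> \<in> uhp \<Longrightarrow> g (\<tau> + of_real w) = g \<tau>" and t: "\<tau> \<in> uhp"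
  shows "g (\<tau> + of_int k * of_real w) = g \<tau>"
proof -
  have u: "\<tau> + of_int k * of_real w \<in> uhp" for k using t by (simp add: uhp_def)
  have step: "g (\<tau> + of_int (k + 1) * of_real w) = g (\<tau> + of_int k * of_real w)" for k
    using per[OF u[of k]] by (simp add: algebra_simps)
  show ?thesis
  proof (induction k rule: int_induct[of _ 0])
    case (step1 i)
    thus ?case using step[of i] by simp
  next
    case (step2 i)
    thus ?case using step[of "i - 1"] by simp
  qed simp
qed

text \<open>
The function descends along \<open>\<tau> \<mapsto> exp(2\<pi>i\<tau>/w)\<close> to the punctured disc. It is holomorphic there
because locally any branch of the logarithm may be used, and it extends by 0 over the puncture.
\<close>
theorem periodic_cuspidal_expansion:
  fixes g :: "complex \<Rightarrow> complex"
  assumes w: "w > 0" and hol: "g holomorphic_on uhp"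
    and per: "\<And>\<tau>. \<tau> \<in> uhp \<Longrightarrow> g (\<tau> + of_real w) = g \<tau>"
    and lim: "(g \<longlongrightarrow> 0) (filtercomap Im at_top)"
  obtains h where "h holomorphic_on ball 0 1" "h 0 = 0"
    "\<And>\<tau>. \<tau> \<in> uhp \<Longrightarrow> g \<tau> = h (exp (2 * of_real pi * \<i> * \<tau> / of_real w))"
proof -
  define c where "c = of_real w / (2 * of_real pi * \<i>)"
  have c0: "c \<noteq> 0" using w by (simp add: c_def)
  have Imc: "Im (c * z) = - w / (2 * pi) * Re z" for z
    by (simp add: c_def field_simps Im_divide Re_divide power2_eq_square)
  have ec: "2 * of_real pi * \<i> * (c * z) / of_real w = z" for z using w by (simp add: c_def)
  define h0 where "h0 = (\<lambda>z. g (c * Ln z))"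
  have h0: "g \<tau> = h0 z" if t: "\<tau> \<in> uhp" and z: "z = exp (2 * of_real pi * \<i> * \<tau> / of_real w)" for \<tau> z
  proof -
    have "exp (Ln z) = exp (2 * of_real pi * \<i> * \<tau> / of_real w)" using z by simp
    then obtain n where n: "Ln z = 2 * of_real pi * \<i> * \<tau> / of_real w + (of_int (2 * n) * pi) * \<i>"
      using exp_eq by blast
    have "c * Ln z = \<tau> + of_int n * of_real w"
      unfolding n using w by (simp add: c_def field_simps)
    thus ?thesis unfolding h0_def using periodic_int[where g = g and w = w, OF per t, of n] by simp
  qed
  have h0_at: "g (c * x) = h0 z" if "z = exp x" "norm z < 1" for x z
  proof (rule h0)
    have "norm z = exp (Re x)" using that by simp
    hence "Re x < 0" using that(2) by simp
    thus "c * x \<in> uhp" unfolding uhp_def using w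
      by (simp only: mem_Collect_eq Imc) (simp add: mult_pos_neg divide_neg_pos)
    show "z = exp (2 * of_real pi * \<i> * (c * x) / of_real w)" unfolding ec by (rule that)
  qed
  have hol0: "h0 holomorphic_on ball 0 1 - {0}"
  proof (subst holomorphic_on_open)
    show "open (ball 0 1 - {0::complex})" by auto
    show "\<forall>z0\<in>ball 0 1 - {0}. \<exists>f'. (h0 has_field_derivative f') (at z0)"
    proof
      fix z0 :: complex assume z0: "z0 \<in> ball 0 1 - {0}"
      \<comment> \<open>on this ball \<open>z / z0\<close> has positive real part, so \<open>Ln (z / z0) + Ln z0\<close> is a holomorphic logarithm\<close>
      define U where "U = ball z0 (norm z0) \<inter> ball 0 1"
      have U: "open U" "z0 \<in> U" using z0 by (auto simp: U_def)
      have nz: "z \<noteq> 0" if "z \<in> U" for z using that by (auto simp: U_def)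
      have notneg: "z / z0 \<notin> \<real>\<^sub>\<le>\<^sub>0" if "z \<in> U" for z
      proof -
        have "norm (z / z0 - 1) < 1"
        proof -
          have "z / z0 - 1 = (z - z0) / z0" using z0 by (simp add: field_simps)
          thus ?thesis using that z0 by (simp add: U_def norm_divide dist_norm norm_minus_commute)
        qed
        hence "Re (z / z0) > 0" using complex_Re_le_cmod[of "1 - z / z0"] by (simp add: norm_minus_commute)
        thus ?thesis by (auto simp: complex_nonpos_Reals_iff)
      qed
      define k where "k = (\<lambda>z. g (c * (Ln (z / z0) + Ln z0)))"
      have eq: "k z = h0 z" if "z \<in> U" for z
      proof -
        have "exp (Ln (z / z0) + Ln z0) = z" using nz[OF that] z0 by (simp add: exp_add)
        moreover have "norm z < 1" using that by (simp add: U_def)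
        ultimately show ?thesis unfolding k_def by (intro h0_at) auto
      qed
      have "(\<lambda>z. c * (Ln (z / z0) + Ln z0)) holomorphic_on U"
        using notneg z0 by (intro holomorphic_intros) auto
      moreover have "c * (Ln (z / z0) + Ln z0) \<in> uhp" if "z \<in> U" for z
      proof -
        have e: "exp (Ln (z / z0) + Ln z0) = z" using nz[OF that] z0 by (simp add: exp_add)
        have "exp (Re (Ln (z / z0) + Ln z0)) = norm z" unfolding norm_exp_eq_Re[symmetric] e ..
        also have "norm z < 1" using that by (simp add: U_def)
        finally have "Re (Ln (z / z0) + Ln z0) < 0" by simp
        thus ?thesis unfolding uhp_def using w by (simp only: mem_Collect_eq Imc) (simp add: mult_pos_neg divide_neg_pos)
      qed
      ultimately have "k holomorphic_on U"
        using holomorphic_on_compose_gen[OF _ hol, of "\<lambda>z. c * (Ln (z / z0) + Ln z0)" U]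
        by (auto simp: k_def o_def)
      then obtain f' where "(k has_field_derivative f') (at z0)" using U by (auto simp: holomorphic_on_open)
      hence "(h0 has_field_derivative f') (at z0)"
        by (rule has_field_derivative_transform_within_open[OF _ U]) (use eq in auto)
      thus "\<exists>f'. (h0 has_field_derivative f') (at z0)" by blast
    qed
  qed
  have lim0: "h0 \<midarrow>0\<rightarrow> 0"
  proof (rule tendstoI)
    fix e :: real assume "e > 0"
    hence "\<forall>\<^sub>F \<tau> in filtercomap Im at_top. dist (g \<tau>) 0 < e" using lim tendstoD by blast
    then obtain M where M: "\<And>\<tau>. Im \<tau> \<ge> M \<Longrightarrow> dist (g \<tau>) 0 < e"
      by (auto simp: eventually_filtercomap_at_top_linorder)
    define d where "d = exp (- 2 * pi * \<bar>M\<bar> / w)"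
    have "dist (h0 z) 0 < e" if "z \<noteq> 0" "dist z 0 < d" for z
    proof -
      have "d > 0" by (simp add: d_def)
      hence "ln (norm z) < ln d" using that by simp
      hence "ln (norm z) < - 2 * pi * \<bar>M\<bar> / w" by (simp add: d_def)
      hence "w * ln (norm z) < - 2 * pi * \<bar>M\<bar>" using w by (simp add: field_simps)
      moreover have "Im (c * Ln z) = - w / (2 * pi) * ln (norm z)" using that(1) by (simp only: Imc) simp
      moreover have "\<bar>M\<bar> \<le> - w / (2 * pi) * ln (norm z)"
        using \<open>w * ln (norm z) < - 2 * pi * \<bar>M\<bar>\<close> by (simp add: field_simps)
      ultimately have "Im (c * Ln z) \<ge> \<bar>M\<bar>" by (simp only:)
      thus ?thesis unfolding h0_def by (intro M) linarith
    qed
    moreover have "d > 0" by (simp add: d_def)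
    ultimately show "\<forall>\<^sub>F z in at 0. dist (h0 z) 0 < e" unfolding eventually_at by blast
  qed
  define h where "h = (\<lambda>z. if z = 0 then 0 else h0 z)"
  show thesis
  proof (rule that[of h])
    show "h holomorphic_on ball 0 1" unfolding h_def by (rule removable_singularity[OF hol0 _ lim0]) simp
    show "h 0 = 0" by (simp add: h_def)
    show "g \<tau> = h (exp (2 * of_real pi * \<i> * \<tau> / of_real w))" if "\<tau> \<in> uhp" for \<tau>
      using h0[OF that refl] by (simp add: h_def)
  qed
qed

text \<open>
The descended function vanishes at 0, hence is bounded by a multiple of its argument, and
the argument has absolute value \<open>exp(-2\<pi>y/w)\<close>.
\<close>
lemma periodic_cuspidal_decay:
  fixes g :: "complex \<Rightarrow> complex"
  assumes w: "w > 0" and hol: "g holomorphic_on uhp"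
    and per: "\<And>\<tau>. \<tau> \<in> uhp \<Longrightarrow> g (\<tau> + of_real w) = g \<tau>"
    and lim: "(g \<longlongrightarrow> 0) (filtercomap Im at_top)"
  obtains C where "\<And>y. y \<ge> 1 \<Longrightarrow> norm (g (\<i> * of_real y)) \<le> C * exp (- (2 * pi / w) * y)"
proof -
  obtain h where h: "h holomorphic_on ball 0 1" "h 0 = 0"
    "\<And>\<tau>. \<tau> \<in> uhp \<Longrightarrow> g \<tau> = h (exp (2 * of_real pi * \<i> * \<tau> / of_real w))"
    using periodic_cuspidal_expansion[OF assms] by blast
  define r where "r = exp (- (2 * pi / w))"
  have r: "0 < r" "r < 1" using w by (auto simp: r_def)
  have sub: "cball 0 r \<subseteq> ball (0::complex) 1" using r by auto
  have dh: "(h has_field_derivative deriv h z) (at z)" if "z \<in> ball 0 1" for z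
    using h(1) that by (intro holomorphic_derivI[OF _ open_ball])
  have "deriv h holomorphic_on ball 0 1" using h(1) by (intro holomorphic_deriv) auto
  hence "continuous_on (cball 0 r) (deriv h)"
    using sub holomorphic_on_imp_continuous_on continuous_on_subset by blast
  hence "bounded (deriv h ` cball 0 r)"
    by (intro compact_imp_bounded compact_continuous_image) auto
  then obtain B where B: "\<And>z. z \<in> cball 0 r \<Longrightarrow> norm (deriv h z) \<le> B"
    unfolding bounded_iff by blast
  have bd: "norm (h z) \<le> B * norm z" if "z \<in> cball 0 r" for z
  proof -
    have "norm (h z - h 0) \<le> B * norm (z - 0)"
    proof (rule field_differentiable_bound[of "cball 0 r" h "deriv h" B])
      show "(h has_field_derivative deriv h x) (at x within cball 0 r)" if "x \<in> cball 0 r" for x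
        using dh[of x] sub that has_field_derivative_at_within by blast
    qed (use that B r in auto)
    thus ?thesis using h(2) by simp
  qed
  show thesis
  proof (rule that[of B])
    fix y :: real assume y: "y \<ge> 1"
    define z where "z = exp (2 * of_real pi * \<i> * (\<i> * of_real y) / of_real w)"
    have nz: "norm z = exp (- (2 * pi / w) * y)" by (simp add: z_def)
    have "2 * pi / w * 1 \<le> 2 * pi / w * y" using y w by (intro mult_left_mono) auto
    hence "norm z \<le> r" unfolding nz r_def by simp
    hence "norm (h z) \<le> B * norm z" by (intro bd) simp
    moreover have "g (\<i> * of_real y) = h z" unfolding z_def using y by (intro h(3)) (simp add: uhp_def)
    ultimately show "norm (g (\<i> * of_real y)) \<le> B * exp (- (2 * pi / w) * y)" by (simp add: nz)
  qed
qed

section \<open>Mellin transforms of rapidly decaying functions\<close>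

lemma powr_le_exp:
  fixes A c :: real
  assumes "c > 0"
  obtains K where "K > 0" "\<And>x. x \<ge> 1 \<Longrightarrow> x powr A \<le> K * exp (c * x)"
proof -
  have "((\<lambda>x. x powr A * exp (- c * x)) \<longlongrightarrow> 0) at_top" using assms by real_asymp
  hence "\<forall>\<^sub>F x in at_top. x powr A * exp (- c * x) < 1" by (rule order_tendstoD) simp
  then obtain X where X: "\<And>x. x \<ge> X \<Longrightarrow> x powr A * exp (- c * x) < 1" by (auto simp: eventually_at_top_linorder)
  define K where "K = max 1 (max 1 X powr \<bar>A\<bar>)"
  show thesis
  proof (rule that[of K])
    show "K > 0" by (simp add: K_def)
    fix x :: real assume x: "x \<ge> 1"
    have ex: "exp (c * x) \<ge> 1" using x assms by simp
    show "x powr A \<le> K * exp (c * x)"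
    proof (cases "x \<ge> X")
      case True
      have "x powr A = (x powr A * exp (- c * x)) * exp (c * x)" by (simp add: exp_minus)
      also have "\<dots> \<le> K * exp (c * x)" using X[OF True] by (intro mult_right_mono) (auto simp: K_def)
      finally show ?thesis .
    next
      case False
      have "x powr A \<le> x powr \<bar>A\<bar>" using x by (intro powr_mono) auto
      also have "\<dots> \<le> max 1 X powr \<bar>A\<bar>" using x False by (intro powr_mono2) auto
      also have "\<dots> \<le> K * 1" by (simp add: K_def)
      also have "\<dots> \<le> K * exp (c * x)" using ex by (intro mult_left_mono) (auto simp: K_def)
      finally show ?thesis .
    qed
  qed
qed

text \<open>
The behaviour of a weight \<open>k\<close> cusp form along the imaginary axis: exponential decay at infinity,
and, through the inversion \<open>y \<mapsto> 1/y\<close> with its factor of automorphy \<open>y\<^sup>k\<close>, exponential decay in \<open>1/y\<close> at 0.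
\<close>
locale rapid_decay =
  fixes \<phi> :: "real \<Rightarrow> complex" and C c :: real and k :: nat
  assumes cont: "continuous_on {0<..} \<phi>" and c: "c > 0"
    and decay_top: "\<And>y. y \<ge> 1 \<Longrightarrow> norm (\<phi> y) \<le> C * exp (- c * y)"
    and decay_0: "\<And>y. y \<ge> 1 \<Longrightarrow> norm (\<phi> (1 / y)) \<le> C * y ^ k * exp (- c * y)"
begin

lemma C_nonneg: "C \<ge> 0"
proof -
  have "0 \<le> C * exp (- c * 1)" using decay_top[of 1] norm_ge_zero[of "\<phi> 1"] by linarith
  thus ?thesis by (simp add: zero_le_mult_iff)
qed

text \<open>
The weight \<open>exp(A |ln y|)\<close> is the larger of \<open>y\<^sup>A\<close> and \<open>y\<^bsup>-A\<^esup>\<close>; with \<open>A\<close> large it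
dominates the integrands of all Mellin transforms below.
\<close>
lemma dominated:
  obtains K where "\<And>y. y > 0 \<Longrightarrow> norm (\<phi> y) * exp (A * \<bar>ln y\<bar>) \<le> K * exp (- (c / 2) * y)"
proof -
  obtain K1 where K1: "K1 > 0" "\<And>x. x \<ge> 1 \<Longrightarrow> x powr A \<le> K1 * exp (c / 2 * x)"
    using powr_le_exp[of "c / 2" A] c by auto
  obtain K2 where K2: "K2 > 0" "\<And>x. x \<ge> 1 \<Longrightarrow> x powr (A + real k) \<le> K2 * exp (c * x)"
    using powr_le_exp[OF c, of "A + real k"] by auto
  define K where "K = C * K1 + C * K2 * exp (c / 2)"
  show thesis
  proof (rule that[of K])
    fix y :: real assume y: "y > 0"
    show "norm (\<phi> y) * exp (A * \<bar>ln y\<bar>) \<le> K * exp (- (c / 2) * y)"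
    proof (cases "y \<ge> 1")
      case True
      have "norm (\<phi> y) * exp (A * \<bar>ln y\<bar>) = norm (\<phi> y) * y powr A" using True by (simp add: powr_def)
      also have "\<dots> \<le> (C * exp (- c * y)) * (K1 * exp (c / 2 * y))"
        using decay_top[OF True] K1 True C_nonneg by (intro mult_mono) auto
      also have "\<dots> = C * K1 * exp (- (c / 2) * y)"
        by (simp add: exp_add[symmetric] mult_ac)
      also have "\<dots> \<le> K * exp (- (c / 2) * y)" using C_nonneg K2 by (intro mult_right_mono) (auto simp: K_def)
      finally show ?thesis .
    next
      case False
      define x where "x = 1 / y"
      have x: "x \<ge> 1" "y = 1 / x" using False y by (auto simp: x_def)
      have "norm (\<phi> y) * exp (A * \<bar>ln y\<bar>) = norm (\<phi> (1 / x)) * x powr A"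
        using x by (simp add: powr_def ln_div)
      also have "\<dots> \<le> (C * x ^ k * exp (- c * x)) * x powr A"
        using decay_0[OF x(1)] by (intro mult_right_mono) auto
      also have "\<dots> = C * exp (- c * x) * x powr (A + real k)"
        using x by (simp add: powr_add powr_realpow)
      also have "\<dots> \<le> C * exp (- c * x) * (K2 * exp (c * x))"
        using K2(2)[OF x(1)] C_nonneg by (intro mult_left_mono) auto
      also have "\<dots> = C * K2" by (simp add: exp_minus)
      also have "\<dots> = C * K2 * exp (c / 2) * exp (- (c / 2) * 1)" by (simp add: exp_minus)
      also have "\<dots> \<le> K * exp (- (c / 2) * y)"
        using C_nonneg K1 K2 False c by (intro mult_mono) (auto simp: K_def)
      finally show ?thesis .
    qed
  qed
qed

lemma abs_integrable:
  assumes m: "continuous_on {0<..} m" and le: "\<And>y. y > 0 \<Longrightarrow> norm (m y) \<le> B * exp (A * \<bar>ln y\<bar>)"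
  shows "(\<lambda>y. \<phi> y * m y) absolutely_integrable_on {0<..}"
proof -
  obtain K where K: "\<And>y. y > 0 \<Longrightarrow> norm (\<phi> y) * exp (A * \<bar>ln y\<bar>) \<le> K * exp (- (c / 2) * y)"
    using dominated by blast
  have B: "B \<ge> 0" using le[of 1] norm_ge_zero[of "m 1"] by (simp del: norm_ge_zero)
  show ?thesis
  proof (rule measurable_bounded_by_integrable_imp_absolutely_integrable)
    show "(\<lambda>y. \<phi> y * m y) \<in> borel_measurable (lebesgue_on {0<..})"
      by (intro continuous_imp_measurable_on_sets_lebesgue continuous_intros cont m) auto
    have "(\<lambda>y. exp (- (c / 2) * y)) integrable_on {0..}"
      using c by (intro integrable_on_exp_minus_to_infinity) auto
    hence "(\<lambda>y. exp (- (c / 2) * y)) integrable_on {0<..}"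
      by (rule integrable_spike_set) (auto intro: negligible_subset[of "{0}"])
    thus "(\<lambda>y. B * K * exp (- (c / 2) * y)) integrable_on {0<..}" by (rule integrable_on_mult_right)
    fix y :: real assume "y \<in> {0<..}"
    hence y: "y > 0" by simp
    have "norm (\<phi> y * m y) \<le> norm (\<phi> y) * (B * exp (A * \<bar>ln y\<bar>))"
      unfolding norm_mult using le[OF y] by (intro mult_left_mono) auto
    also have "\<dots> = B * (norm (\<phi> y) * exp (A * \<bar>ln y\<bar>))" by simp
    also have "\<dots> \<le> B * (K * exp (- (c / 2) * y))" using K[OF y] B by (intro mult_left_mono)
    finally show "norm (\<phi> y * m y) \<le> B * K * exp (- (c / 2) * y)" by simp
  qed auto
qed

definition mellin :: "complex \<Rightarrow> complex" where
  "mellin z = integral {0<..} (\<lambda>y. \<phi> y * of_real y powr (z - 1))"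

lemma powr_exp_ln: "y > 0 \<Longrightarrow> of_real y powr (z - 1 :: complex) = exp (z * of_real (ln y)) / of_real y"
  by (simp add: powr_def Ln_of_real left_diff_distrib exp_diff exp_of_real)

lemma inverse_le_exp_ln: "y > 0 \<Longrightarrow> 1 / y \<le> exp \<bar>ln y :: real\<bar>"
proof -
  assume "y > 0"
  hence "1 / y = exp (- ln y)" by (simp add: exp_minus field_simps)
  thus ?thesis by simp
qed

text \<open>
Expanding \<open>y\<^sup>z = exp(z ln y)\<close> in powers of \<open>z\<close> and integrating termwise exhibits the Mellin transform
as a power series in \<open>z\<close> that converges everywhere.
\<close>
lemma mellin_entire: "mellin holomorphic_on UNIV"
proof -
  define a where "a = (\<lambda>n. integral {0<..} (\<lambda>y. \<phi> y * (of_real (ln y ^ n / fact n / y))))"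
  have main: "(\<lambda>n. a n * z ^ n) sums mellin z" for z
  proof -
    define f where "f = (\<lambda>n y. \<phi> y * (of_real (ln y ^ n / fact n / y) * z ^ n))"
    \<comment> \<open>the extra 1 absorbs the factor \<open>1 / y\<close>\<close>
    define A where "A = norm z + 1"
    have part: "(\<Sum>i<n. (norm z * \<bar>ln y\<bar>) ^ i / fact i) \<le> exp (norm z * \<bar>ln y\<bar>)" for y n
    proof -
      have "(\<lambda>i. (norm z * \<bar>ln y\<bar>) ^ i / fact i) sums exp (norm z * \<bar>ln y\<bar>)"
        using exp_converges[of "norm z * \<bar>ln y\<bar>"] by (simp add: field_simps)
      thus ?thesis using sum_le_suminf[of "\<lambda>i. (norm z * \<bar>ln y\<bar>) ^ i / fact i" "{..<n}"]
        by (simp add: sums_iff)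
    qed
    have nf: "norm (f n y) = norm (\<phi> y) / y * ((norm z * \<bar>ln y\<bar>) ^ n / fact n)" if "y > 0" for n y
      using that by (simp add: f_def norm_mult norm_power norm_divide power_mult_distrib) (simp add: mult_ac)
    have termle: "(norm z * \<bar>ln y\<bar>) ^ n / fact n \<le> exp (norm z * \<bar>ln y\<bar>)" for n y
    proof -
      have "(norm z * \<bar>ln y\<bar>) ^ n / fact n \<le> (\<Sum>i<Suc n. (norm z * \<bar>ln y\<bar>) ^ i / fact i)"
        by (simp add: sum_nonneg)
      also note part
      finally show ?thesis .
    qed
    have yA: "1 / y * exp (norm z * \<bar>ln y\<bar>) \<le> exp (A * \<bar>ln y\<bar>)" if "y > 0" for y
    proof -
      have "1 / y * exp (norm z * \<bar>ln y\<bar>) \<le> exp \<bar>ln y\<bar> * exp (norm z * \<bar>ln y\<bar>)"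
        using inverse_le_exp_ln[OF that] by (intro mult_right_mono) auto
      thus ?thesis by (simp add: A_def exp_add[symmetric] algebra_simps)
    qed
    have fi: "f n absolutely_integrable_on {0<..}" for n
      unfolding f_def
    proof (rule abs_integrable)
      show "continuous_on {0<..} (\<lambda>y. of_real (ln y ^ n / fact n / y) * z ^ n)"
        by (intro continuous_intros) auto
      fix y :: real assume y: "y > 0"
      have "norm (of_real (ln y ^ n / fact n / y) * z ^ n) = 1 / y * ((norm z * \<bar>ln y\<bar>) ^ n / fact n)"
        using y by (simp add: norm_mult norm_power norm_divide power_mult_distrib) (simp add: mult_ac)
      also have "\<dots> \<le> 1 / y * exp (norm z * \<bar>ln y\<bar>)" using termle y by (intro mult_left_mono) auto
      also note yA[OF y]
      finally show "norm (of_real (ln y ^ n / fact n / y) * z ^ n) \<le> 1 * exp (A * \<bar>ln y\<bar>)" by simp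
    qed
    have fs: "(\<lambda>n. f n y) sums (\<phi> y * of_real y powr (z - 1))" if y: "y > 0" for y
    proof -
      have "(\<lambda>n. (z * of_real (ln y)) ^ n /\<^sub>R fact n) sums exp (z * of_real (ln y))" by (rule exp_converges)
      hence "(\<lambda>n. \<phi> y / of_real y * ((z * of_real (ln y)) ^ n /\<^sub>R fact n)) sums (\<phi> y / of_real y * exp (z * of_real (ln y)))"
        by (rule sums_mult)
      thus ?thesis using y by (simp add: f_def powr_exp_ln power_mult_distrib scaleR_conv_of_real field_simps)
    qed
    have summ: "summable (\<lambda>n. norm (f n y))" if "y \<in> {0<..}" for y
    proof -
      have "(\<lambda>i. (norm z * \<bar>ln y\<bar>) ^ i / fact i) sums exp (norm z * \<bar>ln y\<bar>)"
        using exp_converges[of "norm z * \<bar>ln y\<bar>"] by (simp add: field_simps)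
      hence "summable (\<lambda>i. norm (\<phi> y) / y * ((norm z * \<bar>ln y\<bar>) ^ i / fact i))"
        by (intro summable_mult) (simp add: sums_iff)
      thus ?thesis using nf that by simp
    qed
    have W: "(\<lambda>y. \<phi> y * of_real (exp (A * \<bar>ln y\<bar>))) absolutely_integrable_on {0<..}"
      by (rule abs_integrable[where B = 1 and A = A]) (auto intro!: continuous_intros)
    have sumi: "summable (\<lambda>n. integral {0<..} (\<lambda>y. norm (f n y)))"
    proof (rule summableI_nonneg_bounded)
      show "0 \<le> integral {0<..} (\<lambda>y. norm (f n y))" for n
        using absolutely_integrable_norm[OF fi[of n]] set_lebesgue_integral_eq_integral(1)
        by (intro integral_nonneg) (auto simp: o_def)
      fix n
      have ni: "(\<lambda>y. norm (f i y)) integrable_on {0<..}" for i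
        using set_lebesgue_integral_eq_integral(1)[OF absolutely_integrable_norm[OF fi[of i]]] by (simp add: o_def)
      have "(\<Sum>i<n. integral {0<..} (\<lambda>y. norm (f i y))) = integral {0<..} (\<lambda>y. \<Sum>i<n. norm (f i y))"
        by (rule integral_sum[symmetric]) (use ni in auto)
      also have "\<dots> \<le> integral {0<..} (\<lambda>y. norm (\<phi> y * of_real (exp (A * \<bar>ln y\<bar>))))"
      proof (rule integral_le)
        show "(\<lambda>y. \<Sum>i<n. norm (f i y)) integrable_on {0<..}" by (intro integrable_sum ni) auto
        show "(\<lambda>y. norm (\<phi> y * of_real (exp (A * \<bar>ln y\<bar>)))) integrable_on {0<..}"
          using set_lebesgue_integral_eq_integral(1)[OF absolutely_integrable_norm[OF W]] by (simp add: o_def)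
        fix y :: real assume "y \<in> {0<..}"
        hence y: "y > 0" by simp
        have "(\<Sum>i<n. norm (f i y)) = norm (\<phi> y) * (1 / y * (\<Sum>i<n. (norm z * \<bar>ln y\<bar>) ^ i / fact i))"
          unfolding nf[OF y] by (simp add: sum_distrib_left)
        also have "\<dots> \<le> norm (\<phi> y) * (1 / y * exp (norm z * \<bar>ln y\<bar>))"
          using part y by (intro mult_left_mono) auto
        also have "\<dots> \<le> norm (\<phi> y) * exp (A * \<bar>ln y\<bar>)" using yA[OF y] by (intro mult_left_mono) auto
        finally show "(\<Sum>i<n. norm (f i y)) \<le> norm (\<phi> y * of_real (exp (A * \<bar>ln y\<bar>)))" by (simp add: norm_mult)
      qed
      finally show "(\<Sum>i<n. integral {0<..} (\<lambda>y. norm (f i y))) \<le> integral {0<..} (\<lambda>y. norm (\<phi> y * of_real (exp (A * \<bar>ln y\<bar>))))" .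
    qed
    have "(\<lambda>n. integral {0<..} (f n)) sums integral {0<..} (\<lambda>y. \<Sum>n. f n y)"
      by (rule absolutely_integrable_termwise(2)[OF fi summ sumi])
    also have "integral {0<..} (\<lambda>y. \<Sum>n. f n y) = mellin z"
      unfolding mellin_def using fs by (intro integral_cong) (auto simp: sums_iff)
    also have "(\<lambda>n. integral {0<..} (f n)) = (\<lambda>n. a n * z ^ n)"
    proof
      fix n
      have "f n = (\<lambda>y. \<phi> y * of_real (ln y ^ n / fact n / y) * z ^ n)" by (auto simp: f_def)
      thus "integral {0<..} (f n) = a n * z ^ n" unfolding a_def by (simp only: integral_mult_left)
    qed
    finally show ?thesis .
  qed
  have "mellin holomorphic_on ball 0 r" for r
    by (rule power_series_holomorphic[of 0 r a]) (use main in simp)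
  hence "mellin analytic_on {z}" for z
    by (auto simp: analytic_at intro!: exI[of _ "ball 0 (norm z + 1)"])
  hence "mellin analytic_on UNIV" using analytic_on_analytic_at by blast
  thus ?thesis by (rule analytic_imp_holomorphic)
qed

end

lemma Gamma_integral_scaled:
  assumes z: "Re z > 0" and a: "a > 0"
  shows "(\<lambda>t. of_real t powr (z - 1) / of_real (exp (a * t))) absolutely_integrable_on {0<..}"
    and "integral {0<..} (\<lambda>t. of_real t powr (z - 1) / of_real (exp (a * t))) = Gamma z / of_real a powr z"
proof -
  show ai: "(\<lambda>t. of_real t powr (z - 1) / of_real (exp (a * t))) absolutely_integrable_on {0<..}"
    by (rule absolutely_integrable_Gamma_integral[OF z a])
  define g where "g = (\<lambda>t::real. of_real t powr (z - 1) / of_real (exp t) :: complex)"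
  have g: "g absolutely_integrable_on {0<..}" unfolding g_def by (rule absolutely_integrable_Gamma_integral'[OF z])
  have "Gamma z = integral {0<..} g" unfolding g_def using Gamma_integral_complex'[OF z] by (simp add: integral_unique)
  also have "\<dots> = (LINT t|lebesgue. indicat_real {0<..} t *\<^sub>R g t)"
    using set_lebesgue_integral_eq_integral(2)[OF g] by (simp add: set_lebesgue_integral_def)
  also have "\<dots> = \<bar>a\<bar> *\<^sub>R (LINT t|lebesgue. indicat_real {0<..} (0 + a * t) *\<^sub>R g (0 + a * t))"
    by (rule lebesgue_integral_real_affine) (use a in auto)
  also have "(\<lambda>t. indicat_real {0<..} (0 + a * t) *\<^sub>R g (0 + a * t)) = 
      (\<lambda>t. indicat_real {0<..} t *\<^sub>R (of_real a powr (z - 1) * (of_real t powr (z - 1) / of_real (exp (a * t)))))"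
  proof
    fix t
    show "indicat_real {0<..} (0 + a * t) *\<^sub>R g (0 + a * t) = 
      indicat_real {0<..} t *\<^sub>R (of_real a powr (z - 1) * (of_real t powr (z - 1) / of_real (exp (a * t))))"
    proof (cases "t > 0")
      case True
      hence "complex_of_real (a * t) powr (z - 1) = of_real a powr (z - 1) * of_real t powr (z - 1)"
        using a by (simp add: powr_times_real)
      thus ?thesis using True a by (simp add: g_def)
    next
      case False
      hence "\<not> a * t > 0" using a by (simp add: zero_less_mult_iff)
      thus ?thesis using False by simp
    qed
  qed
  also have "(LINT t|lebesgue. indicat_real {0<..} t *\<^sub>R (of_real a powr (z - 1) * (of_real t powr (z - 1) / of_real (exp (a * t)))))
    = integral {0<..} (\<lambda>t. of_real a powr (z - 1) * (of_real t powr (z - 1) / of_real (exp (a * t))))"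
    using set_lebesgue_integral_eq_integral(2)[OF set_integrable_mult_right[OF ai, of "of_real a powr (z - 1)"]]
    by (simp add: set_lebesgue_integral_def)
  also have "\<dots> = of_real a powr (z - 1) * integral {0<..} (\<lambda>t. of_real t powr (z - 1) / of_real (exp (a * t)))"
    by (rule integral_mult_right)
  finally have "Gamma z = of_real a * of_real a powr (z - 1) * integral {0<..} (\<lambda>t. of_real t powr (z - 1) / of_real (exp (a * t)))"
    using a by (simp add: scaleR_conv_of_real mult.assoc)
  also have "of_real a * of_real a powr (z - 1) = complex_of_real a powr z"
    using a by (simp add: powr_diff)
  finally show "integral {0<..} (\<lambda>t. of_real t powr (z - 1) / of_real (exp (a * t))) = Gamma z / of_real a powr z"
    using a by (simp add: field_simps)
qed

section \<open>The L-value of a cusp form at 1\<close>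

text \<open>
This yields uniqueness of Fourier coefficients: the variable \<open>exp(2\<pi>i\<tau>)\<close> takes every value of the
unit disc except 0.
\<close>
lemma power_series_punctured_zero:
  fixes d :: "nat \<Rightarrow> complex"
  assumes d: "\<And>x. x \<noteq> 0 \<Longrightarrow> norm x < 1 \<Longrightarrow> (\<lambda>n. d n * x ^ n) sums 0"
  shows "d n = 0"
proof (induction n rule: less_induct)
  case (less n)
  have s: "(\<lambda>m. d (m + n) * x ^ m) sums 0" if x: "x \<noteq> 0" "norm x < 1" for x
  proof -
    have "(\<lambda>m. d (m + n) * x ^ (m + n)) sums 0"
      using d[OF x] less by (subst sums_zero_iff_shift[of n "\<lambda>m. d m * x ^ m"]) auto
    hence "(\<lambda>m. 1 / x ^ n * (d (m + n) * x ^ (m + n))) sums (1 / x ^ n * 0)" by (rule sums_mult)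
    thus ?thesis using x by (simp add: power_add)
  qed
  have "((\<lambda>x::complex. 0) \<longlongrightarrow> d (0 + n)) (at 0)"
    by (rule powser_limit_0_strong[of 1 "\<lambda>m. d (m + n)"]) (use s in auto)
  thus ?case by (simp add: tendsto_const_iff)
qed

text \<open>
Hecke's argument. The growth bound makes the Fourier coefficients grow polynomially, so the
Dirichlet series converges in a half-plane and there equals the Mellin transform of \<open>f(iy)\<close> up to the
factor \<open>(2\<pi>)\<^sup>z / \<Gamma>(z)\<close>. Rapid decay at both ends of the imaginary axis makes the Mellin transform
entire, hence this product is the analytic continuation; its value at 1 is the integral.
\<close>
theorem L_fun_cusp_form_at_1:
  fixes f :: "complex \<Rightarrow> complex"
  assumes cf: "cusp_form k L f" and L: "L > 0"
    and growth: "\<And>\<tau>. \<tau> \<in> uhp \<Longrightarrow> Im \<tau> \<le> 1 \<Longrightarrow> norm (f \<tau>) \<le> C0 / Im \<tau> ^ m"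
  shows "L_fun f 1 = 2 * pi * integral {0<..} (\<lambda>y. f (\<i> * of_real y))"
proof -
  have hol: "f holomorphic_on uhp"
    and inv: "\<And>a b c d \<tau>. a * d - b * c = 1 \<Longrightarrow> [a = 1] (mod int L) \<Longrightarrow> [d = 1] (mod int L) \<Longrightarrow>
        [c = 0] (mod int L) \<Longrightarrow> \<tau> \<in> uhp \<Longrightarrow> slash k a b c d f \<tau> = f \<tau>"
    and cusp: "\<And>a b c d. a * d - b * c = 1 \<Longrightarrow> (slash k a b c d f \<longlongrightarrow> 0) (filtercomap Im at_top)"
    using cf unfolding cusp_form_def by blast+
  have per: "f (\<tau> + of_real 1) = f \<tau>" if "\<tau> \<in> uhp" for \<tau>
    using inv[of 1 1 1 0 \<tau>] that by (simp add: slash_def)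
  have limf: "(f \<longlongrightarrow> 0) (filtercomap Im at_top)"
  proof -
    have "slash k 1 0 0 1 f = f" by (auto simp: slash_def)
    thus ?thesis using cusp[of 1 1 0 0] by simp
  qed
  obtain h where h: "h holomorphic_on ball 0 1" "h 0 = 0"
    "\<And>\<tau>. \<tau> \<in> uhp \<Longrightarrow> f \<tau> = h (exp (2 * of_real pi * \<i> * \<tau> / of_real 1))"
    using periodic_cuspidal_expansion[OF zero_less_one hol per limf] by blast
  have hf: "f \<tau> = h (exp (2 * of_real pi * \<i> * \<tau>))" if "\<tau> \<in> uhp" for \<tau> using h(3)[OF that] by simp
  define a where "a = (\<lambda>n. (deriv ^^ n) h 0 / fact n)"
  have ha: "(\<lambda>n. a n * q ^ n) sums h q" if "norm q < 1" for q
    using holomorphic_power_series[OF h(1), of q] that by (simp add: a_def)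
  have a0: "a 0 = 0" by (simp add: a_def h(2))
  have qpow: "exp (2 * of_real pi * \<i> * of_nat n * \<tau>) = exp (2 * of_real pi * \<i> * \<tau>) ^ n" for n \<tau>
    unfolding exp_of_nat_mult[symmetric] by (simp add: mult_ac)
  have nq: "norm (exp (2 * of_real pi * \<i> * \<tau>)) < 1" if "\<tau> \<in> uhp" for \<tau> using that by (simp add: uhp_def)
  have tau_of: "\<exists>\<tau>\<in>uhp. x = exp (2 * of_real pi * \<i> * \<tau>) \<and> Im \<tau> = - ln (norm x) / (2 * pi)" if "x \<noteq> 0" "norm x < 1" for x
  proof -
    define \<tau> where "\<tau> = Ln x / (2 * of_real pi * \<i>)"
    have im: "Im \<tau> = - ln (norm x) / (2 * pi)" using that(1)
      by (simp add: \<tau>_def Im_divide power2_eq_square)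
    have "ln (norm x) < 0" using that by simp
    hence "\<tau> \<in> uhp" by (simp add: uhp_def im divide_neg_pos)
    moreover have "x = exp (2 * of_real pi * \<i> * \<tau>)" using that by (simp add: \<tau>_def)
    ultimately show ?thesis using im by blast
  qed
  have qc: "q_coeffs f = a"
    unfolding q_coeffs_def
  proof (rule the_equality)
    show "\<forall>\<tau>\<in>uhp. (\<lambda>n. a n * exp (2 * of_real pi * \<i> * of_nat n * \<tau>)) sums f \<tau>"
      using ha[OF nq] hf by (simp add: qpow)
  next
    fix b assume b: "\<forall>\<tau>\<in>uhp. (\<lambda>n. b n * exp (2 * of_real pi * \<i> * of_nat n * \<tau>)) sums f \<tau>"
    have "b n - a n = 0" for n
    proof (rule power_series_punctured_zero[of "\<lambda>n. b n - a n"])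
      fix x :: complex assume x: "x \<noteq> 0" "norm x < 1"
      then obtain \<tau> where t: "\<tau> \<in> uhp" "x = exp (2 * of_real pi * \<i> * \<tau>)" using tau_of by blast
      have "(\<lambda>n. b n * x ^ n) sums f \<tau>" using b t by (simp add: qpow)
      moreover have "(\<lambda>n. a n * x ^ n) sums f \<tau>" using ha[OF x(2)] hf[OF t(1)] t(2) by simp
      ultimately have "(\<lambda>n. b n * x ^ n - a n * x ^ n) sums (f \<tau> - f \<tau>)" by (rule sums_diff)
      thus "(\<lambda>n. (b n - a n) * x ^ n) sums 0" by (simp add: left_diff_distrib)
    qed
    thus "b = a" by auto
  qed
  define C1 where "C1 = C0 * exp (2 * pi)"
  have a_bound: "norm (a n) \<le> C1 * real n ^ m" if n: "n \<ge> 1" for n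
  proof -
    \<comment> \<open>Cauchy's inequality on the circle that corresponds to \<open>Im \<tau> = 1/n\<close>, where \<open>r\<^sup>n\<close> does not depend on \<open>n\<close>\<close>
    define r where "r = exp (- (2 * pi / real n))"
    have r: "0 < r" "r < 1" using n by (auto simp: r_def)
    have B: "norm (h x) \<le> C0 * real n ^ m" if "norm (0 - x) = r" for x
    proof -
      have x: "x \<noteq> 0" "norm x < 1" "norm x = r" using that r by auto
      then obtain \<tau> where t: "\<tau> \<in> uhp" "x = exp (2 * of_real pi * \<i> * \<tau>)" "Im \<tau> = - ln (norm x) / (2 * pi)" 
        using tau_of by blast
      have im: "Im \<tau> = 1 / real n" unfolding t(3) x(3) r_def by simp
      have "norm (f \<tau>) \<le> C0 / (1 / real n) ^ m" using growth[OF t(1)] n unfolding im by simp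
      thus ?thesis using hf[OF t(1)] t(2) by (simp add: power_divide)
    qed
    have "norm ((deriv ^^ n) h 0) \<le> fact n * (C0 * real n ^ m) / r ^ n"
    proof (rule Cauchy_inequality[OF _ _ r(1) B])
      have sub: "cball 0 r \<subseteq> ball (0::complex) 1" using r by auto
      show "continuous_on (cball 0 r) h" using h(1) sub holomorphic_on_imp_continuous_on continuous_on_subset by blast
      show "h holomorphic_on ball 0 r" by (rule holomorphic_on_subset[OF h(1)]) (use r in auto)
    qed auto
    hence "norm (a n) \<le> C0 * real n ^ m / r ^ n" by (simp add: a_def norm_divide field_simps)
    also have "r ^ n = exp (- (2 * pi))" unfolding r_def exp_of_nat_mult[symmetric] using n by simp
    finally show ?thesis by (simp add: C1_def exp_minus field_simps)
  qed
  define \<phi> where "\<phi> = (\<lambda>y. f (\<i> * of_real y))"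
  have cont_phi: "continuous_on {0<..} \<phi>"
    unfolding \<phi>_def by (rule continuous_on_compose2[OF holomorphic_on_imp_continuous_on[OF hol]])
      (auto intro!: continuous_intros simp: uhp_def)
  obtain Ca where Ca: "\<And>y. y \<ge> 1 \<Longrightarrow> norm (f (\<i> * of_real y)) \<le> Ca * exp (- (2 * pi / 1) * y)"
    using periodic_cuspidal_decay[OF zero_less_one hol per limf] by blast
  \<comment> \<open>the form at the cusp 0; it has period \<open>L\<close>, as conjugating the translation by \<open>L\<close> gives a matrix of \<open>\<Gamma>\<^sub>1(L)\<close>\<close>
  define g where "g = slash k 0 (-1) 1 0 f"
  have g: "g \<tau> = f (- 1 / \<tau>) / \<tau> ^ k" for \<tau> by (simp add: g_def slash_def)
  have inv_uhp: "- 1 / \<tau> \<in> uhp" if "\<tau> \<in> uhp" for \<tau>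
    using that by (auto simp: uhp_def Im_divide intro!: divide_pos_pos sum_power2_gt_zero_iff[THEN iffD2])
  have uhp_nz: "\<tau> \<noteq> 0" if "\<tau> \<in> uhp" for \<tau> using that by (auto simp: uhp_def)
  obtain Cb where Cb: "\<And>y. y \<ge> 1 \<Longrightarrow> norm (g (\<i> * of_real y)) \<le> Cb * exp (- (2 * pi / real L) * y)"
  proof (rule periodic_cuspidal_decay[of "real L" g])
    show "real L > 0" using L by simp
    show "(g \<longlongrightarrow> 0) (filtercomap Im at_top)" unfolding g_def by (rule cusp) simp
    have "(\<lambda>\<tau>. - 1 / \<tau>) holomorphic_on uhp"
      using uhp_nz by (intro holomorphic_intros) auto
    hence "(f \<circ> (\<lambda>\<tau>. - 1 / \<tau>)) holomorphic_on uhp"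
      by (rule holomorphic_on_compose_gen[OF _ hol]) (use inv_uhp in blast)
    hence "(\<lambda>\<tau>. f (- 1 / \<tau>)) holomorphic_on uhp" by (simp only: o_def)
    thus "g holomorphic_on uhp"
      unfolding g[abs_def] using uhp_nz by (intro holomorphic_intros) auto
    fix \<sigma> assume s: "\<sigma> \<in> uhp"
    have s': "\<sigma> + of_nat L \<in> uhp" using s by (simp add: uhp_def)
    have nz: "\<sigma> \<noteq> 0" "\<sigma> + of_nat L \<noteq> 0" using uhp_nz s s' by auto
    have "slash k 1 0 (- int L) 1 f (- 1 / \<sigma>) = f (- 1 / \<sigma>)"
      by (rule inv) (use inv_uhp[OF s] in \<open>auto simp: cong_def\<close>)
    moreover have "slash k 1 0 (- int L) 1 f (- 1 / \<sigma>) =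
        f ((- 1 / \<sigma>) / (- of_nat L * (- 1 / \<sigma>) + 1)) / (- of_nat L * (- 1 / \<sigma>) + 1) ^ k"
      by (simp add: slash_def)
    moreover have "- of_nat L * (- 1 / \<sigma>) + 1 = (\<sigma> + of_nat L) / \<sigma>" using nz by (simp add: field_simps)
    ultimately have "f ((- 1 / \<sigma>) / ((\<sigma> + of_nat L) / \<sigma>)) / ((\<sigma> + of_nat L) / \<sigma>) ^ k = f (- 1 / \<sigma>)"
      by (simp only:)
    moreover have "(- 1 / \<sigma>) / ((\<sigma> + of_nat L) / \<sigma>) = - 1 / (\<sigma> + of_nat L)" using nz by (simp add: field_simps)
    ultimately have "f (- 1 / (\<sigma> + of_nat L)) / ((\<sigma> + of_nat L) / \<sigma>) ^ k = f (- 1 / \<sigma>)" by (simp only:)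
    thus "g (\<sigma> + of_real (real L)) = g \<sigma>"
      unfolding g using nz by (simp add: power_divide field_simps)
  qed blast
  define C where "C = max \<bar>Ca\<bar> \<bar>Cb\<bar>"
  define c where "c = min (2 * pi) (2 * pi / real L)"
  have c_le: "exp (- (2 * pi) * y) \<le> exp (- c * y)" "exp (- (2 * pi / real L) * y) \<le> exp (- c * y)" if "y \<ge> 1" for y :: real
  proof -
    have "c \<le> 2 * pi" "c \<le> 2 * pi / real L" by (simp_all add: c_def)
    hence "c * y \<le> 2 * pi * y" "c * y \<le> 2 * pi / real L * y"
      using that by (intro mult_right_mono; simp)+
    thus "exp (- (2 * pi) * y) \<le> exp (- c * y)" "exp (- (2 * pi / real L) * y) \<le> exp (- c * y)" by auto
  qed
  interpret rapid_decay \<phi> C c k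
  proof
    show "continuous_on {0<..} \<phi>" by (rule cont_phi)
    show "c > 0" using L by (simp add: c_def)
    fix y :: real assume y: "y \<ge> 1"
    have "norm (\<phi> y) \<le> Ca * exp (- (2 * pi) * y)" using Ca[OF y] by (simp add: \<phi>_def)
    also have "\<dots> \<le> C * exp (- c * y)" using c_le(1)[OF y] by (intro mult_mono) (auto simp: C_def)
    finally show "norm (\<phi> y) \<le> C * exp (- c * y)" .
    have "- 1 / (\<i> * of_real y) = \<i> * of_real (1 / y)" using y by (simp add: field_simps)
    hence "\<phi> (1 / y) = g (\<i> * of_real y) * (\<i> * of_real y) ^ k"
      unfolding \<phi>_def g using y by simp
    hence "norm (\<phi> (1 / y)) = norm (g (\<i> * of_real y)) * y ^ k" using y by (simp add: norm_mult norm_power)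
    also have "\<dots> \<le> (Cb * exp (- (2 * pi / real L) * y)) * y ^ k" using Cb[OF y] y by (intro mult_right_mono) auto
    also have "\<dots> \<le> (C * exp (- c * y)) * y ^ k"
      using c_le(2)[OF y] y by (intro mult_right_mono mult_mono) (auto simp: C_def)
    finally show "norm (\<phi> (1 / y)) \<le> C * y ^ k * exp (- c * y)" by (simp add: mult_ac)
  qed
  define Lc where "Lc = (\<lambda>z. of_real (2 * pi) powr z * rGamma z * mellin z)"
  have Lc_hol: "Lc holomorphic_on UNIV"
    unfolding Lc_def using mellin_entire by (intro holomorphic_intros holomorphic_rGamma) auto
  define \<sigma> where "\<sigma> = real m + 1"
  have a_sum: "summable (\<lambda>n. norm (a (Suc n)) / real (Suc n) powr x)" if x: "x > \<sigma>" for x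
  proof (rule summable_comparison_test')
    have "summable (\<lambda>n. real n powr (real m - x))" using x by (simp add: summable_real_powr_iff \<sigma>_def)
    hence "summable (\<lambda>n. real (Suc n) powr (real m - x))" by (subst summable_Suc_iff)
    thus "summable (\<lambda>n. C1 * real (Suc n) powr (real m - x))" by (rule summable_mult)
    fix n :: nat
    have "norm (a (Suc n)) / real (Suc n) powr x \<le> C1 * real (Suc n) ^ m / real (Suc n) powr x"
      using a_bound[of "Suc n"] by (intro divide_right_mono) auto
    also have "\<dots> = C1 * real (Suc n) powr (real m - x)" by (simp add: powr_diff powr_realpow)
    finally show "norm (norm (a (Suc n)) / real (Suc n) powr x) \<le> C1 * real (Suc n) powr (real m - x)" by simp
  qed
  have dirichlet: "(\<lambda>n. a (Suc n) / of_nat (Suc n) powr z) sums Lc z" if z: "Re z > \<sigma>" for z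
  proof -
    have z0: "Re z > 0" using z by (simp add: \<sigma>_def)
    define F where "F = (\<lambda>n t. a (Suc n) * (complex_of_real t powr (z - 1) / of_real (exp (2 * pi * real (Suc n) * t))))"
    have pos: "2 * pi * real (Suc n) > 0" for n by simp
    have Fi: "F n absolutely_integrable_on {0<..}" for n
      unfolding F_def by (intro set_integrable_mult_right Gamma_integral_scaled(1)[OF z0 pos])
    have Fint: "integral {0<..} (F n) = a (Suc n) * (Gamma z / of_real (2 * pi * real (Suc n)) powr z)" for n
      unfolding F_def by (simp only: integral_mult_right Gamma_integral_scaled(2)[OF z0 pos])
    have Fnorm: "norm (F n t) = norm (a (Suc n)) * (t powr (Re z - 1) / exp (2 * pi * real (Suc n) * t))" if "t > 0" for n t
      using that by (simp add: F_def norm_mult norm_divide norm_powr_real_powr)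
    have nint: "integral {0<..} (\<lambda>t. norm (F n t)) = norm (a (Suc n)) * (Gamma (Re z) / (2 * pi * real (Suc n)) powr Re z)" for n
    proof -
      have "((\<lambda>t. complex_of_real t powr (of_real (Re z) - 1) / of_real (exp (2 * pi * real (Suc n) * t))) has_integral
         (Gamma (of_real (Re z)) / of_real (2 * pi * real (Suc n)) powr of_real (Re z))) {0<..}"
      proof -
        have z1: "Re (complex_of_real (Re z)) > 0" using z0 by simp
        show ?thesis
          using integrable_integral[OF set_lebesgue_integral_eq_integral(1)[OF Gamma_integral_scaled(1)[OF z1 pos[of n]]]]
          unfolding Gamma_integral_scaled(2)[OF z1 pos[of n]] .
      qed
      from has_integral_linear[OF this bounded_linear_Re]
      have "((\<lambda>t. Re (complex_of_real t powr (of_real (Re z) - 1) / of_real (exp (2 * pi * real (Suc n) * t)))) has_integral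
         Re (Gamma (of_real (Re z)) / of_real (2 * pi * real (Suc n)) powr of_real (Re z))) {0<..}"
        by (simp only: o_def)
      also have "Re (Gamma (of_real (Re z)) / of_real (2 * pi * real (Suc n)) powr of_real (Re z)) =
          Gamma (Re z) / (2 * pi * real (Suc n)) powr Re z"
        using pos[of n] by (simp only: Gamma_complex_of_real powr_of_real less_imp_le of_real_divide[symmetric] Re_complex_of_real)
      finally have "((\<lambda>t. t powr (Re z - 1) / exp (2 * pi * real (Suc n) * t)) has_integral
         Gamma (Re z) / (2 * pi * real (Suc n)) powr Re z) {0<..}"
      proof (rule has_integral_eq[rotated])
        fix t :: real assume t: "t \<in> {0<..}"
        have "complex_of_real t powr (of_real (Re z) - 1) = of_real (t powr (Re z - 1))"
          using t powr_of_real[of t "Re z - 1"] by simp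
        thus "Re (complex_of_real t powr (of_real (Re z) - 1) / of_real (exp (2 * pi * real (Suc n) * t))) =
            t powr (Re z - 1) / exp (2 * pi * real (Suc n) * t)" 
          by (simp only: of_real_divide[symmetric] Re_complex_of_real)
      qed
      from has_integral_mult_right[OF this, of "norm (a (Suc n))"]
      have "((\<lambda>t. norm (F n t)) has_integral norm (a (Suc n)) * (Gamma (Re z) / (2 * pi * real (Suc n)) powr Re z)) {0<..}"
        by (rule has_integral_eq[rotated]) (use Fnorm in auto)
      thus ?thesis by (rule integral_unique)
    qed
    have sumi: "summable (\<lambda>n. integral {0<..} (\<lambda>t. norm (F n t)))"
    proof -
      have "(\<lambda>n. integral {0<..} (\<lambda>t. norm (F n t))) = (\<lambda>n. Gamma (Re z) / (2 * pi) powr Re z * (norm (a (Suc n)) / real (Suc n) powr Re z))"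
        unfolding nint by (simp only: powr_mult[of "2 * pi" "real (Suc n)" for n]) (simp add: mult.commute del: of_nat_Suc)
      thus ?thesis by (simp only:) (rule summable_mult[OF a_sum[OF z]])
    qed
    have key: "(\<lambda>n. F n t) sums (\<phi> t * of_real t powr (z - 1))" "summable (\<lambda>n. norm (F n t))" if t: "t > 0" for t
    proof -
      define q where "q = exp (2 * of_real pi * \<i> * (\<i> * of_real t))"
      have tu: "\<i> * of_real t \<in> uhp" using t by (simp add: uhp_def)
      have q: "norm q < 1" unfolding q_def using nq[OF tu] .
      have ft: "F n t = of_real t powr (z - 1) * (a (Suc n) * q ^ Suc n)" for n
      proof -
        have "q ^ Suc n = exp (2 * of_real pi * \<i> * of_nat (Suc n) * (\<i> * of_real t))" unfolding q_def by (rule qpow[symmetric])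
        also have "2 * of_real pi * \<i> * of_nat (Suc n) * (\<i> * of_real t) = complex_of_real (- (2 * pi * real (Suc n) * t))"
          by (simp add: complex_eq_iff)
        also have "exp \<dots> = of_real (1 / exp (2 * pi * real (Suc n) * t))"
          unfolding exp_of_real exp_minus inverse_eq_divide ..
        finally show ?thesis by (simp add: F_def)
      qed
      have "(\<lambda>n. a n * q ^ n) sums \<phi> t" using ha[OF q] hf[OF tu] by (simp add: \<phi>_def q_def)
      hence "(\<lambda>n. a (Suc n) * q ^ Suc n) sums \<phi> t" 
        by (subst sums_Suc_iff) (simp add: a0)
      from sums_mult[OF this, of "of_real t powr (z - 1)"]
      show "(\<lambda>n. F n t) sums (\<phi> t * of_real t powr (z - 1))" unfolding ft by (simp add: mult.commute)
      \<comment> \<open>a point further out than \<open>q\<close>, for absolute convergence at \<open>q\<close>\<close>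
      define p where "p = (1 + norm q) / 2"
      have p: "norm q < p" "p < 1" "0 < p" using q by (auto simp: p_def add_pos_nonneg)
      have "summable (\<lambda>n. a n * of_real p ^ n)" using ha[of "of_real p"] p by (simp add: sums_iff)
      hence "summable (\<lambda>n. norm (a n * q ^ n))" by (rule powser_insidea) (use p in simp)
      hence "summable (\<lambda>n. norm (a (Suc n) * q ^ Suc n))" by (subst summable_Suc_iff)
      thus "summable (\<lambda>n. norm (F n t))" unfolding ft norm_mult[of "of_real t powr (z - 1)"] by (rule summable_mult)
    qed
    have "(\<lambda>n. integral {0<..} (F n)) sums integral {0<..} (\<lambda>t. \<Sum>n. F n t)"
      by (rule absolutely_integrable_termwise(2)[OF Fi _ sumi]) (use key(2) in auto)
    also have "integral {0<..} (\<lambda>t. \<Sum>n. F n t) = mellin z"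
      unfolding mellin_def using key(1) by (intro integral_cong) (auto simp: sums_iff)
    finally have "(\<lambda>n. of_real (2 * pi) powr z * rGamma z * integral {0<..} (F n)) sums Lc z"
      unfolding Lc_def by (rule sums_mult)
    also have "(\<lambda>n. of_real (2 * pi) powr z * rGamma z * integral {0<..} (F n)) = (\<lambda>n. a (Suc n) / of_nat (Suc n) powr z)"
    proof
      fix n
      have "z \<notin> \<int>\<^sub>\<le>\<^sub>0" using z0 by (auto elim!: nonpos_Ints_cases)
      hence G: "rGamma z * Gamma z = 1" by (simp add: rGamma_inverse_Gamma Gamma_eq_zero_iff)
      have P: "complex_of_real (2 * pi * real (Suc n)) powr z = of_real (2 * pi) powr z * of_nat (Suc n) powr z"
        using powr_times_real[of "of_real (2 * pi)" "of_nat (Suc n)" z] by (simp del: of_nat_Suc)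
      have nz: "complex_of_real (2 * pi) powr z \<noteq> 0" by simp
      have "of_real (2 * pi) powr z * rGamma z * integral {0<..} (F n) = 
        (rGamma z * Gamma z) * (of_real (2 * pi) powr z * a (Suc n) / (of_real (2 * pi) powr z * of_nat (Suc n) powr z))"
        unfolding Fint P by simp
      thus "of_real (2 * pi) powr z * rGamma z * integral {0<..} (F n) = a (Suc n) / of_nat (Suc n) powr z"
        unfolding G using nz by simp
    qed
    finally show ?thesis .
  qed
  have "L_fun f = Lc"
    unfolding L_fun_def qc
  proof (rule the_equality)
    show "Lc holomorphic_on UNIV \<and> (\<exists>\<sigma>. \<forall>z. Re z > \<sigma> \<longrightarrow> (\<lambda>n. a (Suc n) / of_nat (Suc n) powr z) sums Lc z)"
      using Lc_hol dirichlet by blast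
  next
    fix l assume l: "l holomorphic_on UNIV \<and> (\<exists>\<sigma>. \<forall>z. Re z > \<sigma> \<longrightarrow> (\<lambda>n. a (Suc n) / of_nat (Suc n) powr z) sums l z)"
    then obtain \<sigma>' where \<sigma>': "\<And>z. Re z > \<sigma>' \<Longrightarrow> (\<lambda>n. a (Suc n) / of_nat (Suc n) powr z) sums l z" by blast
    show "l = Lc"
    proof
      fix z
      show "l z = Lc z"
      proof (rule analytic_continuation_open[of "{z. Re z > max \<sigma> \<sigma>'}" UNIV l Lc])
        show "open {z. Re z > max \<sigma> \<sigma>'}" by (rule open_halfspace_Re_gt)
        have "of_real (max \<sigma> \<sigma>' + 1) \<in> {z. Re z > max \<sigma> \<sigma>'}" by (simp add: max_def)
        thus "{z. Re z > max \<sigma> \<sigma>'} \<noteq> {}" by blast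
        show "l z = Lc z" if "z \<in> {z. Re z > max \<sigma> \<sigma>'}" for z
          using that dirichlet[of z] \<sigma>'[of z] by (auto intro: sums_unique2)
      qed (use l Lc_hol in auto)
    qed
  qed
  moreover have "mellin 1 = integral {0<..} \<phi>"
    unfolding mellin_def by (intro integral_cong) auto
  ultimately show ?thesis by (simp add: Lc_def \<phi>_def)
qed

section \<open>The L-value as a combination of hypergeometric values\<close>

lemma N2_pos: "N2 r > 0"
proof -
  have "gcd \<lfloor>24 * r\<rfloor> 24 \<le> 48" by (rule order_trans[OF zdvd_imp_le[of _ 24]]) auto
  moreover have "gcd \<lfloor>24 * r\<rfloor> 24 > 0" by (simp add: gcd_pos_int)
  ultimately show ?thesis unfolding N2_def by (simp add: pos_imp_zdiv_pos_iff)
qed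

text \<open>
The bound that makes the Fourier coefficients of a combination of the \<open>K\<^sub>2\<close> grow polynomially.
\<close>
lemma K2_form_growth:
  assumes rs: "(r, s) \<in> S2'"
  shows "\<exists>C\<ge>0. \<forall>\<tau>\<in>uhp. Im \<tau> \<le> 1 \<longrightarrow> norm (K2_form r s \<tau>) \<le> C / Im \<tau> ^ 6"
proof -
  define N :: real where "N = of_int (N2 r)"
  have N: "N > 0" using N2_pos[of r] by (simp add: N_def)
  define C where "C = (2 * (1 + pi * N) / (pi * N)) ^ 6"
  show ?thesis
  proof (intro exI[of _ C] conjI ballI impI)
    show "C \<ge> 0" by (simp add: C_def)
    fix \<tau> assume t: "\<tau> \<in> uhp" "Im \<tau> \<le> 1"
    have y: "Im \<tau> > 0" using t by (simp add: uhp_def)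
    have im: "Im (of_int (N2 r) * \<tau>) = N * Im \<tau>" by (simp add: N_def)
    have "of_int (N2 r) * \<tau> \<in> uhp" using N y unfolding uhp_def mem_Collect_eq im by simp
    from K2_growth[OF this, of r s]
    have "norm (K2_form r s \<tau>) \<le> (2 * (1 + pi * (N * Im \<tau>)) / (pi * (N * Im \<tau>))) ^ 6"
      using rs unfolding K2_form_def im by (auto simp: S2'_def)
    also have "\<dots> \<le> (2 * (1 + pi * N) / (pi * (N * Im \<tau>))) ^ 6"
    proof (intro power_mono divide_right_mono mult_left_mono add_left_mono)
      show "N * Im \<tau> \<le> N" using N y t by simp
    qed (use N y in auto)
    also have "\<dots> = C / Im \<tau> ^ 6" by (simp add: C_def power_divide power_mult_distrib)
    finally show "norm (K2_form r s \<tau>) \<le> C / Im \<tau> ^ 6" .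
  qed
qed

text \<open>
Rescaling by \<open>N(r)\<close> contributes the factor \<open>1/N(r)\<close>, and positivity on the imaginary axis allows
integrating the absolute value.
\<close>
lemma K2_form_integral:
  assumes rs: "(r, s) \<in> S2'"
  shows "((\<lambda>y. K2_form r s (\<i> * of_real y)) has_integral of_real (F_val r s / (2 * pi))) {0<..}"
proof -
  have rs': "0 < r" "r < s" using rs by (auto simp: S2'_def)
  define R :: real where "R = of_rat r"
  define N :: real where "N = of_int (N2 r)"
  have N: "N > 0" using N2_pos[of r] by (simp add: N_def)
  define \<kappa> where "\<kappa> = (\<lambda>y. norm (K2 r s (\<i> * of_real y)))"
  define I where "I = integral {0<..} \<kappa>"
  have I: "I = 16 powr (- R) / pi * (Beta R (of_rat (s - r)) * eval_fps (fps_hypergeo [1/2, 1/2, R] [1, of_rat s] 1) 1)"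
    unfolding I_def \<kappa>_def R_def by (rule K2_imaginary_axis_integral(2)[OF rs'])
  have im: "(\<lambda>y. N * y) ` {0<..} = {0<..}"
  proof (intro equalityI subsetI)
    fix x :: real assume "x \<in> {0<..}"
    thus "x \<in> (\<lambda>y. N * y) ` {0<..}" using N by (intro image_eqI[of _ _ "x / N"]) auto
  qed (use N in auto)
  have "\<kappa> absolutely_integrable_on (\<lambda>y. N * y) ` {0<..} \<and> integral ((\<lambda>y. N * y) ` {0<..}) \<kappa> = I"
    unfolding im using K2_imaginary_axis_integral(1)[OF rs'] by (simp add: \<kappa>_def I_def)
  hence "(\<lambda>y. \<bar>N\<bar> * \<kappa> (N * y)) absolutely_integrable_on {0<..} \<and> integral {0<..} (\<lambda>y. \<bar>N\<bar> * \<kappa> (N * y)) = I"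
    by (rule has_absolute_integral_change_of_variables_1'[THEN iffD2, rotated 3])
       (use N in \<open>auto intro!: derivative_eq_intros inj_onI\<close>)
  hence "((\<lambda>y. \<bar>N\<bar> * \<kappa> (N * y)) has_integral I) {0<..}"
    using set_lebesgue_integral_eq_integral(1) integrable_integral by metis
  from has_integral_mult_right[OF this, of "1 / N"]
  have "((\<lambda>y. \<kappa> (N * y)) has_integral I / N) {0<..}" using N by simp
  from has_integral_linear[OF this bounded_linear_of_real]
  have "((\<lambda>y. complex_of_real (\<kappa> (N * y))) has_integral of_real (I / N)) {0<..}" by (simp only: o_def)
  hence "((\<lambda>y. K2_form r s (\<i> * of_real y)) has_integral of_real (I / N)) {0<..}"
  proof (rule has_integral_eq[rotated])
    fix y :: real assume y: "y \<in> {0<..}"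
    have e: "of_int (N2 r) * (\<i> * of_real y) = \<i> * complex_of_real (N * y)" by (simp add: N_def)
    have "\<i> * complex_of_real (N * y) \<in> uhp" using y N by (simp add: uhp_def)
    from K2_norm(2)[OF this, of r s]
    show "of_real (\<kappa> (N * y)) = K2_form r s (\<i> * of_real y)"
      unfolding K2_form_def e \<kappa>_def by simp
  qed
  moreover have "I / N = F_val r s / (2 * pi)"
  proof -
    have "2 powr (1 - 4 * R) = 2 * (2 powr 4) powr (- R)" 
      unfolding powr_powr by (simp add: powr_diff powr_minus field_simps)
    hence "2 powr (1 - 4 * R) = 2 * 16 powr (- R)" by simp
    thus ?thesis unfolding F_val_def I R_def N_def by simp
  qed
  ultimately show ?thesis by simp
qed

text \<open>
An eigenform is a cusp form, to which Hecke's argument applies; the growth bound and the integral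
over the imaginary axis are additive over the family.
\<close>
theorem corollary1p2:
  fixes b :: nat and s :: "nat \<Rightarrow> rat" and \<beta> :: "nat \<Rightarrow> complex"
    and f :: "complex \<Rightarrow> complex"
  assumes "b > 0"
    and "galois_family ((\<lambda>i. (of_nat i / of_nat b, s i)) ` totatives b)"
    and "\<And>i. i \<in> totatives b \<Longrightarrow> algebraic (\<beta> i)"
    and "\<beta> 1 = 1"
    and "f = (\<lambda>\<tau>. \<Sum>i\<in>totatives b. \<beta> i * K2_form (of_nat i / of_nat b) (s i) \<tau>)"
    and "hecke_eigenform 6 3 f"
  shows "L_fun f 1 = (\<Sum>i\<in>totatives b. \<beta> i * of_real (F_val (of_nat i / of_nat b) (s i)))"
proof -
  define r where "r = (\<lambda>i. of_nat i / of_nat b :: rat)"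
  have rs: "(r i, s i) \<in> S2'" if "i \<in> totatives b" for i
    using assms(2) that unfolding galois_family_def conjugate_family_def r_def by blast
  have f: "f \<tau> = (\<Sum>i\<in>totatives b. \<beta> i * K2_form (r i) (s i) \<tau>)" for \<tau>
    by (simp add: assms(5) r_def)
  obtain L where L: "L > 0" "cusp_form 3 L f"
    using assms(6) unfolding hecke_eigenform_def by blast
  have "\<forall>i\<in>totatives b. \<exists>C. C \<ge> 0 \<and> (\<forall>\<tau>\<in>uhp. Im \<tau> \<le> 1 \<longrightarrow> norm (K2_form (r i) (s i) \<tau>) \<le> C / Im \<tau> ^ 6)"
    using K2_form_growth[OF rs] by blast
  from bchoice[OF this] obtain C where C: "\<forall>i\<in>totatives b. C i \<ge> 0 \<and>
      (\<forall>\<tau>\<in>uhp. Im \<tau> \<le> 1 \<longrightarrow> norm (K2_form (r i) (s i) \<tau>) \<le> C i / Im \<tau> ^ 6)" ..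
  have "L_fun f 1 = 2 * pi * integral {0<..} (\<lambda>y. f (\<i> * of_real y))"
  proof (rule L_fun_cusp_form_at_1[OF L(2,1)])
    fix \<tau> assume t: "\<tau> \<in> uhp" "Im \<tau> \<le> 1"
    have "norm (f \<tau>) \<le> (\<Sum>i\<in>totatives b. norm (\<beta> i) * (C i / Im \<tau> ^ 6))"
      unfolding f by (intro sum_norm_le) (unfold norm_mult, intro mult_left_mono, use C t in auto)
    also have "\<dots> = (\<Sum>i\<in>totatives b. norm (\<beta> i) * C i) / Im \<tau> ^ 6" by (simp add: sum_divide_distrib)
    finally show "norm (f \<tau>) \<le> (\<Sum>i\<in>totatives b. norm (\<beta> i) * C i) / Im \<tau> ^ 6" .
  qed
  also have "((\<lambda>y. f (\<i> * of_real y)) has_integral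
      (\<Sum>i\<in>totatives b. \<beta> i * of_real (F_val (r i) (s i) / (2 * pi)))) {0<..}"
    unfolding f by (intro has_integral_sum has_integral_mult_right K2_form_integral rs) auto
  hence "integral {0<..} (\<lambda>y. f (\<i> * of_real y)) = (\<Sum>i\<in>totatives b. \<beta> i * of_real (F_val (r i) (s i) / (2 * pi)))"
    by (rule integral_unique)
  also have "2 * pi * (\<Sum>i\<in>totatives b. \<beta> i * of_real (F_val (r i) (s i) / (2 * pi))) =
      (\<Sum>i\<in>totatives b. \<beta> i * of_real (F_val (r i) (s i)))"
    by (simp add: sum_distrib_left)
  finally show ?thesis by (simp add: r_def)
qed

end
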